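(* Let $K\subset S^3$ be an oriented knot with exterior $X$, $\Gamma=\pi_1(X)$, and let $\varphi\colon\Gamma\to\mathbf Z$ be the abelianization map. Let $a,b\ge 1$, $n=a+b$, and let $\alpha\colon\Gamma\to\mathrm{SL}_a(\mathbf C)$ and $\beta\colon\Gamma\to\mathrm{SL}_b(\mathbf C)$ be irreducible and infinitesimally regular representations. Let $\lambda\in\mathbf C^*$ and let $\rho_\lambda=(\lambda^{b\varphi}\otimes\alpha)\oplus(\lambda^{-a\varphi}\otimes\beta)\colon\Gamma\to\mathrm{SL}_n(\mathbf C)$. Assume that $\rho_\lambda$ can be deformed to irreducible representations. Then $$\Delta_1^+(\lambda^n)=\Delta_1^-(\lambda^{-n})=0 .$$
   Context: $X=S^3\setminus\mathcal N(K)$ is the complement of an open tubular neighbourhood of $K$; $\varphi(\gamma)$ is the linking number of $\gamma$ with $K$. $R(\Gamma,\mathrm{SL}_n(\mathbf C))=\mathrm{Hom}(\Gamma,\mathrm{SL}_n(\mathbf C))$ is the affine algebraic set of representations. A representation $\alpha\colon\Gamma\to\mathrm{SL}_a(\mathbf C)$ is infinitesimally regular if $\dim H^1(\Gamma;\mathfrak{sl}_a(\mathbf C)_{\mathrm{Ad}\,\alpha})=a-1$, where $\gamma\in\Gamma$ acts on $\mathfrak{sl}_a(\mathbf C)$ by $\mathrm{Ad}_{\alpha(\gamma)}$ (for $a=1$ the trivial representation is irreducible and infinitesimally regular). Explicitly, $\rho_\lambda(\gamma)=\begin{pmatrix}\lambda^{b\varphi(\gamma)}\alpha(\gamma)&0\\0&\lambda^{-a\varphi(\gamma)}\beta(\gamma)\end{pmatrix}$.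 "$\rho_\lambda$ can be deformed to irreducible representations" means that $\rho_\lambda$ belongs to an irreducible component of $R(\Gamma,\mathrm{SL}_n(\mathbf C))$ that contains irreducible representations. Twisted Alexander polynomials: for a finite-dimensional complex representation $\rho\colon\Gamma\to\mathrm{GL}(V)$, let $V[\mathbf Z]=V\otimes_{\mathbf C}\mathbf C[t^{\pm1}]$ with $\gamma\cdot(v\otimes p)=\rho(\gamma)v\otimes t^{\varphi(\gamma)}p$. Then $H_i(\Gamma;V[\mathbf Z])$ is a finitely generated $\mathbf C[t^{\pm1}]$-module (isomorphic to $H_i$ of the infinite cyclic cover of $X$ with coefficients in $V$), and $\Delta_i^\rho(t)\in\mathbf C[t^{\pm1}]$ is its order: if the module is $\bigoplus_j\mathbf C[t^{\pm1}]/(p_j)$, the order is $\prod_jp_j$ (so it is $0$ if the module is not torsion); it is defined up to units $c\,t^k$, $c\in\mathbf C^*$, $k\in\mathbf Z$. $\alpha\otimes\beta^*$ is the representation of $\Gamma$ on $M_{a\times b}(\mathbf C)$ given by $\gamma\cdot A=\alpha(\gamma)A\beta(\gamma)^{-1}$, and $\beta\otimes\alpha^*$ the one on $M_{b\times a}(\mathbf C)$ given by $\gamma\cdot B=\beta(\gamma)B\alpha(\gamma)^{-1}$. $\Delta_i^+=\Delta_i^{\alpha\otimes\beta^*}$ and $\Delta_i^-=\Delta_i^{\beta\otimes\alpha^*}$. *)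

theory Defs
  imports
    "HOL-Analysis.Analysis"
    "HOL-Algebra.Elementary_Groups"
    "HOL-Algebra.Generated_Groups"
    "HOL-Library.Poly_Mapping"
begin

section \<open>The fundamental group\<close>

definition path_class :: "'x::topological_space set \<Rightarrow> (real \<Rightarrow> 'x) \<Rightarrow> (real \<Rightarrow> 'x) set" where
  "path_class X p = {q. homotopic_paths X p q}"

definition loops_at :: "'x::topological_space set \<Rightarrow> 'x \<Rightarrow> (real \<Rightarrow> 'x) set" where
  "loops_at X x0 = {p. path p \<and> path_image p \<subseteq> X \<and> pathstart p = x0 \<and> pathfinish p = x0}"

definition fundamental_group ::
    "'x::real_normed_vector set \<Rightarrow> 'x \<Rightarrow> (real \<Rightarrow> 'x) set monoid" where
  "fundamental_group X x0 =
     \<lparr>carrier = path_class X ` loops_at X x0,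
      monoid.mult = (\<lambda>A B. {r. \<exists>p\<in>A. \<exists>q\<in>B. homotopic_paths X (p +++ q) r}),
      one = path_class X (linepath x0 x0)\<rparr>"

lemma path_class_eqI: "homotopic_paths X p q \<Longrightarrow> path_class X p = path_class X q"
  unfolding path_class_def using homotopic_paths_sym homotopic_paths_trans by blast

lemma mult_path_class:
  assumes "p \<in> loops_at X x0" "q \<in> loops_at X x0"
  shows "path_class X p \<otimes>\<^bsub>fundamental_group X x0\<^esub> path_class X q = path_class X (p +++ q)"
proof -
  have pq: "homotopic_paths X p p" "homotopic_paths X q q" "pathfinish p = pathstart q"
    using assms by (simp_all add: loops_at_def)
  have "homotopic_paths X (p +++ q) r"
    if "homotopic_paths X p p'" "homotopic_paths X q q'" "homotopic_paths X (p' +++ q') r" for p' q' r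
    using homotopic_paths_join[OF that(1,2) pq(3)] that(3) by (rule homotopic_paths_trans)
  then show ?thesis
    using pq(1,2) unfolding fundamental_group_def path_class_def monoid.simps by blast
qed

lemma loops_at_join: "p \<in> loops_at X x0 \<Longrightarrow> q \<in> loops_at X x0 \<Longrightarrow> p +++ q \<in> loops_at X x0"
  by (simp add: loops_at_def path_image_join)

lemma group_fundamental_group:
  assumes "x0 \<in> X"
  shows "group (fundamental_group X x0)"
proof -
  let ?G = "fundamental_group X x0"
  have car: "carrier ?G = path_class X ` loops_at X x0"
    and one: "\<one>\<^bsub>?G\<^esub> = path_class X (linepath x0 x0)"
    by (simp_all add: fundamental_group_def)
  have const: "linepath x0 x0 \<in> loops_at X x0"
    using assms by (simp add: loops_at_def)
  show ?thesis
  proof (rule groupI)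
    fix A B assume "A \<in> carrier ?G" "B \<in> carrier ?G"
    then obtain p q where pq: "p \<in> loops_at X x0" "q \<in> loops_at X x0"
      "A = path_class X p" "B = path_class X q"
      unfolding car by blast
    show "A \<otimes>\<^bsub>?G\<^esub> B \<in> carrier ?G"
      unfolding pq(3,4) mult_path_class[OF pq(1,2)] car using loops_at_join[OF pq(1,2)] by (rule imageI)
  next
    show "\<one>\<^bsub>?G\<^esub> \<in> carrier ?G" unfolding one car using const by (rule imageI)
  next
    fix A B C assume "A \<in> carrier ?G" "B \<in> carrier ?G" "C \<in> carrier ?G"
    then obtain p q r where pqr: "p \<in> loops_at X x0" "q \<in> loops_at X x0" "r \<in> loops_at X x0"
      and eq: "A = path_class X p" "B = path_class X q" "C = path_class X r"
      unfolding car by blast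
    have "path_class X (p +++ (q +++ r)) = path_class X ((p +++ q) +++ r)"
      using pqr by (intro path_class_eqI homotopic_paths_assoc) (simp_all add: loops_at_def)
    then show "A \<otimes>\<^bsub>?G\<^esub> B \<otimes>\<^bsub>?G\<^esub> C = A \<otimes>\<^bsub>?G\<^esub> (B \<otimes>\<^bsub>?G\<^esub> C)"
      unfolding eq using pqr by (simp only: mult_path_class loops_at_join)
  next
    fix A assume "A \<in> carrier ?G"
    then obtain p where p: "p \<in> loops_at X x0" and A: "A = path_class X p"
      unfolding car by blast
    have "homotopic_paths X (linepath x0 x0 +++ p) p"
      using p homotopic_paths_lid[of p X] by (simp add: loops_at_def)
    then show "\<one>\<^bsub>?G\<^esub> \<otimes>\<^bsub>?G\<^esub> A = A"
      unfolding one A mult_path_class[OF const p] by (rule path_class_eqI)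
    have rev: "reversepath p \<in> loops_at X x0"
      using p by (simp add: loops_at_def)
    have "homotopic_paths X (reversepath p +++ p) (linepath x0 x0)"
      using p homotopic_paths_linv[of p X] by (simp add: loops_at_def)
    then have "path_class X (reversepath p) \<otimes>\<^bsub>?G\<^esub> A = \<one>\<^bsub>?G\<^esub>"
      unfolding one A mult_path_class[OF rev p] by (rule path_class_eqI)
    moreover have "path_class X (reversepath p) \<in> carrier ?G"
      unfolding car using rev by (rule imageI)
    ultimately show "\<exists>B\<in>carrier ?G. B \<otimes>\<^bsub>?G\<^esub> A = \<one>\<^bsub>?G\<^esub>" by blast
  qed
qed


section \<open>Oriented knots, exteriors, and the linking number\<close>

text \<open>On a finite-dimensional space this is \<open>C\<^sup>\<infinity>\<close>: all iterated directional derivatives exist and are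
  (Frechet) differentiable.\<close>

coinductive smooth :: "('x::real_normed_vector \<Rightarrow> 'y::real_normed_vector) \<Rightarrow> bool" where
  "\<lbrakk>\<And>x. f differentiable (at x);
    \<And>v. smooth (\<lambda>x. frechet_derivative f (at x) v)\<rbrakk> \<Longrightarrow> smooth f"

text \<open>An oriented knot in \<open>S\<^sup>3 \<subseteq> \<real>\<^sup>4\<close> is given by a smooth embedding \<open>k\<close> of \<open>\<real>/\<int>\<close>; its
  orientation is the direction of increasing parameter.\<close>

definition oriented_knot :: "(real \<Rightarrow> real^4) \<Rightarrow> bool" where
  "oriented_knot k \<longleftrightarrow>
     smooth k \<and> range k \<subseteq> sphere 0 1 \<and>
     (\<forall>s s'. k s = k s' \<longleftrightarrow> s - s' \<in> \<int>) \<and>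
     (\<forall>s. vector_derivative k (at s) \<noteq> 0)"

text \<open>A parametrised tubular neighbourhood of the knot: a smooth embedding \<open>T\<close> of \<open>\<real>/\<int> \<times> \<complex>\<close>
  into \<open>S\<^sup>3\<close> with core \<open>k\<close>. The open tubular neighbourhood that gets removed is the image of the
  open unit disc bundle, so that its closure is an embedded solid torus. The determinant condition
  contains that \<open>T\<close> is an immersion, and says that \<open>T\<close> preserves orientation when \<open>S\<^sup>3\<close> is oriented
  as the boundary of the unit ball (outward normal \<open>T (s, z)\<close> first). It is no restriction on the
  neighbourhood: otherwise replace \<open>T (s, z)\<close> by \<open>T (s, cnj z)\<close>.\<close>

definition tubular_nbhd :: "(real \<Rightarrow> real^4) \<Rightarrow> (real \<times> complex \<Rightarrow> real^4) \<Rightarrow> bool" where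
  "tubular_nbhd k T \<longleftrightarrow>
     smooth T \<and> range T \<subseteq> sphere 0 1 \<and>
     (\<forall>s. T (s, 0) = k s) \<and>
     (\<forall>s z s' z'. T (s, z) = T (s', z') \<longleftrightarrow> s - s' \<in> \<int> \<and> z = z') \<and>
     (\<forall>x. det (vector [T x,
                       frechet_derivative T (at x) (1, 0),
                       frechet_derivative T (at x) (0, 1),
                       frechet_derivative T (at x) (0, \<i>)] :: real^4^4) > 0)"

definition knot_exterior :: "(real \<times> complex \<Rightarrow> real^4) \<Rightarrow> (real^4) set" where
  "knot_exterior T = sphere 0 1 - T ` (UNIV \<times> ball 0 1)"

definition meridian :: "(real \<times> complex \<Rightarrow> real^4) \<Rightarrow> real \<Rightarrow> real^4" where
  "meridian T t = T (0, exp (2 * of_real pi * \<i> * of_real t))"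

text \<open>\<open>\<phi>\<close> is the abelianization \<open>\<pi>\<^sub>1(X, x0) \<rightarrow> \<int>\<close>, i.e. an epimorphism whose kernel is the commutator
  subgroup. This determines \<open>\<phi>\<close> up to sign; the sign is that of the linking number with the
  oriented knot, which takes the value \<open>1\<close> on the meridian turning by the right-hand rule. The
  meridian is attached to the base point by an arbitrary path \<open>p\<close> in the exterior.\<close>

definition knot_abelianization ::
    "(real \<times> complex \<Rightarrow> real^4) \<Rightarrow> real^4 \<Rightarrow> ((real \<Rightarrow> real^4) set \<Rightarrow> int) \<Rightarrow> bool" where
  "knot_abelianization T x0 \<phi> \<longleftrightarrow>
     (let X = knot_exterior T; G = fundamental_group X x0 in
        \<phi> \<in> hom G integer_group \<and>
        \<phi> ` carrier G = UNIV \<and>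
        kernel G integer_group \<phi> = derived G (carrier G) \<and>
        (\<forall>p. path p \<and> path_image p \<subseteq> X \<and> pathstart p = x0 \<and> pathfinish p = meridian T 0 \<longrightarrow>
             \<phi> (path_class X (p +++ (meridian T +++ reversepath p))) = 1))"


section \<open>Representations into \<open>SL\<^sub>n(\<complex>)\<close>\<close>

definition SL :: "(complex^'n^'n) monoid" where
  "SL = \<lparr>carrier = {A. det A = 1}, monoid.mult = (**), one = mat 1\<rparr>"

lemma group_SL: "group (SL :: (complex^'n^'n) monoid)"
proof (rule groupI)
  fix A :: "complex^'n^'n" assume "A \<in> carrier SL"
  then have A: "det A = 1" by (simp add: SL_def)
  then have "invertible A" by (simp add: invertible_det_nz)
  then obtain B where B: "B ** A = mat 1" unfolding invertible_def by blast
  then have "det B = 1" using A det_mul[of B A] by simp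
  with B show "\<exists>B\<in>carrier SL. B \<otimes>\<^bsub>SL\<^esub> A = \<one>\<^bsub>SL\<^esub>" by (auto simp: SL_def)
qed (auto simp: SL_def det_mul matrix_mul_assoc)

text \<open>Homomorphisms are made extensional, so that a point of the representation variety is
  a function on the group and not on the ambient type.\<close>

definition rep_variety :: "'g monoid \<Rightarrow> ('g \<Rightarrow> complex^'n^'n) set" where
  "rep_variety G = hom G SL \<inter> extensional (carrier G)"

definition irreducible_rep :: "'g monoid \<Rightarrow> ('g \<Rightarrow> complex^'n^'n) \<Rightarrow> bool" where
  "irreducible_rep G \<rho> \<longleftrightarrow>
     (\<forall>W. vec.subspace W \<and> (\<forall>g\<in>carrier G. \<forall>w\<in>W. \<rho> g *v w \<in> W) \<longrightarrow> W = {0} \<or> W = UNIV)"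

text \<open>Zariski topology on the representation variety. The polynomial functions are generated by the
  matrix entries of all \<open>\<rho> g\<close>. For a finitely generated group these are the polynomials in the matrix
  entries of the images of the generators, as the entries of \<open>(\<rho> g)\<^sup>-\<^sup>1\<close> are cofactors of \<open>\<rho> g\<close>.\<close>

inductive_set polynomial_functions :: "'g monoid \<Rightarrow> (('g \<Rightarrow> complex^'n^'n) \<Rightarrow> complex) set"
  for G :: "'g monoid" where
  const: "(\<lambda>_. c) \<in> polynomial_functions G"
| entry: "g \<in> carrier G \<Longrightarrow> (\<lambda>\<rho>. \<rho> g $ i $ j) \<in> polynomial_functions G"
| add: "f \<in> polynomial_functions G \<Longrightarrow> h \<in> polynomial_functions G
          \<Longrightarrow> (\<lambda>\<rho>. f \<rho> + h \<rho>) \<in> polynomial_functions G"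
| mult: "f \<in> polynomial_functions G \<Longrightarrow> h \<in> polynomial_functions G
          \<Longrightarrow> (\<lambda>\<rho>. f \<rho> * h \<rho>) \<in> polynomial_functions G"

definition zariski_closed :: "'g monoid \<Rightarrow> ('g \<Rightarrow> complex^'n^'n) set \<Rightarrow> bool" where
  "zariski_closed G Z \<longleftrightarrow>
     (\<exists>F \<subseteq> polynomial_functions G. Z = {\<rho> \<in> rep_variety G. \<forall>f\<in>F. f \<rho> = 0})"

definition zariski_irreducible :: "'g monoid \<Rightarrow> ('g \<Rightarrow> complex^'n^'n) set \<Rightarrow> bool" where
  "zariski_irreducible G Z \<longleftrightarrow>
     Z \<noteq> {} \<and> Z \<subseteq> rep_variety G \<and>
     (\<forall>A B. zariski_closed G A \<and> zariski_closed G B \<and> Z \<subseteq> A \<union> B \<longrightarrow> Z \<subseteq> A \<or> Z \<subseteq> B)"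

definition irreducible_component :: "'g monoid \<Rightarrow> ('g \<Rightarrow> complex^'n^'n) set \<Rightarrow> bool" where
  "irreducible_component G Z \<longleftrightarrow>
     zariski_irreducible G Z \<and> (\<forall>Y. zariski_irreducible G Y \<and> Z \<subseteq> Y \<longrightarrow> Y = Z)"

definition deformable_to_irreducible :: "'g monoid \<Rightarrow> ('g \<Rightarrow> complex^'n^'n) \<Rightarrow> bool" where
  "deformable_to_irreducible G \<rho> \<longleftrightarrow>
     (\<exists>Z. irreducible_component G Z \<and> \<rho> \<in> Z \<and> (\<exists>\<sigma>\<in>Z. irreducible_rep G \<sigma>))"

definition matrix_smult :: "complex \<Rightarrow> complex^'m^'n \<Rightarrow> complex^'m^'n" where
  "matrix_smult c A = map_matrix (\<lambda>x. c * x) A"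

definition block_diag :: "complex^'a^'a \<Rightarrow> complex^'b^'b \<Rightarrow> complex^('a + 'b)^('a + 'b)" where
  "block_diag A B = (\<chi> i j. case (i, j) of
       (Inl i', Inl j') \<Rightarrow> A $ i' $ j'
     | (Inr i', Inr j') \<Rightarrow> B $ i' $ j'
     | _ \<Rightarrow> 0)"

definition rho_sum :: "'g monoid \<Rightarrow> ('g \<Rightarrow> int) \<Rightarrow> complex \<Rightarrow>
    ('g \<Rightarrow> complex^'a^'a) \<Rightarrow> ('g \<Rightarrow> complex^'b^'b) \<Rightarrow> 'g \<Rightarrow> complex^('a + 'b)^('a + 'b)" where
  "rho_sum G \<phi> l \<alpha> \<beta> = (\<lambda>g\<in>carrier G.
     block_diag (matrix_smult (l powi (int CARD('b) * \<phi> g)) (\<alpha> g))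
                (matrix_smult (l powi (- int CARD('a) * \<phi> g)) (\<beta> g)))"


section \<open>First cohomology and infinitesimal regularity\<close>

text \<open>Cochains are only constrained on the carrier of the group; the values elsewhere are
  irrelevant and are factored out together with the coboundaries.\<close>

definition cocycles1 :: "'g monoid \<Rightarrow> 'v::ab_group_add set \<Rightarrow> ('g \<Rightarrow> 'v \<Rightarrow> 'v) \<Rightarrow> ('g \<Rightarrow> 'v) set" where
  "cocycles1 G V act =
     {z. (\<forall>g\<in>carrier G. z g \<in> V) \<and>
         (\<forall>g\<in>carrier G. \<forall>h\<in>carrier G. z (g \<otimes>\<^bsub>G\<^esub> h) = z g + act g (z h))}"

definition coboundaries1 :: "'g monoid \<Rightarrow> 'v::ab_group_add set \<Rightarrow> ('g \<Rightarrow> 'v \<Rightarrow> 'v) \<Rightarrow> ('g \<Rightarrow> 'v) set" where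
  "coboundaries1 G V act = {z. \<exists>v\<in>V. \<forall>g\<in>carrier G. z g = act g v - v}"

text \<open>\<open>dim H\<^sup>1(G; V) = d\<close>: there are \<open>d\<close> cocycles whose classes form a basis of the
  quotient of the space of cocycles by the space of coboundaries; \<open>sc\<close> is scalar multiplication on \<open>V\<close>.\<close>

definition H1_has_dim ::
    "'g monoid \<Rightarrow> (complex \<Rightarrow> 'v \<Rightarrow> 'v) \<Rightarrow> 'v::ab_group_add set \<Rightarrow> ('g \<Rightarrow> 'v \<Rightarrow> 'v) \<Rightarrow> nat \<Rightarrow> bool" where
  "H1_has_dim G sc V act d \<longleftrightarrow>
     (\<exists>z. (\<forall>j<d. z j \<in> cocycles1 G V act) \<and>
          (\<forall>y\<in>cocycles1 G V act. \<exists>r. (\<lambda>g. y g - (\<Sum>j<d. sc (r j) (z j g))) \<in> coboundaries1 G V act) \<and>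
          (\<forall>r. (\<lambda>g. \<Sum>j<d. sc (r j) (z j g)) \<in> coboundaries1 G V act \<longrightarrow> (\<forall>j<d. r j = 0)))"

definition infinitesimally_regular :: "'g monoid \<Rightarrow> ('g \<Rightarrow> complex^'a^'a) \<Rightarrow> bool" where
  "infinitesimally_regular G \<alpha> \<longleftrightarrow>
     H1_has_dim G matrix_smult {A. trace A = 0}
       (\<lambda>g A. \<alpha> g ** A ** matrix_inv (\<alpha> g)) (CARD('a) - 1)"


section \<open>Group homology with coefficients in a left module\<close>

text \<open>The inhomogeneous bar complex: \<open>i\<close>-chains are finite sums of terms \<open>m \<otimes> [g\<^sub>1|...|g\<^sub>i]\<close>, encoded as
  finitely supported functions on lists of length \<open>i\<close>. The left action \<open>act\<close> is turned into a right
  action by inversion, so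
  \<open>\<partial>(m \<otimes> [g\<^sub>1|...|g\<^sub>i]) = g\<^sub>1\<^sup>-\<^sup>1m \<otimes> [g\<^sub>2|...|g\<^sub>i] + \<Sum>\<^sub>j (-1)\<^sup>j m \<otimes> [...|g\<^sub>jg\<^sub>j\<^sub>+\<^sub>1|...] + (-1)\<^sup>i m \<otimes> [g\<^sub>1|...|g\<^sub>i\<^sub>-\<^sub>1]\<close>
  for \<open>i > 0\<close>, and \<open>\<partial> = 0\<close> on \<open>0\<close>-chains.\<close>

definition chains :: "'g monoid \<Rightarrow> nat \<Rightarrow> ('g list \<Rightarrow>\<^sub>0 'm::ab_group_add) set" where
  "chains G i = {c. \<forall>gs\<in>Poly_Mapping.keys c. set gs \<subseteq> carrier G \<and> length gs = i}"

definition signed :: "nat \<Rightarrow> 'm::ab_group_add \<Rightarrow> 'm" where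
  "signed j m = (if even j then m else - m)"

definition bar_boundary_term ::
    "'g monoid \<Rightarrow> ('g \<Rightarrow> 'm \<Rightarrow> 'm) \<Rightarrow> 'g list \<Rightarrow> 'm::ab_group_add \<Rightarrow> ('g list \<Rightarrow>\<^sub>0 'm)" where
  "bar_boundary_term G act gs m =
     (if gs = [] then 0
      else Poly_Mapping.single (tl gs) (act (inv\<^bsub>G\<^esub> (hd gs)) m)
         + (\<Sum>j\<in>{1..<length gs}.
              Poly_Mapping.single
                (take (j - 1) gs @ [gs ! (j - 1) \<otimes>\<^bsub>G\<^esub> gs ! j] @ drop (j + 1) gs) (signed j m))
         + Poly_Mapping.single (butlast gs) (signed (length gs) m))"

definition bar_boundary ::
    "'g monoid \<Rightarrow> ('g \<Rightarrow> 'm \<Rightarrow> 'm) \<Rightarrow> ('g list \<Rightarrow>\<^sub>0 'm::ab_group_add) \<Rightarrow> ('g list \<Rightarrow>\<^sub>0 'm)" where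
  "bar_boundary G act c =
     (\<Sum>gs\<in>Poly_Mapping.keys c. bar_boundary_term G act gs (Poly_Mapping.lookup c gs))"

definition bar_cycles :: "'g monoid \<Rightarrow> ('g \<Rightarrow> 'm \<Rightarrow> 'm) \<Rightarrow> nat \<Rightarrow> ('g list \<Rightarrow>\<^sub>0 'm::ab_group_add) set" where
  "bar_cycles G act i = {c \<in> chains G i. bar_boundary G act c = 0}"

definition bar_boundaries :: "'g monoid \<Rightarrow> ('g \<Rightarrow> 'm \<Rightarrow> 'm) \<Rightarrow> nat \<Rightarrow> ('g list \<Rightarrow>\<^sub>0 'm::ab_group_add) set" where
  "bar_boundaries G act i = bar_boundary G act ` chains G (Suc i)"


section \<open>Twisted Alexander polynomials\<close>

text \<open>The ring \<open>\<complex>[t\<^sup>\<plusminus>\<^sup>1]\<close>, with \<open>t\<^sup>k = Poly_Mapping.single k 1\<close> and convolution as multiplication.\<close>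

type_synonym laurent = "int \<Rightarrow>\<^sub>0 complex"

definition laurent_eval :: "laurent \<Rightarrow> complex \<Rightarrow> complex" where
  "laurent_eval p x = (\<Sum>k\<in>Poly_Mapping.keys p. Poly_Mapping.lookup p k * x powi k)"

text \<open>\<open>V[\<int>] = V \<otimes> \<complex>[t\<^sup>\<plusminus>\<^sup>1]\<close> is the type \<open>int \<Rightarrow>\<^sub>0 'v\<close>, with \<open>v \<otimes> t\<^sup>k = Poly_Mapping.single k v\<close>.\<close>

definition laurent_smult ::
    "(complex \<Rightarrow> 'v \<Rightarrow> 'v) \<Rightarrow> laurent \<Rightarrow> (int \<Rightarrow>\<^sub>0 'v::ab_group_add) \<Rightarrow> (int \<Rightarrow>\<^sub>0 'v)" where
  "laurent_smult sc p x =
     (\<Sum>k\<in>Poly_Mapping.keys p. \<Sum>l\<in>Poly_Mapping.keys x.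
        Poly_Mapping.single (k + l) (sc (Poly_Mapping.lookup p k) (Poly_Mapping.lookup x l)))"

definition twisted_action ::
    "('g \<Rightarrow> int) \<Rightarrow> ('g \<Rightarrow> 'v \<Rightarrow> 'v) \<Rightarrow> 'g \<Rightarrow> (int \<Rightarrow>\<^sub>0 'v::ab_group_add) \<Rightarrow> (int \<Rightarrow>\<^sub>0 'v)" where
  "twisted_action \<phi> act g x =
     (\<Sum>l\<in>Poly_Mapping.keys x. Poly_Mapping.single (l + \<phi> g) (act g (Poly_Mapping.lookup x l)))"

definition chain_smult ::
    "(complex \<Rightarrow> 'v \<Rightarrow> 'v) \<Rightarrow> laurent \<Rightarrow> ('g list \<Rightarrow>\<^sub>0 int \<Rightarrow>\<^sub>0 'v::ab_group_add) \<Rightarrow> ('g list \<Rightarrow>\<^sub>0 int \<Rightarrow>\<^sub>0 'v)" where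
  "chain_smult sc p c =
     (\<Sum>gs\<in>Poly_Mapping.keys c.
        Poly_Mapping.single gs (laurent_smult sc p (Poly_Mapping.lookup c gs)))"

text \<open>For submodules \<open>B \<subseteq> Z\<close> of a module over \<open>R\<close> (with scalar multiplication \<open>sm\<close>), \<open>\<Delta>\<close> is an order
  of \<open>Z/B\<close> if there is an isomorphism \<open>\<Oplus>\<^sub>j R/(p\<^sub>j) \<rightarrow> Z/B\<close>, sending the \<open>j\<close>-th generator to the class of
  \<open>x\<^sub>j\<close>, with \<open>\<Delta> = \<Prod>\<^sub>j p\<^sub>j\<close>: the two conditions are surjectivity, and well-definedness together with
  injectivity. Orders are closed under multiplication by units, because a summand \<open>R/(u) = 0\<close> with \<open>u\<close>
  a unit may be added.\<close>

definition is_module_order ::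
    "('r::comm_ring_1 \<Rightarrow> 'm \<Rightarrow> 'm) \<Rightarrow> 'm::ab_group_add set \<Rightarrow> 'm set \<Rightarrow> 'r \<Rightarrow> bool" where
  "is_module_order sm Z B \<Delta> \<longleftrightarrow>
     (\<exists>k p x. (\<forall>j<k. x j \<in> Z) \<and>
        (\<forall>z\<in>Z. \<exists>r. z - (\<Sum>j<k. sm (r j) (x j)) \<in> B) \<and>
        (\<forall>r. (\<Sum>j<k. sm (r j) (x j)) \<in> B \<longleftrightarrow> (\<forall>j<k. p j dvd r j)) \<and>
        \<Delta> = (\<Prod>j<k::nat. p j))"

text \<open>\<open>\<Delta>\<close> is (a representative of) the \<open>i\<close>-th twisted Alexander polynomial of the representation
  \<open>act\<close> of \<open>G\<close> on the complex vector space \<open>'v\<close> with scalar multiplication \<open>sc\<close>. It is a relation, as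
  the polynomial is only defined up to units.\<close>

definition is_twisted_alexander ::
    "'g monoid \<Rightarrow> ('g \<Rightarrow> int) \<Rightarrow> (complex \<Rightarrow> 'v \<Rightarrow> 'v) \<Rightarrow> ('g \<Rightarrow> 'v::ab_group_add \<Rightarrow> 'v) \<Rightarrow> nat \<Rightarrow> laurent \<Rightarrow> bool" where
  "is_twisted_alexander G \<phi> sc act i \<Delta> \<longleftrightarrow>
     is_module_order (chain_smult sc)
       (bar_cycles G (twisted_action \<phi> act) i) (bar_boundaries G (twisted_action \<phi> act) i) \<Delta>"

text \<open>\<open>\<alpha> \<otimes> \<beta>\<^sup>*\<close> on \<open>a \<times> b\<close> matrices.\<close>

definition tensor_dual :: "('g \<Rightarrow> complex^'a^'a) \<Rightarrow> ('g \<Rightarrow> complex^'b^'b) \<Rightarrow>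
    'g \<Rightarrow> complex^'b^'a \<Rightarrow> complex^'b^'a" where
  "tensor_dual \<alpha> \<beta> g A = \<alpha> g ** A ** matrix_inv (\<beta> g)"

end

theory Submission
  imports Defs "HOL-Computational_Algebra.Fundamental_Theorem_Algebra" "HOL-Library.Function_Algebras"
begin

text \<open>Write \<open>\<alpha>' = \<lambda>\<^sup>b\<^sup>\<phi> \<otimes> \<alpha>\<close> and \<open>\<beta>' = \<lambda>\<^sup>-\<^sup>a\<^sup>\<phi> \<otimes> \<beta>\<close>. The two vanishing statements are proved independently: the
  second is the first with \<open>\<alpha>\<close> and \<open>\<beta>\<close> exchanged, so no duality between \<open>\<Delta>\<^sub>1\<^sup>+\<close> and \<open>\<Delta>\<^sub>1\<^sup>-\<close> is needed.

  Suppose \<open>\<Delta>\<^sub>1\<^sup>+(\<lambda>\<^sup>n) \<noteq> 0\<close>. A cocycle \<open>z\<close> with values in \<open>Hom(\<alpha>', \<beta>')\<close> pairs with 1-chains after \<open>t = \<lambda>\<^sup>n\<close>, and this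
  pairing kills all 1-cycles; hence \<open>z\<close> is a coboundary on \<open>ker \<phi>\<close>. If \<open>Hom(\<alpha>', \<beta>')\<close> has no invariants, then \<open>z\<close> is a
  coboundary, so \<open>H\<^sup>1(\<Gamma>; Hom(\<alpha>', \<beta>')) = 0\<close>. This group contains the obstructions to deforming the invariant
  subspace of \<open>\<alpha>'\<close> along with \<open>\<rho>\<^sub>\<lambda>\<close>, so on any irreducible set \<open>Z\<close> through \<open>\<rho>\<^sub>\<lambda>\<close> the universal representation is
  reducible modulo every power of the maximal ideal at \<open>\<rho>\<^sub>\<lambda>\<close>. By Burnside's theorem an irreducible member of \<open>Z\<close>
  gives a determinant in the matrix entries that does not vanish there but lies in all these powers, contradicting
  Krull's intersection theorem (\<open>\<Gamma>\<close> is finitely generated since the exterior is a compact neighbourhood retract).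

  Otherwise \<open>\<alpha>'\<close> and \<open>\<beta>'\<close> are isomorphic by Schur's lemma, and \<open>Hom(\<alpha>', \<beta>')\<close> is the sum of a trivial line and
  the adjoint module of \<open>\<alpha>\<close>. The previous argument kills \<open>H\<^sup>1\<close> of the latter, so infinitesimal regularity forces
  \<open>a = b = 1\<close> and \<open>\<lambda>\<^sup>2 = 1\<close>. Then \<open>\<rho>\<^sub>\<lambda>\<close> is scalar, and as \<open>ker \<phi>\<close> is the commutator subgroup, all members of \<open>Z\<close> are
  abelian.\<close>

section \<open>Noetherian rings and the intersection of the powers of a maximal ideal\<close>

text \<open>The value \<lambda>^n is the ratio of the twists \<lambda>^b and \<lambda>^(-a):
  \<alpha> \<otimes> \<beta>* with t specialised to \<lambda>^n is the dual of the coefficient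
  module of the obstructions. The pairing is linear over the Laurent ring through evaluation, so a
  generator of order p_j pairs with a cocycle to a number killed by p_j(\<lambda>^n); this number
  vanishes unless p_j(\<lambda>^n) does.

  The obstacle in the deformation argument is convergence. The changes of basis straightening the
  family modulo m^k depend on k, and a limit would exist only in a completion. The determinant test
  avoids the limit: it is one fixed function, and a change of basis alters it only by a factor in
  the algebra, so its membership in m^k can be read off from a basis chosen for that k. Krull's
  theorem then gives f = q f with q in the maximal ideal; that f itself vanishes uses that the
  functions on an irreducible set form an integral domain.

  If there are invariants, the obstruction argument breaks down at the step recovering a matrix from
  its coboundary, and scalar \<rho> needs the separate commutator argument.\<close>

definition is_subring :: "'r::comm_ring_1 set \<Rightarrow> bool" where
  "is_subring B \<longleftrightarrow> 1 \<in> B \<and> (\<forall>x\<in>B. \<forall>y\<in>B. x - y \<in> B \<and> x * y \<in> B)"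

lemma is_subringD:
  assumes "is_subring B"
  shows "1 \<in> B" "0 \<in> B" "x \<in> B \<Longrightarrow> - x \<in> B"
    "x \<in> B \<Longrightarrow> y \<in> B \<Longrightarrow> x + y \<in> B" "x \<in> B \<Longrightarrow> y \<in> B \<Longrightarrow> x - y \<in> B"
    "x \<in> B \<Longrightarrow> y \<in> B \<Longrightarrow> x * y \<in> B"
proof -
  show 1: "1 \<in> B" and d: "\<And>x y. x \<in> B \<Longrightarrow> y \<in> B \<Longrightarrow> x - y \<in> B"
    and "x \<in> B \<Longrightarrow> y \<in> B \<Longrightarrow> x * y \<in> B" using assms by (auto simp: is_subring_def)
  show 0: "0 \<in> B" using d[OF 1 1] by simp
  show m: "\<And>x. x \<in> B \<Longrightarrow> - x \<in> B" using d[OF 0] by simp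
  show "x \<in> B \<Longrightarrow> y \<in> B \<Longrightarrow> x + y \<in> B" using d[of x "- y"] m[of y] by simp
qed

lemma is_subring_sum:
  assumes "is_subring B" "\<And>i. i \<in> I \<Longrightarrow> f i \<in> B"
  shows "sum f I \<in> B"
  using assms(2) by (induction I rule: infinite_finite_induct) (auto intro: is_subringD[OF assms(1)])

lemma is_subring_prod:
  assumes "is_subring B" "\<And>i. i \<in> I \<Longrightarrow> f i \<in> B"
  shows "prod f I \<in> B"
  using assms(2) by (induction I rule: infinite_finite_induct) (auto intro: is_subringD[OF assms(1)])

text \<open>\<open>B\<close> is an arbitrary set of coefficients here. For a subring the result is
  an ideal; with a power of an ideal in place of \<open>B\<close> it is the next power, which is how
  \<open>ideal_pow\<close> uses it.\<close>

inductive_set ideal_gen :: "'r::comm_ring_1 set \<Rightarrow> 'r set \<Rightarrow> 'r set" for B F where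
  zero: "0 \<in> ideal_gen B F"
| step: "b \<in> B \<Longrightarrow> f \<in> F \<Longrightarrow> y \<in> ideal_gen B F \<Longrightarrow> b * f + y \<in> ideal_gen B F"

lemma ideal_gen_add:
  "x \<in> ideal_gen B F \<Longrightarrow> y \<in> ideal_gen B F \<Longrightarrow> x + y \<in> ideal_gen B F"
  by (induction rule: ideal_gen.induct) (auto simp: add.assoc intro: ideal_gen.intros)

lemma ideal_gen_mult:
  assumes "is_subring B" "c \<in> B" "x \<in> ideal_gen B F"
  shows "c * x \<in> ideal_gen B F"
  using assms(3)
proof induction
  case (step b f y)
  have "(c * b) * f + c * y \<in> ideal_gen B F"
    using step assms(2) by (intro ideal_gen.step is_subringD(6)[OF assms(1)]) auto
  then show ?case by (simp add: algebra_simps)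
qed (simp add: ideal_gen.zero)

lemma ideal_gen_gen: "is_subring B \<Longrightarrow> f \<in> F \<Longrightarrow> f \<in> ideal_gen B F"
  using ideal_gen.step[of 1 B f F 0] by (simp add: ideal_gen.zero is_subringD)

lemma ideal_gen_diff:
  assumes "is_subring B" "x \<in> ideal_gen B F" "y \<in> ideal_gen B F"
  shows "x - y \<in> ideal_gen B F"
  using ideal_gen_add[OF assms(2) ideal_gen_mult[OF assms(1) _ assms(3), of "-1"]] assms(1)
  by (simp add: is_subringD)

lemma ideal_gen_trans:
  assumes "is_subring B" "x \<in> ideal_gen B F" "F \<subseteq> ideal_gen B F'"
  shows "x \<in> ideal_gen B F'"
  using assms(2)
  by induction (use assms in \<open>auto intro: ideal_gen.zero ideal_gen_add ideal_gen_mult\<close>)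

lemma ideal_gen_mono: "F \<subseteq> F' \<Longrightarrow> is_subring B \<Longrightarrow> ideal_gen B F \<subseteq> ideal_gen B F'"
  by (meson ideal_gen_trans ideal_gen_gen subset_iff)

lemma ideal_gen_sum:
  assumes "is_subring B" "\<And>i. i \<in> I \<Longrightarrow> f i \<in> ideal_gen B F"
  shows "sum f I \<in> ideal_gen B F"
  using assms(2)
  by (induction I rule: infinite_finite_induct) (auto intro: ideal_gen.zero ideal_gen_add)

lemma ideal_gen_initial_sum:
  fixes f :: "nat \<Rightarrow> 'r::comm_ring_1"
  assumes "is_subring B" "x \<in> ideal_gen B (f ` {..<k})"
  shows "\<exists>b. (\<forall>i. b i \<in> B) \<and> x = (\<Sum>i<k. b i * f i)"
  using assms(2)
proof induction
  case zero
  show ?case by (rule exI[of _ "\<lambda>_. 0"]) (use assms in \<open>auto simp: is_subringD\<close>)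
next
  case (step c g y)
  then obtain b i where b: "\<forall>i. b i \<in> B" "y = (\<Sum>i<k. b i * f i)" and i: "i < k" "g = f i"
    by auto
  have "(\<Sum>j<k. (b j + (if j = i then c else 0)) * f j) = c * f i + y"
    using i by (simp add: b algebra_simps sum.distrib if_distrib[of "(*) _"] if_distribR
        sum.delta cong: if_cong)
  moreover have "\<forall>j. b j + (if j = i then c else 0) \<in> B"
    using b step assms by (auto intro: is_subringD)
  ultimately show ?case by (intro exI[of _ "\<lambda>j. b j + (if j = i then c else 0)"]) (simp add: i(2))
qed

lemma ideal_gen_range_initial:
  fixes f :: "nat \<Rightarrow> 'r::comm_ring_1"
  assumes "is_subring B" "x \<in> ideal_gen B (range f)"
  shows "\<exists>k. x \<in> ideal_gen B (f ` {..<k})"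
  using assms(2)
proof induction
  case (step c g y)
  then obtain k i where k: "y \<in> ideal_gen B (f ` {..<k})" and i: "g = f i" by auto
  have "y \<in> ideal_gen B (f ` {..<max k (Suc i)})"
    using k ideal_gen_mono[OF image_mono assms(1), of "{..<k}" "{..<max k (Suc i)}" f] by auto
  then show ?case using step i by (intro exI[of _ "max k (Suc i)"] ideal_gen.step) auto
qed (auto intro: ideal_gen.zero)

text \<open>The ascending chain condition for ideals generated by initial segments of a sequence.
  This form is applied directly to the sequence f, f t, f t^2, ... in Krull's theorem.\<close>

definition noetherian :: "'r::comm_ring_1 set \<Rightarrow> bool" where
  "noetherian B \<longleftrightarrow> (\<forall>f::nat \<Rightarrow> 'r. range f \<subseteq> B \<longrightarrow> (\<exists>k. f k \<in> ideal_gen B (f ` {..<k})))"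

definition adjoin :: "'r::comm_ring_1 set \<Rightarrow> 'r \<Rightarrow> 'r set" where
  "adjoin B x = {poly p x | p. \<forall>i. coeff p i \<in> B}"

lemma is_subring_adjoin:
  assumes B: "is_subring B"
  shows "is_subring (adjoin B x)"
  unfolding is_subring_def
proof (intro conjI ballI)
  show "1 \<in> adjoin B x"
    unfolding adjoin_def by (rule CollectI, rule exI[of _ 1]) (auto simp: B is_subringD)
  fix a b assume "a \<in> adjoin B x" "b \<in> adjoin B x"
  then obtain p q where p: "a = poly p x" "\<forall>i. coeff p i \<in> B" and q: "b = poly q x" "\<forall>i. coeff q i \<in> B"
    by (auto simp: adjoin_def)
  show "a - b \<in> adjoin B x"
    unfolding adjoin_def by (rule CollectI, rule exI[of _ "p - q"]) (auto simp: B p q is_subringD)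
  show "a * b \<in> adjoin B x"
    unfolding adjoin_def by (rule CollectI, rule exI[of _ "p * q"])
      (auto simp: B p q is_subringD coeff_mult intro!: is_subring_sum)
qed

lemma adjoin_superset: assumes "is_subring B" "b \<in> B" shows "b \<in> adjoin B x"
  unfolding adjoin_def by (rule CollectI, rule exI[of _ "[:b:]"])
    (auto simp: assms is_subringD coeff_pCons split: nat.splits)

lemma adjoin_generator: assumes "is_subring B" shows "x \<in> adjoin B x"
  unfolding adjoin_def by (rule CollectI, rule exI[of _ "[:0, 1:]"])
    (auto simp: assms is_subringD coeff_pCons split: nat.splits)

text \<open>Hilbert's basis theorem; \<open>x\<close> need not be transcendental over \<open>B\<close>, so degrees are those of
  polynomials representing elements of \<open>adjoin B x\<close>.\<close>

lemma noetherian_adjoin: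
  fixes x :: "'r::comm_ring_1"
  assumes B: "is_subring B" and N: "noetherian B"
  shows "noetherian (adjoin B x)"
proof (rule ccontr)
  let ?A = "adjoin B x"
  have A: "is_subring ?A" by (rule is_subring_adjoin[OF B])
  assume "\<not> noetherian ?A"
  then obtain f :: "nat \<Rightarrow> 'r" where f: "range f \<subseteq> ?A" and nf: "\<And>k. f k \<notin> ideal_gen ?A (f ` {..<k})"
    by (auto simp: noetherian_def)
  \<comment> \<open>Hilbert's argument runs on polynomials representing elements: \<open>J\<close>
    is the preimage of the ideal generated by the bad sequence \<open>f\<close>.\<close>
  define J where "J = {p. (\<forall>i. coeff p i \<in> B) \<and> poly p x \<in> ideal_gen ?A (range f)}"
  \<comment> \<open>If the values of finitely many members of \<open>J\<close> generated all others,
    they would already lie in the ideal of an initial segment of \<open>f\<close>, and then so would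
    the next \<open>f M\<close>.\<close>
  have ex: "\<exists>p\<in>J. poly p x \<notin> ideal_gen ?A ((\<lambda>i. poly (g i) x) ` {..<n})"
    if g: "\<And>i. i < n \<Longrightarrow> g i \<in> J" for g and n :: nat
  proof (rule ccontr)
    assume "\<not> ?thesis"
    then have all: "\<And>p. p \<in> J \<Longrightarrow> poly p x \<in> ideal_gen ?A ((\<lambda>i. poly (g i) x) ` {..<n})" by blast
    have "\<forall>i\<in>{..<n}. \<exists>k. poly (g i) x \<in> ideal_gen ?A (f ` {..<k})"
      using g ideal_gen_range_initial[OF A] by (auto simp: J_def)
    then obtain K where K: "\<And>i. i < n \<Longrightarrow> poly (g i) x \<in> ideal_gen ?A (f ` {..<K i})"
      by (metis lessThan_iff)
    define M where "M = Max (insert 0 (K ` {..<n}))"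
    have M: "poly (g i) x \<in> ideal_gen ?A (f ` {..<M})" if "i < n" for i
    proof -
      have "K i \<le> M" unfolding M_def using that by (intro Max_ge) auto
      then show ?thesis
        using K[OF that] ideal_gen_mono[OF image_mono A, of "{..<K i}" "{..<M}" f] by auto
    qed
    obtain p where p: "f M = poly p x" "\<forall>i. coeff p i \<in> B"
      using f by (auto simp: adjoin_def)
    have "f M \<in> ideal_gen ?A (range f)" by (intro ideal_gen_gen[OF A] rangeI)
    then have "p \<in> J" using p by (simp add: J_def)
    have "f M \<in> ideal_gen ?A (f ` {..<M})"
      unfolding p(1)
      by (rule ideal_gen_trans[OF A all[OF \<open>p \<in> J\<close>]]) (use M in blast)
    with nf show False by blast
  qed
  \<comment> \<open>Greedy choice: a member of \<open>J\<close> of least degree among those whose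
    value is outside the ideal of the earlier values.\<close>
  define P where "P g n p \<longleftrightarrow> p \<in> J \<and> poly p x \<notin> ideal_gen ?A ((\<lambda>i. poly (g i) x) ` {..<n}) \<and>
      (\<forall>q\<in>J. poly q x \<notin> ideal_gen ?A ((\<lambda>i. poly (g i) x) ` {..<n}) \<longrightarrow> degree p \<le> degree q)" for g and n::nat and p
  have "\<exists>g. \<forall>n. P g n (g n)"
  proof (rule dependent_wellorder_choice)
    fix r :: "'r poly" and g h :: "nat \<Rightarrow> 'r poly" and n assume "\<And>m. m < n \<Longrightarrow> g m = h m"
    then have "(\<lambda>i. poly (g i) x) ` {..<n} = (\<lambda>i. poly (h i) x) ` {..<n}" by (intro image_cong) auto
    then show "P g n r = P h n r" by (simp add: P_def)
  next
    fix n and g :: "nat \<Rightarrow> 'r poly" assume "\<And>m. m < n \<Longrightarrow> P g m (g m)"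
    then have "\<And>i. i < n \<Longrightarrow> g i \<in> J" by (simp add: P_def)
    from ex[of n g, OF this] obtain p
      where p: "p \<in> J" "poly p x \<notin> ideal_gen ?A ((\<lambda>i. poly (g i) x) ` {..<n})"
      by (rule bexE)
    define Q where "Q q \<longleftrightarrow> q \<in> J \<and> poly q x \<notin> ideal_gen ?A ((\<lambda>i. poly (g i) x) ` {..<n})" for q
    have "Q p" using p by (simp add: Q_def)
    then have "Q (arg_min degree Q)" "\<forall>q. Q q \<longrightarrow> degree (arg_min degree Q) \<le> degree q"
      by (blast intro: arg_min_natI arg_min_nat_le)+
    then have "P g n (arg_min degree Q)" unfolding P_def Q_def by blast
    then show "\<exists>r. P g n r" by blast
  qed
  then obtain g where g: "\<And>n. P g n (g n)" by blast
  define c where "c n = lead_coeff (g n)" for n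
  have "range c \<subseteq> B" using g by (auto simp: c_def P_def J_def)
  then obtain k where "c k \<in> ideal_gen B (c ` {..<k})" using N by (auto simp: noetherian_def)
  then obtain b where b: "\<And>i. b i \<in> B" "c k = (\<Sum>i<k. b i * c i)"
    using ideal_gen_initial_sum[OF B] by blast
  let ?I = "\<lambda>n. ideal_gen ?A ((\<lambda>i. poly (g i) x) ` {..<n})"
  have gJ: "g n \<in> J" and gn: "poly (g n) x \<notin> ?I n" for n using g[of n] by (auto simp: P_def)
  have mono: "?I i \<subseteq> ?I j" if "i \<le> j" for i j using that by (intro ideal_gen_mono A image_mono) auto
  have deg: "degree (g i) \<le> degree (g k)" if "i \<le> k" for i
    using g[of i] gJ[of k] gn[of k] mono[OF that] by (auto simp: P_def)
  \<comment> \<open>The relation between leading coefficients, lifted by shifting degrees: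
    \<open>s\<close> agrees with \<open>g k\<close> in its top degree, and its value is in the ideal
    of the earlier values. Hence \<open>g k - s\<close> is as admissible as \<open>g k\<close>, but
    its coefficient in that degree is 0. By minimality it can only be the zero polynomial, whose
    value is in every ideal.\<close>
  define s where "s = (\<Sum>i<k. monom (b i) (degree (g k) - degree (g i)) * g i)"
  have cg: "coeff (g i) j \<in> B" for i j using gJ[of i] by (simp add: J_def)
  have cs: "coeff s j \<in> B" for j
    unfolding s_def coeff_sum
    by (intro is_subring_sum[OF B]) (auto simp: coeff_monom_mult b cg B is_subringD)
  have A': "adjoin B x \<supseteq> B" using adjoin_superset[OF B] by auto
  have mx: "x ^ j \<in> ?A" for j
    by (induction j) (auto simp: A is_subringD adjoin_generator B)
  have ps: "poly s x = (\<Sum>i<k. (b i * x ^ (degree (g k) - degree (g i))) * poly (g i) x)"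
    by (simp add: s_def poly_sum poly_monom)
  have bA: "b i * x ^ j \<in> ?A" for i j
    using b(1) A' mx by (auto intro!: is_subringD(6)[OF A])
  have sI: "poly s x \<in> ?I k"
    unfolding ps by (intro ideal_gen_sum[OF A] ideal_gen_mult[OF A] bA ideal_gen_gen[OF A]) auto
  have "poly (g i) x \<in> ideal_gen ?A (range f)" for i using gJ[of i] by (simp add: J_def)
  then have sJ: "poly s x \<in> ideal_gen ?A (range f)"
    unfolding ps by (intro ideal_gen_sum[OF A] ideal_gen_mult[OF A] bA)
  define q where "q = g k - s"
  have qJ: "q \<in> J"
    using gJ[of k] sJ cs by (auto simp: q_def J_def B is_subringD intro!: ideal_gen_diff[OF A])
  have qn: "poly q x \<notin> ?I k"
  proof
    assume "poly q x \<in> ?I k"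
    from ideal_gen_add[OF this sI] have "poly (g k) x \<in> ?I k" by (simp add: q_def)
    with gn show False by blast
  qed
  have ge: "degree (g k) \<le> degree q" using g[of k] qJ qn by (auto simp: P_def)
  have "degree (monom (b i) (degree (g k) - degree (g i)) * g i) \<le> degree (g k)" if "i < k" for i
    using degree_mult_le[of "monom (b i) (degree (g k) - degree (g i))" "g i"]
      degree_monom_le[of "b i" "degree (g k) - degree (g i)"] deg[of i] that by simp
  then have "degree s \<le> degree (g k)" unfolding s_def by (intro degree_sum_le) auto
  then have le: "degree q \<le> degree (g k)" unfolding q_def by (intro degree_diff_le) auto
  have "coeff s (degree (g k)) = (\<Sum>i<k. b i * c i)"
    unfolding s_def coeff_sum
    by (intro sum.cong refl) (use deg in \<open>auto simp: coeff_monom_mult c_def\<close>)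
  then have "coeff q (degree (g k)) = 0" using b(2) by (simp add: q_def c_def)
  then have "lead_coeff q = 0" using ge le by simp
  then have "q = 0" by simp
  then show False using qn by (simp add: ideal_gen.zero)
qed

lemma noetherian_field:
  assumes "\<And>c. c \<in> K \<Longrightarrow> c \<noteq> 0 \<Longrightarrow> \<exists>d\<in>K. d * c = 1" and K: "is_subring K"
  shows "noetherian K"
  unfolding noetherian_def
proof (intro allI impI)
  fix f :: "nat \<Rightarrow> 'a" assume f: "range f \<subseteq> K"
  show "\<exists>k. f k \<in> ideal_gen K (f ` {..<k})"
  proof (cases "f 0 = 0")
    case True
    then show ?thesis by (intro exI[of _ 0]) (simp add: ideal_gen.zero)
  next
    case False
    then obtain d where d: "d \<in> K" "d * f 0 = 1" using assms(1)[of "f 0"] f by auto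
    have "(f 1 * d) * f 0 + 0 \<in> ideal_gen K (f ` {..<1})"
      using f d K by (intro ideal_gen.intros is_subringD) auto
    then show ?thesis using d by (intro exI[of _ 1]) (simp add: mult.assoc)
  qed
qed

inductive_set subring_gen :: "'r::comm_ring_1 set \<Rightarrow> 'r set \<Rightarrow> 'r set" for K F where
  base: "c \<in> K \<Longrightarrow> c \<in> subring_gen K F"
| gen: "x \<in> F \<Longrightarrow> x \<in> subring_gen K F"
| add: "x \<in> subring_gen K F \<Longrightarrow> y \<in> subring_gen K F \<Longrightarrow> x + y \<in> subring_gen K F"
| mult: "x \<in> subring_gen K F \<Longrightarrow> y \<in> subring_gen K F \<Longrightarrow> x * y \<in> subring_gen K F"

lemma is_subring_subring_gen:
  assumes "is_subring K" shows "is_subring (subring_gen K F)"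
proof -
  have "x - y \<in> subring_gen K F" if "x \<in> subring_gen K F" "y \<in> subring_gen K F" for x y
  proof -
    have "- 1 \<in> K" using assms by (simp add: is_subringD)
    then have "x + (- 1) * y \<in> subring_gen K F" using that by (blast intro: subring_gen.intros)
    then show ?thesis by simp
  qed
  then show ?thesis
    using assms by (auto simp: is_subring_def intro: subring_gen.intros is_subringD)
qed

lemma subring_gen_empty: "is_subring K \<Longrightarrow> subring_gen K {} = K"
proof (intro equalityI subsetI)
  fix x assume "is_subring K" "x \<in> subring_gen K {}"
  from this(2,1) show "x \<in> K" by induction (auto simp: is_subringD)
qed (auto intro: subring_gen.base)

lemma subring_gen_insert:
  assumes "is_subring K"
  shows "subring_gen K (insert x F) = adjoin (subring_gen K F) x"
proof (intro equalityI subsetI)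
  let ?S = "subring_gen K F" and ?T = "subring_gen K (insert x F)"
  have S: "is_subring ?S" and T: "is_subring ?T" by (auto intro: is_subring_subring_gen assms)
  have A: "is_subring (adjoin ?S x)" by (rule is_subring_adjoin[OF S])
  fix y
  show "y \<in> adjoin ?S x" if "y \<in> ?T"
    using that
    by induction (auto intro: subring_gen.intros adjoin_superset[OF S] adjoin_generator[OF S] is_subringD[OF A])
  have ST: "z \<in> ?T" if "z \<in> ?S" for z
    using that by induction (auto intro: subring_gen.intros)
  have xj: "x ^ j \<in> ?T" for j
    by (induction j) (auto intro: is_subringD[OF T] subring_gen.gen)
  show "y \<in> ?T" if "y \<in> adjoin ?S x"
  proof -
    from that obtain p where "y = poly p x" "\<forall>i. coeff p i \<in> ?S" by (auto simp: adjoin_def)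
    then show ?thesis
      using ST xj by (simp add: poly_altdef is_subring_sum[OF T] is_subringD(6)[OF T])
  qed
qed

theorem noetherian_subring_gen:
  assumes "is_subring K" "noetherian K" "finite F"
  shows "noetherian (subring_gen K F)"
  using assms(3)
  by induction (use assms in \<open>simp_all add: subring_gen_empty subring_gen_insert
      noetherian_adjoin is_subring_subring_gen\<close>)


section \<open>Powers of an ideal\<close>

primrec ideal_pow :: "'r::comm_ring_1 set \<Rightarrow> 'r set \<Rightarrow> nat \<Rightarrow> 'r set" where
  "ideal_pow B M 0 = B"
| "ideal_pow B M (Suc k) = ideal_gen (ideal_pow B M k) M"

lemma ideal_pow_zero: "is_subring B \<Longrightarrow> 0 \<in> ideal_pow B M k"
  by (cases k) (auto simp: is_subringD ideal_gen.zero)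

lemma ideal_pow_add:
  "is_subring B \<Longrightarrow> x \<in> ideal_pow B M k \<Longrightarrow> y \<in> ideal_pow B M k \<Longrightarrow> x + y \<in> ideal_pow B M k"
  by (cases k) (auto simp: is_subringD ideal_gen_add)

lemma ideal_pow_mult:
  assumes B: "is_subring B"
  shows "x \<in> ideal_pow B M i \<Longrightarrow> y \<in> ideal_pow B M j \<Longrightarrow> M \<subseteq> B \<Longrightarrow> x * y \<in> ideal_pow B M (i + j)"
proof (induction i arbitrary: x y)
  case 0
  from 0(2) have "x * y \<in> ideal_pow B M j"
    using 0(1)
  proof (induction j arbitrary: x y)
    case (Suc j)
    from Suc.prems(1) have "y \<in> ideal_gen (ideal_pow B M j) M" by simp
    then show ?case
      unfolding ideal_pow.simps
    proof induction
      case (step b f z)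
      have "(x * b) * f + x * z \<in> ideal_gen (ideal_pow B M j) M"
        using step Suc by (intro ideal_gen.step) auto
      then show ?case by (simp add: algebra_simps)
    qed (simp add: ideal_gen.zero)
  qed (simp add: is_subringD[OF B])
  then show ?case by simp
next
  case (Suc i)
  from Suc.prems(1) have "x \<in> ideal_gen (ideal_pow B M i) M" by simp
  then show ?case
    unfolding ideal_pow.simps add_Suc
  proof induction
    case (step b f z)
    have "(b * y) * f + z * y \<in> ideal_gen (ideal_pow B M (i + j)) M"
      using step Suc by (intro ideal_gen.step) auto
    then show ?case by (simp add: algebra_simps)
  qed (simp add: ideal_gen.zero)
qed

lemma ideal_pow_one: "is_subring B \<Longrightarrow> f \<in> M \<Longrightarrow> f \<in> ideal_pow B M 1"
  using ideal_gen.step[of 1 B f M 0] by (simp add: is_subringD ideal_gen.zero)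

lemma ideal_pow_sum:
  assumes "is_subring B" "\<And>i. i \<in> I \<Longrightarrow> f i \<in> ideal_pow B M k"
  shows "sum f I \<in> ideal_pow B M k"
  using assms(2)
  by (induction I rule: infinite_finite_induct) (auto simp: assms(1) ideal_pow_zero ideal_pow_add)

lemma ideal_pow_Suc_subset:
  assumes "is_subring B" "M \<subseteq> B" shows "ideal_pow B M (Suc k) \<subseteq> ideal_pow B M k"
proof
  fix x assume "x \<in> ideal_pow B M (Suc k)"
  then have "x \<in> ideal_gen (ideal_pow B M k) M" by simp
  then show "x \<in> ideal_pow B M k"
  proof induction
    case (step b f y)
    have "b * f \<in> ideal_pow B M (k + 0)"
      using step assms by (intro ideal_pow_mult) auto
    then show ?case using step by (simp add: ideal_pow_add assms)
  qed (simp add: ideal_pow_zero assms)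
qed

lemma ideal_pow_antimono:
  assumes "is_subring B" "M \<subseteq> B" "i \<le> j" shows "ideal_pow B M j \<subseteq> ideal_pow B M i"
  using assms(3) by (induction j rule: dec_induct) (use ideal_pow_Suc_subset[OF assms(1,2)] in auto)

lemma ideal_pow_subset:
  assumes "is_subring B" "M \<subseteq> B" shows "ideal_pow B M k \<subseteq> B"
  using ideal_pow_antimono[OF assms, of 0 k] by simp

lemma ideal_pow_mult_left:
  assumes "is_subring B" "M \<subseteq> B" "b \<in> B" "x \<in> ideal_pow B M k" shows "b * x \<in> ideal_pow B M k"
  using ideal_pow_mult[of B b M 0 x k] assms by simp

lemma ideal_pow_diff:
  assumes "is_subring B" "M \<subseteq> B" "x \<in> ideal_pow B M k" "y \<in> ideal_pow B M k"
  shows "x - y \<in> ideal_pow B M k"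
  using ideal_pow_add[OF assms(1,3) ideal_pow_mult_left[OF assms(1,2) _ assms(4), of "-1"]]
  by (simp add: is_subringD assms)

section \<open>Algebras of complex functions and the maximal ideal of a point\<close>

definition const_funs :: "('p \<Rightarrow> complex) set" where
  "const_funs = range (\<lambda>c _. c)"

lemma is_subring_const_funs: "is_subring const_funs"
  unfolding is_subring_def const_funs_def
  by (auto simp: image_def fun_eq_iff)

definition function_algebra :: "('p \<Rightarrow> complex) set \<Rightarrow> ('p \<Rightarrow> complex) set" where
  "function_algebra Y = subring_gen const_funs Y"

definition max_ideal :: "('p \<Rightarrow> complex) set \<Rightarrow> 'p \<Rightarrow> ('p \<Rightarrow> complex) set" where
  "max_ideal Y p0 = {f \<in> function_algebra Y. f p0 = 0}"

lemma is_subring_function_algebra: "is_subring (function_algebra Y)"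
  by (simp add: function_algebra_def is_subring_subring_gen is_subring_const_funs)

lemma const_in_function_algebra: "(\<lambda>_. c) \<in> function_algebra Y"
  by (auto simp: function_algebra_def const_funs_def intro: subring_gen.base)

lemma max_ideal_subset: "max_ideal Y p0 \<subseteq> function_algebra Y"
  by (auto simp: max_ideal_def)

text \<open>Makes the maximal ideal of \<open>p0\<close> finitely generated, by the differences y -
  y(p0). The product case rests on xy - x(p0) y(p0) = y (x - x(p0)) + x(p0) (y - y(p0)).\<close>

lemma function_algebra_minus_value:
  assumes "f \<in> function_algebra Y"
  shows "f - (\<lambda>_. f p0) \<in> ideal_gen (function_algebra Y) ((\<lambda>y. y - (\<lambda>_. y p0)) ` Y)" (is "_ \<in> ?I")
proof -
  have A: "is_subring (function_algebra Y)" by (rule is_subring_function_algebra)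
  from assms show ?thesis unfolding function_algebra_def
  proof induction
    case (base c)
    then have "c - (\<lambda>_. c p0) = 0" by (auto simp: const_funs_def)
    then show ?case by (simp only: ideal_gen.zero)
  next
    case (gen x)
    then show ?case using A unfolding function_algebra_def by (intro ideal_gen_gen) auto
  next
    case (add x y)
    have "x + y - (\<lambda>_. (x + y) p0) = (x - (\<lambda>_. x p0)) + (y - (\<lambda>_. y p0))" by auto
    then show ?case using add by (simp only: ideal_gen_add)
  next
    case (mult x y)
    have "x * y - (\<lambda>_. (x * y) p0) = y * (x - (\<lambda>_. x p0)) + (\<lambda>_. x p0) * (y - (\<lambda>_. y p0))"
      by (auto simp: algebra_simps)
    moreover have "(\<lambda>_. x p0) \<in> subring_gen const_funs Y"
      using const_in_function_algebra unfolding function_algebra_def .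
    ultimately show ?case using mult A unfolding function_algebra_def
      by (simp only: ideal_gen_add ideal_gen_mult)
  qed
qed

text \<open>Via the Rees algebra \<open>\<Oplus>\<^sub>k \<mm>\<^sup>k t\<^sup>k\<close>: as it is Noetherian, some \<open>f t\<^sup>k\<close> is a combination of
  \<open>f, f t, \<dots>, f t\<^sup>k\<^sup>-\<^sup>1\<close>.\<close>

theorem krull_intersection:
  fixes Y :: "('p \<Rightarrow> complex) set" and p0 :: 'p
  defines "A \<equiv> function_algebra Y" and "M \<equiv> max_ideal Y p0"
  assumes fin: "finite Y" and f: "\<And>k. f \<in> ideal_pow A M k"
  shows "\<exists>q\<in>M. f = q * f"
proof -
  have A: "is_subring A" unfolding A_def by (rule is_subring_function_algebra)
  have MA: "M \<subseteq> A" unfolding M_def A_def by (rule max_ideal_subset)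
  let ?x = "\<lambda>y. y - (\<lambda>_. y p0)"
  \<comment> \<open>The field of scalars, embedded as constant polynomials whose coefficients are
    constant functions.\<close>
  define C where "C = (\<lambda>c. [:c:]) ` (const_funs :: ('p \<Rightarrow> complex) set)"
  have C: "is_subring C"
    unfolding is_subring_def
  proof (intro conjI ballI)
    show "1 \<in> C" unfolding C_def by (rule image_eqI[of _ _ 1]) (auto simp: is_subringD[OF is_subring_const_funs] one_pCons)
    fix a b assume "a \<in> C" "b \<in> C"
    then obtain c d where "a = [:c:]" "b = [:d:]" "c \<in> const_funs" "d \<in> const_funs" by (auto simp: C_def)
    then show "a - b \<in> C" "a * b \<in> C"
      unfolding C_def by (auto intro!: imageI is_subringD[OF is_subring_const_funs])
  qed
  have "noetherian C"
  proof (rule noetherian_field[OF _ C])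
    fix c assume "c \<in> C" "c \<noteq> 0"
    then obtain a where a: "c = [:\<lambda>_. a:]" by (auto simp: C_def const_funs_def)
    with \<open>c \<noteq> 0\<close> have "a \<noteq> 0" by (auto simp: zero_fun_def)
    then have "[:\<lambda>_. inverse a:] * c = 1" by (auto simp: a one_pCons fun_eq_iff)
    moreover have "[:\<lambda>_. inverse a:] \<in> C" by (auto simp: C_def const_funs_def)
    ultimately show "\<exists>d\<in>C. d * c = 1" by blast
  qed
  \<comment> \<open>Generators of the Rees algebra: \<open>Y\<close> in degree 0 and the generators
    of \<open>M\<close> in degree 1. \<open>RC\<close> bounds its coefficients by the powers of
    \<open>M\<close>, and \<open>PR\<close> shows that all homogeneous elements allowed by this
    bound occur.\<close>
  define R where "R = subring_gen C ((\<lambda>y. [:y:]) ` Y \<union> (\<lambda>y. monom (?x y) 1) ` Y)"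
  have R: "is_subring R" and NR: "noetherian R"
    unfolding R_def using C \<open>noetherian C\<close> fin
    by (auto intro!: is_subring_subring_gen noetherian_subring_gen)
  have YA: "y \<in> A" if "y \<in> Y" for y
    using that by (auto simp: A_def function_algebra_def intro: subring_gen.gen)
  have cA: "(\<lambda>_. c) \<in> A" for c by (simp add: A_def const_in_function_algebra)
  have xM: "?x y \<in> M" if "y \<in> Y" for y
    using is_subringD(5)[OF A YA[OF that] cA[of "y p0"]] by (simp add: M_def max_ideal_def A_def)
  have z0: "0 \<in> ideal_pow A M k" "(\<lambda>_. 0) \<in> ideal_pow A M k" for k
    using ideal_pow_zero[OF A, of M k] by (simp_all add: zero_fun_def)
  have RC: "coeff r k \<in> ideal_pow A M k" if "r \<in> R" for r k
    using that unfolding R_def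
  proof (induction arbitrary: k)
    case (base c)
    then obtain a where "c = [:\<lambda>_. a:]" by (auto simp: C_def const_funs_def)
    then show ?case by (cases k) (simp_all add: z0 cA del: ideal_pow.simps(2))
  next
    case (gen z)
    then consider y where "y \<in> Y" "z = [:y:]" | y where "y \<in> Y" "z = monom (?x y) 1" by blast
    then show ?case
    proof cases
      case 1
      then show ?thesis
        by (cases k) (simp_all add: z0 YA del: ideal_pow.simps(2))
    next
      case 2
      then show ?thesis
        using ideal_pow_one[OF A xM] by (auto simp: z0)
    qed
  next
    case (add x y)
    then show ?case unfolding coeff_add by (intro ideal_pow_add[OF A])
  next
    case (mult x y)
    have "coeff x i * coeff y (k - i) \<in> ideal_pow A M k" if "i \<le> k" for i
      using ideal_pow_mult[OF A mult.IH(1)[of i] mult.IH(2)[of "k - i"] MA] that by simp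
    then show ?case unfolding coeff_mult by (intro ideal_pow_sum[OF A]) simp
  qed
  have AR: "[:g:] \<in> R" if "g \<in> A" for g
    using that unfolding A_def function_algebra_def
  proof induction
    case (add x y)
    have "[:x + y:] = [:x:] + [:y:]" by simp
    then show ?case using add R by (simp only: is_subringD)
  next
    case (mult x y)
    have "[:x * y:] = [:x:] * [:y:]" by simp
    then show ?case using mult R by (simp only: is_subringD)
  qed (auto simp: R_def C_def intro: subring_gen.intros)
  have MX: "g \<in> ideal_gen A (?x ` Y)" if "g \<in> M" for g
  proof -
    have "g - (\<lambda>_. g p0) = g" using that by (auto simp: M_def max_ideal_def)
    then show ?thesis
      using function_algebra_minus_value[of g Y p0] that MA unfolding A_def by auto
  qed
  have PR: "monom g k \<in> R" if "g \<in> ideal_pow A M k" for g k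
    using that
  proof (induction k arbitrary: g)
    case 0
    then show ?case using AR by (simp add: monom_0)
  next
    case (Suc k)
    then have "g \<in> ideal_gen (ideal_pow A M k) M" by simp
    then show ?case
    proof induction
      case (step b h y)
      have "h \<in> ideal_gen A (?x ` Y)" by (rule MX) fact
      then have "monom (b * h) (Suc k) \<in> R"
      proof induction
        case (step a z w)
        then obtain y where y: "y \<in> Y" "z = ?x y" by blast
        have "monom z 1 \<in> R" unfolding R_def y(2) using y(1) by (intro subring_gen.gen) blast
        then have "monom b k * ([:a:] * monom z 1) + monom (b * w) (Suc k) \<in> R"
          by (intro is_subringD(4,6)[OF R] step.IH Suc.IH AR \<open>b \<in> ideal_pow A M k\<close> \<open>a \<in> A\<close> \<open>monom z 1 \<in> R\<close>)
        moreover have "monom b k * ([:a:] * monom z 1) + monom (b * w) (Suc k) = monom (b * (a * z + w)) (Suc k)"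
          by (simp add: mult_monom smult_monom add_monom algebra_simps)
        ultimately show ?case by metis
      qed (metis mult_zero_right monom_eq_0 is_subringD(2)[OF R])
      then show ?case unfolding add_monom[symmetric] using step by (intro is_subringD(4)[OF R])
    qed (metis monom_eq_0 is_subringD(2)[OF R])
  qed
  define F where "F k = monom f k" for k
  have "range F \<subseteq> R" using PR f by (auto simp: F_def)
  then obtain k where "F k \<in> ideal_gen R (F ` {..<k})" using NR by (auto simp: noetherian_def)
  then obtain q where q: "\<And>i. q i \<in> R" "F k = (\<Sum>i<k. q i * F i)"
    using ideal_gen_initial_sum[OF R] by blast
  \<comment> \<open>Comparing coefficients of t^k: \<open>q i\<close> contributes through its
    coefficient of degree k - i \<ge> 1, which lies in \<open>M\<close>.\<close>
  have "f = coeff (F k) k" by (simp add: F_def)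
  also have "\<dots> = (\<Sum>i<k. coeff (q i) (k - i) * f)"
    unfolding q(2) by (simp add: coeff_sum F_def mult.commute[of _ "monom f _"] coeff_monom_mult)
      (simp add: mult.commute)
  also have "\<dots> = (\<Sum>i<k. coeff (q i) (k - i)) * f" by (simp add: sum_distrib_right)
  finally have eq: "f = (\<Sum>i<k. coeff (q i) (k - i)) * f" .
  have P1M: "ideal_pow A M 1 \<subseteq> M"
  proof
    fix x assume "x \<in> ideal_pow A M 1"
    then have "x \<in> A" using ideal_pow_subset[OF A MA, of 1] by blast
    have "x \<in> ideal_gen A M" using \<open>x \<in> ideal_pow A M 1\<close> by simp
    then have "x p0 = 0" by induction (auto simp: M_def max_ideal_def)
    with \<open>x \<in> A\<close> show "x \<in> M" by (simp add: M_def A_def max_ideal_def)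
  qed
  have "coeff (q i) (k - i) \<in> ideal_pow A M 1" if "i < k" for i
  proof (rule subsetD[OF ideal_pow_antimono[OF A MA] RC[OF q(1)]])
    show "1 \<le> k - i" using that by simp
  qed
  then have "(\<Sum>i<k. coeff (q i) (k - i)) \<in> ideal_pow A M 1"
    by (intro ideal_pow_sum[OF A]) (simp del: ideal_pow.simps One_nat_def)
  then show ?thesis using eq P1M by blast
qed

text \<open>From f = q f with q(p0) = 0 one gets (1 - q) f = 0, and 1 - q takes the value 1 at
  \<open>p0\<close>.\<close>

corollary krull_intersection_domain:
  fixes Y :: "('p \<Rightarrow> complex) set"
  assumes "finite Y" and f: "\<And>k. f \<in> ideal_pow (function_algebra Y) (max_ideal Y p0) k"
    and dom: "\<And>u v. u \<in> function_algebra Y \<Longrightarrow> v \<in> function_algebra Y \<Longrightarrow> u * v = 0 \<Longrightarrow> u = 0 \<or> v = 0"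
  shows "f = 0"
proof -
  obtain q where q: "q \<in> max_ideal Y p0" "f = q * f"
    using krull_intersection[OF assms(1) f] by blast
  have "f \<in> function_algebra Y" using f[of 0] by simp
  moreover have "1 - q \<in> function_algebra Y"
    using q(1) max_ideal_subset[of Y p0]
    by (intro is_subringD(1,5)[OF is_subring_function_algebra]) blast
  moreover have "(1 - q) * f = 0" using q(2) by (simp add: algebra_simps)
  ultimately have "1 - q = 0 \<or> f = 0" using dom by blast
  moreover have "(1 - q) p0 \<noteq> 0" using q by (simp add: max_ideal_def)
  ultimately show ?thesis by auto
qed


section \<open>Irreducible matrix semigroups\<close>

text \<open>Holds in every dimension; it is applied to matrices and also to spaces of functions,
  which may be infinite dimensional.\<close>

lemma (in vector_space) functional_separation:
  assumes "x \<notin> span S"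
  shows "\<exists>g. Vector_Spaces.linear scale (*) g \<and> (\<forall>s\<in>span S. g s = 0) \<and> g x = 1"
proof -
  interpret vector_space_pair scale "(*) :: 'a \<Rightarrow> 'a \<Rightarrow> 'a"
    by unfold_locales (simp_all add: algebra_simps)
  obtain B where B: "B \<subseteq> S" "independent B" "S \<subseteq> span B"
    using maximal_independent_subset by blast
  have sp: "span B = span S" using B by (meson span_mono span_superset subset_antisym span_minimal subspace_span)
  then have "independent (insert x B)" using assms B(2) by (simp add: independent_insertI)
  from linear_independent_extend[OF this, of "\<lambda>b. if b = x then 1 else 0"]
  obtain g where g: "Vector_Spaces.linear scale (*) g" "\<And>b. b \<in> insert x B \<Longrightarrow> g b = (if b = x then 1 else 0)"
    by blast
  have xB: "x \<notin> B" using assms sp span_superset by blast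
  interpret g: Vector_Spaces.linear scale "(*)" g by (rule g)
  have "g s = 0" if "s \<in> span B" for s
    using that by (rule g.eq_0_on_span[rotated]) (use g(2) xB in auto)
  then show ?thesis using g sp by auto
qed

lemma matrix_smult_nth [simp]: "matrix_smult c A $ i $ j = c * A $ i $ j"
  by (simp add: matrix_smult_def map_matrix_def)

interpretation mat_space: vector_space "matrix_smult :: complex \<Rightarrow> complex^'m^'n \<Rightarrow> complex^'m^'n"
  by unfold_locales (simp_all add: vec_eq_iff algebra_simps)

lemma matrix_smult_mult_left: "matrix_smult c A ** B = matrix_smult c (A ** B)"
  by (simp add: vec_eq_iff matrix_matrix_mult_def sum_distrib_left mult.assoc)

lemma matrix_smult_mult_right: "A ** matrix_smult c B = matrix_smult c (A ** B)"
  by (simp add: vec_eq_iff matrix_matrix_mult_def sum_distrib_left mult.left_commute)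

lemma matrix_add_rdistrib': "(A + B) ** C = A ** C + B ** (C :: 'a::semiring_1^'p^'m)"
  by (simp add: vec_eq_iff matrix_matrix_mult_def sum.distrib algebra_simps)

lemma matrix_smult_mult_vec: "matrix_smult c A *v x = c *s (A *v x)"
  by (simp add: vec_eq_iff matrix_vector_mult_def sum_distrib_left mult.assoc)

text \<open>This is p(f) v for a polynomial p in an endomorphism f.\<close>

definition horner_map :: "('a::{comm_semiring_0} \<Rightarrow> 'b \<Rightarrow> 'b) \<Rightarrow> ('b::ab_group_add \<Rightarrow> 'b) \<Rightarrow> 'a poly \<Rightarrow> 'b \<Rightarrow> 'b" where
  "horner_map sc f p v = fold_coeffs (\<lambda>a w. sc a v + f w) p 0"

context
  fixes M :: "complex^'n^'n"
begin

abbreviation pm :: "complex poly \<Rightarrow> complex^'n \<Rightarrow> complex^'n" where "pm \<equiv> horner_map (*s) ((*v) M)"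

lemma pm_0: "pm 0 v = 0"
  by (simp add: horner_map_def)

lemma pm_pCons: "pm (pCons a p) v = a *s v + M *v pm p v"
  by (cases "p = 0 \<and> a = 0") (auto simp: horner_map_def)

lemma pm_add: "pm (p + q) v = pm p v + pm q v"
proof (induction p arbitrary: q)
  case (pCons a p)
  obtain b q' where "q = pCons b q'" by (cases q)
  then show ?case using pCons
    by (simp add: pm_pCons matrix_vector_right_distrib vec.scale_left_distrib)
qed (simp add: pm_0)

lemma pm_smult: "pm (smult c p) v = c *s pm p v"
  by (induction p) (simp_all add: pm_0 pm_pCons vec.scale_right_distrib vector_scalar_commute)

lemma pm_diff: "pm (p - q) v = pm p v - pm q v"
  using pm_add[of p "smult (- 1) q" v] pm_smult[of "- 1" q v] by (simp add: vec.scale_minus_left)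

lemma pm_monom: "pm (monom c i) v = c *s (((*v) M ^^ i) v)"
  by (induction i) (simp_all add: monom_0 monom_Suc pm_pCons pm_0 vector_scalar_commute)

lemma pm_sum: "pm (sum p I) v = (\<Sum>i\<in>I. pm (p i) v)"
  by (induction I rule: infinite_finite_induct) (simp_all add: pm_0 pm_add)

lemma pm_mem:
  assumes "vec.subspace R" "\<And>x. x \<in> R \<Longrightarrow> M *v x \<in> R" "v \<in> R"
  shows "pm p v \<in> R"
  by (induction p) (use assms in \<open>auto simp: pm_0 pm_pCons vec.subspace_0 vec.subspace_add vec.subspace_scale\<close>)

text \<open>Infinitely many vectors M^i v are dependent in finite dimension. A repetition among them
  is treated first, because dependence of a set does not see repeated members.\<close>

lemma exists_annihilating_poly: "\<exists>p. p \<noteq> 0 \<and> pm p v = 0"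
proof (cases "inj (\<lambda>i. ((*v) M ^^ i) v)")
  case False
  then obtain i j where ij: "i \<noteq> j" "((*v) M ^^ i) v = ((*v) M ^^ j) v" by (auto simp: inj_def)
  let ?p = "monom 1 i + monom (-1) j :: complex poly"
  have "coeff ?p i = 1" using ij by simp
  then have "?p \<noteq> 0" by (metis coeff_0 zero_neq_one)
  moreover have "pm ?p v = 0" by (simp add: pm_add pm_monom ij vec.scale_minus_left)
  ultimately show ?thesis by blast
next
  case True
  let ?e = "\<lambda>i. ((*v) M ^^ i) v"
  have "infinite (range ?e)" using True finite_imageD by blast
  then have "vec.dependent (range ?e)" using vec.independent_bound_general by blast
  then obtain t u where t: "finite t" "t \<subseteq> range ?e" "(\<Sum>w\<in>t. u w *s w) = 0" "\<exists>w\<in>t. u w \<noteq> 0"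
    unfolding vec.dependent_explicit by blast
  define I where "I = ?e -` t"
  have tI: "t = ?e ` I" using t(2) by (auto simp: I_def)
  have I: "finite I" using t(1) True by (simp add: I_def finite_vimageI)
  define p where "p = (\<Sum>i\<in>I. monom (u (?e i)) i)"
  have "pm p v = (\<Sum>i\<in>I. u (?e i) *s ?e i)" by (simp add: p_def pm_sum pm_monom)
  also have "\<dots> = (\<Sum>w\<in>t. u w *s w)" unfolding tI by (subst sum.reindex) (use True in \<open>auto simp: inj_on_def inj_def\<close>)
  finally have "pm p v = 0" using t(3) by simp
  moreover obtain i where "i \<in> I" "u (?e i) \<noteq> 0" using t(4) tI by blast
  then have "coeff p i \<noteq> 0" using I by (simp add: p_def coeff_sum sum.delta)
  then have "p \<noteq> 0" by auto
  ultimately show ?thesis by blast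
qed

text \<open>A root r splits an annihilating polynomial as (X - r) q. Either q(M) v is an eigenvector
  for r, or q annihilates v and has smaller degree.\<close>

lemma eigenvector_in_invariant_subspace:
  assumes R: "vec.subspace R" "\<And>x. x \<in> R \<Longrightarrow> M *v x \<in> R" and v: "v \<in> R" "v \<noteq> 0"
  shows "\<exists>c w. w \<in> R \<and> w \<noteq> 0 \<and> M *v w = c *s w"
proof -
  have *: "\<exists>c w. w \<in> R \<and> w \<noteq> 0 \<and> M *v w = c *s w" if "p \<noteq> 0" "pm p v = 0" for p
    using that
  proof (induction "degree p" arbitrary: p)
    case 0
    then obtain a where "p = [:a:]" "a \<noteq> 0" by (metis degree_eq_zeroE pCons_0_0)
    then show ?case using 0 v by (simp add: pm_pCons pm_0)
  next
    case (Suc d)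
    then have "\<not> constant (poly p)" by (simp add: constant_degree)
    then obtain r where "poly p r = 0" using fundamental_theorem_of_algebra by blast
    then obtain q where q: "p = [:-r, 1:] * q" using poly_eq_0_iff_dvd by blast
    with Suc.prems have "q \<noteq> 0" by auto
    then have "degree q = d" using Suc.hyps(2) unfolding q by (subst (asm) degree_mult_eq) auto
    have eq: "M *v pm q v = r *s pm q v"
      using Suc.prems(2) unfolding q by (simp add: pm_diff pm_smult pm_pCons pm_0)
    show ?case
    proof (cases "pm q v = 0")
      case True
      with Suc.hyps(1) \<open>degree q = d\<close> \<open>q \<noteq> 0\<close> show ?thesis by blast
    next
      case False
      then show ?thesis using eq pm_mem[OF R v(1)] by blast
    qed
  qed
  obtain p where "p \<noteq> 0 \<and> pm p v = 0" using exists_annihilating_poly by (rule exE)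
  then show ?thesis by (intro *[of p]) simp_all
qed

end

lemma subspace_range_matrix: "vec.subspace (range ((*v) (T :: complex^'m^'n)))"
  unfolding vec.subspace_def
proof (intro conjI ballI allI)
  show "0 \<in> range ((*v) T)" by (rule range_eqI[of _ _ 0]) simp
  fix u v assume "u \<in> range ((*v) T)" "v \<in> range ((*v) T)"
  then show "u + v \<in> range ((*v) T)" by (auto simp flip: matrix_vector_right_distrib)
next
  fix c u assume "u \<in> range ((*v) T)"
  then show "c *s u \<in> range ((*v) T)" by (auto simp flip: vector_scalar_commute)
qed

definition outer :: "complex^'n \<Rightarrow> complex^'m \<Rightarrow> complex^'m^'n" where
  "outer w y = (\<chi> i j. w $ i * y $ j)"

definition flat :: "'a^'m^'n \<Rightarrow> 'a^('n \<times> 'm)" where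
  "flat A = (\<chi> p. A $ fst p $ snd p)"

lemma vec_functional_nonzero:
  assumes "vec.subspace Y" "Y \<noteq> (UNIV :: (complex^'n) set)"
  shows "\<exists>x. x \<noteq> 0 \<and> (\<forall>y\<in>Y. (\<Sum>i\<in>UNIV. y $ i * x $ i) = 0)"
proof -
  obtain z where "z \<notin> Y" using assms by blast
  then have "z \<notin> vec.span Y" using vec.span_minimal[OF subset_refl assms(1)] by blast
  then obtain g where g: "Vector_Spaces.linear (*s) (*) g" "\<forall>s\<in>vec.span Y. g s = 0" "g z = 1"
    using vec.functional_separation by blast
  interpret g: Vector_Spaces.linear "(*s)" "(*)" g by (rule g)
  define x where "x = (\<chi> i. g (axis i 1))"
  have gx: "g y = (\<Sum>i\<in>UNIV. y $ i * x $ i)" for y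
  proof -
    have "g y = g (\<Sum>i\<in>UNIV. y $ i *s axis i 1)" by (simp add: basis_expansion)
    also have "\<dots> = (\<Sum>i\<in>UNIV. y $ i * x $ i)" by (simp add: g.sum g.scale x_def)
    finally show ?thesis .
  qed
  have "x \<noteq> 0" using g(3) gx[of z] by auto
  moreover have "\<forall>y\<in>Y. (\<Sum>i\<in>UNIV. y $ i * x $ i) = 0" using gx g(2) vec.span_base by metis
  ultimately show ?thesis by blast
qed

section \<open>Burnside's theorem\<close>

context
  fixes S :: "(complex^'n^'n) set"
  assumes one: "mat 1 \<in> S" and mult: "\<And>A B. A \<in> S \<Longrightarrow> B \<in> S \<Longrightarrow> A ** B \<in> S"
    and irr: "\<And>W. vec.subspace W \<Longrightarrow> (\<And>A w. A \<in> S \<Longrightarrow> w \<in> W \<Longrightarrow> A *v w \<in> W) \<Longrightarrow> W = {0} \<or> W = UNIV"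
begin

lemma span_mult:
  assumes "A \<in> mat_space.span S" "B \<in> mat_space.span S" shows "A ** B \<in> mat_space.span S"
proof -
  have *: "A ** B \<in> mat_space.span S" if "A \<in> S" "B \<in> mat_space.span S" for A B
    using that(2)
  proof (rule mat_space.span_induct)
    show "mat_space.subspace {B. A ** B \<in> mat_space.span S}"
      by (auto simp: mat_space.subspace_def matrix_add_ldistrib matrix_smult_mult_right
          mat_space.span_zero mat_space.span_add mat_space.span_scale)
  qed (simp add: mat_space.span_base mult that(1))
  from assms(1) show ?thesis
  proof (rule mat_space.span_induct)
    show "mat_space.subspace {A. A ** B \<in> mat_space.span S}"
      by (auto simp: mat_space.subspace_def matrix_add_rdistrib' matrix_smult_mult_left
          mat_space.span_zero mat_space.span_add mat_space.span_scale)
  qed (use * assms(2) in auto)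
qed

lemma span_transitive:
  assumes "x \<noteq> 0" shows "\<exists>A\<in>mat_space.span S. A *v x = y"
proof -
  let ?W = "{A *v x | A. A \<in> mat_space.span S}"
  have "vec.subspace ?W"
    unfolding vec.subspace_def
  proof (intro conjI allI ballI)
    show "0 \<in> ?W" using mat_space.span_zero matrix_vector_mult_0 by (metis (mono_tags, lifting) mem_Collect_eq)
    fix u v assume "u \<in> ?W" "v \<in> ?W"
    then obtain A B where "u = A *v x" "v = B *v x" "A \<in> mat_space.span S" "B \<in> mat_space.span S" by blast
    then show "u + v \<in> ?W"
      by (intro CollectI exI[of _ "A + B"]) (simp add: matrix_vector_mult_add_rdistrib mat_space.span_add)
  next
    fix c u assume "u \<in> ?W"
    then obtain A where "u = A *v x" "A \<in> mat_space.span S" by blast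
    then show "c *s u \<in> ?W"
      by (intro CollectI exI[of _ "matrix_smult c A"]) (simp add: matrix_smult_mult_vec mat_space.span_scale)
  qed
  moreover have "A *v w \<in> ?W" if A: "A \<in> S" and w: "w \<in> ?W" for A w
  proof -
    obtain B where "w = B *v x" "B \<in> mat_space.span S" using w by blast
    then show ?thesis using span_mult[OF mat_space.span_base[OF A], of B]
      by (intro CollectI exI[of _ "A ** B"]) (simp add: matrix_vector_mul_assoc)
  qed
  moreover have "x \<in> ?W"
    using mat_space.span_base[OF one] by (intro CollectI exI[of _ "mat 1"]) simp
  ultimately have "?W = UNIV" using irr[of ?W] assms by blast
  then have "y \<in> ?W" by simp
  then show ?thesis by blast
qed

text \<open>Take a nonzero \<open>T\<close> in the span with kernel of maximal dimension. If
  \<open>T x2\<close> is not a multiple of \<open>T x1\<close>, choose \<open>A\<close> with A T x1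
  = x2 and an eigenvalue c of T A on the range of \<open>T\<close>. Then T A T - c T is nonzero, as
  its value at x1 shows, and its kernel is larger by a preimage of the eigenvector.\<close>

lemma exists_rank_one: "\<exists>w y. w \<noteq> 0 \<and> y \<noteq> 0 \<and> outer w y \<in> mat_space.span S"
proof -
  define ker where "ker T = {x. T *v x = 0}" for T :: "complex^'n^'n"
  have ker: "vec.subspace (ker T)" for T
    by (auto simp: ker_def vec.subspace_def matrix_vector_right_distrib vector_scalar_commute)
  let ?P = "\<lambda>T. T \<in> mat_space.span S \<and> T \<noteq> 0"
  have "mat 1 \<noteq> (0 :: complex^'n^'n)" by (simp add: mat_def vec_eq_iff)
  then have P1: "?P (mat 1)" using mat_space.span_base[OF one] by blast
  have bd: "\<forall>T. ?P T \<longrightarrow> vec.dim (ker T) < Suc CARD('n)"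
    by (simp add: less_Suc_eq_le dim_subset_UNIV_cart_gen)
  from ex_has_greatest_nat[of ?P, OF P1 bd]
  obtain T where "?P T \<and> (\<forall>T'. ?P T' \<longrightarrow> vec.dim (ker T') \<le> vec.dim (ker T))" by (rule exE)
  then have T: "T \<in> mat_space.span S" "T \<noteq> 0"
    and max: "\<And>T'. ?P T' \<Longrightarrow> vec.dim (ker T') \<le> vec.dim (ker T)" by blast+
  obtain x1 where x1: "T *v x1 \<noteq> 0" using T(2) by (metis matrix_eq matrix_vector_mult_0)
  have rank1: "\<exists>c. T *v x2 = c *s (T *v x1)" for x2
  proof (rule ccontr)
    assume no: "\<nexists>c. T *v x2 = c *s (T *v x1)"
    obtain A where A: "A \<in> mat_space.span S" "A *v (T *v x1) = x2" using span_transitive[OF x1] by blast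
    let ?R = "range ((*v) T)"
    have sub: "vec.subspace ?R" by (rule subspace_range_matrix)
    have inv: "(T ** A) *v x \<in> ?R" for x
      by (simp flip: matrix_vector_mul_assoc)
    obtain c w where w: "w \<in> ?R" "w \<noteq> 0" "(T ** A) *v w = c *s w"
      using eigenvector_in_invariant_subspace[OF sub inv rangeI x1] by blast
    define T' where "T' = T ** A ** T - matrix_smult c T"
    have T'x: "T' *v x = (T ** A) *v (T *v x) - c *s (T *v x)" for x
      by (simp add: T'_def matrix_vector_mult_diff_rdistrib matrix_smult_mult_vec matrix_vector_mul_assoc)
    have "T' *v x1 \<noteq> 0"
      using no A(2) by (auto simp: T'x matrix_vector_mul_assoc[symmetric])
    then have "T' \<noteq> 0" by auto
    moreover have "T' \<in> mat_space.span S"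
      unfolding T'_def using T A span_mult by (intro mat_space.span_diff mat_space.span_scale) auto
    ultimately have "vec.dim (ker T') \<le> vec.dim (ker T)" using max by blast
    moreover have "vec.dim (ker T) < vec.dim (ker T')"
    proof (rule vec.dim_psubset)
      obtain u where u: "w = T *v u" using w(1) by blast
      have "u \<in> ker T'" "u \<notin> ker T" using w u by (auto simp: ker_def T'x)
      moreover have "ker T \<subseteq> ker T'" by (auto simp: ker_def T'x)
      ultimately show "vec.span (ker T) \<subset> vec.span (ker T')"
        unfolding vec.span_subspace[OF subset_refl vec.span_superset ker]
        by blast
    qed
    ultimately show False by simp
  qed
  then obtain c where c: "\<And>x. T *v x = c x *s (T *v x1)" by metis
  define y where "y = (\<chi> j. c (axis j 1))"
  have "T $ i $ j = (T *v x1) $ i * y $ j" for i j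
  proof -
    have "T $ i $ j = (T *v axis j 1) $ i" by (simp add: matrix_vector_mult_def axis_def mult_delta_right)
    also have "\<dots> = y $ j * (T *v x1) $ i" by (subst c) (simp add: y_def)
    finally show ?thesis by simp
  qed
  then have "T = outer (T *v x1) y" by (simp add: outer_def vec_eq_iff)
  moreover from this have "y \<noteq> 0" using T(2) by (auto simp: outer_def vec_eq_iff)
  ultimately show ?thesis using T(1) x1 by metis
qed

text \<open>Left multiplication moves the column factor of a rank one element anywhere. For the row
  factor, the vectors annihilated by all of \<open>Y\<close> form an invariant subspace; if
  \<open>Y\<close> were proper this subspace would be everything, which forces y0 = 0. Rank one
  matrices then sum to any matrix.\<close>

theorem burnside: "mat_space.span S = UNIV"
proof -
  obtain w0 y0 where 0: "w0 \<noteq> 0" "y0 \<noteq> 0" "outer w0 y0 \<in> mat_space.span S"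
    using exists_rank_one by blast
  define Y where "Y = {y. \<forall>w. outer w y \<in> mat_space.span S}"
  have "outer w y0 \<in> mat_space.span S" for w
  proof -
    obtain A where A: "A \<in> mat_space.span S" "A *v w0 = w" using span_transitive[OF 0(1)] by blast
    have "A ** outer w0 y0 = outer w y0"
      by (simp add: A(2)[symmetric] outer_def vec_eq_iff matrix_matrix_mult_def matrix_vector_mult_def sum_distrib_right mult.assoc)
    then show ?thesis using span_mult[OF A(1) 0(3)] by simp
  qed
  then have y0: "y0 \<in> Y" by (simp add: Y_def)
  have Y: "vec.subspace Y"
    unfolding vec.subspace_def
  proof (intro conjI allI ballI)
    show "0 \<in> Y" by (auto simp: Y_def outer_def zero_vec_def[symmetric] mat_space.span_zero)
    fix y z assume "y \<in> Y" "z \<in> Y"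
    moreover have "outer w (y + z) = outer w y + outer w z" for w :: "complex^'n"
      by (simp add: outer_def vec_eq_iff algebra_simps)
    ultimately show "y + z \<in> Y" by (simp add: Y_def mat_space.span_add)
  next
    fix c y assume "y \<in> Y"
    moreover have "outer w (c *s y) = matrix_smult c (outer w y)" for w :: "complex^'n"
      by (simp add: outer_def vec_eq_iff algebra_simps)
    ultimately show "c *s y \<in> Y" by (simp add: Y_def mat_space.span_scale)
  qed
  have YA: "y v* A \<in> Y" if "y \<in> Y" "A \<in> S" for y A
  proof -
    have "outer w (y v* A) = outer w y ** A" for w :: "complex^'n"
      by (simp add: outer_def vec_eq_iff matrix_matrix_mult_def vector_matrix_mult_def sum_distrib_left ac_simps)
    then show ?thesis using that span_mult[OF _ mat_space.span_base[OF that(2)]] by (auto simp: Y_def)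
  qed
  have "Y = UNIV"
  proof (rule ccontr)
    assume "Y \<noteq> UNIV"
    from vec_functional_nonzero[OF Y this] obtain x
      where x: "x \<noteq> 0" "\<And>y. y \<in> Y \<Longrightarrow> (\<Sum>i\<in>UNIV. y $ i * x $ i) = 0" by blast
    define W where "W = {x. \<forall>y\<in>Y. (\<Sum>i\<in>UNIV. y $ i * x $ i) = 0}"
    have "vec.subspace W"
      unfolding vec.subspace_def W_def
      by (auto simp: algebra_simps sum.distrib sum_distrib_left[symmetric])
    moreover have "A *v v \<in> W" if "A \<in> S" "v \<in> W" for A v
    proof -
      have "(\<Sum>i\<in>UNIV. y $ i * (A *v v) $ i) = (\<Sum>i\<in>UNIV. (y v* A) $ i * v $ i)" for y
        unfolding matrix_vector_mult_def vector_matrix_mult_def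
        by (simp add: sum_distrib_left sum_distrib_right) (subst sum.swap, simp add: ac_simps)
      then show ?thesis using that YA by (auto simp: W_def)
    qed
    ultimately have "W = {0} \<or> W = UNIV" using irr by blast
    moreover have "x \<in> W" using x by (simp add: W_def)
    ultimately have "W = UNIV" using x(1) by blast
    obtain i where "y0 $ i \<noteq> 0" using 0(2) by (auto simp: vec_eq_iff)
    moreover have "axis i 1 \<in> W" using \<open>W = UNIV\<close> by simp
    then have "(\<Sum>j\<in>UNIV. y0 $ j * axis i 1 $ j) = 0" using y0 by (simp add: W_def)
    ultimately show False by (simp add: axis_def mult_delta_right)
  qed
  have "A \<in> mat_space.span S" for A
  proof -
    have "A = (\<Sum>b\<in>UNIV. outer (column b A) (axis b 1))"
      by (simp add: vec_eq_iff outer_def column_def axis_def mult_delta_right)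
    moreover have "\<dots> \<in> mat_space.span S"
      using \<open>Y = UNIV\<close> by (intro mat_space.span_sum) (auto simp: Y_def)
    ultimately show ?thesis by simp
  qed
  then show ?thesis by blast
qed

text \<open>Turns irreducibility into the nonvanishing of a single polynomial in matrix entries,
  which can be tested against powers of a maximal ideal. The rows are the flattened members of a
  basis chosen from \<open>S\<close>.\<close>

lemma burnside_det: "\<exists>h. range h \<subseteq> S \<and> det (\<chi> i. flat (h i)) \<noteq> 0"
proof -
  have "flat A \<in> vec.span (flat ` S)" for A
  proof -
    have "A \<in> mat_space.span S" by (simp add: burnside)
    then show ?thesis
    proof (rule mat_space.span_induct)
      have "flat (0::complex^'n^'n) = 0" "\<And>A B::complex^'n^'n. flat (A + B) = flat A + flat B"
        "\<And>c A::complex^'n^'n. flat (matrix_smult c A) = c *s flat A"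
        by (simp_all add: flat_def vec_eq_iff)
      then show "mat_space.subspace {A. flat A \<in> vec.span (flat ` S)}"
        by (auto simp: mat_space.subspace_def vec.span_zero vec.span_add vec.span_scale)
    qed (auto intro: vec.span_base)
  qed
  moreover have "\<exists>A. x = flat A" for x :: "complex^('n\<times>'n)"
    by (rule exI[of _ "\<chi> i j. x $ (i, j)"]) (simp add: flat_def vec_eq_iff)
  ultimately have sp: "vec.span (flat ` S) = UNIV" by (metis UNIV_eq_I)
  obtain B where B: "B \<subseteq> flat ` S" "vec.independent B" "flat ` S \<subseteq> vec.span B" "card B = vec.dim (flat ` S)"
    using vec.basis_exists by blast
  have spB: "vec.span B = UNIV"
    using sp B(3) by (metis top.extremum_uniqueI vec.span_minimal vec.subspace_span)
  have "card B = CARD('n \<times> 'n)"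
    using B(4) sp by (metis vec.dim_span vec_dim_card)
  moreover have "finite B" using B(2) vec.independent_bound_general by blast
  ultimately obtain g where g: "bij_betw g (UNIV :: ('n\<times>'n) set) B"
    using finite_same_card_bij[of "UNIV :: ('n\<times>'n) set" B] by auto
  have "\<forall>i. \<exists>A\<in>S. g i = flat A" using g B(1) by (auto simp: bij_betw_def)
  then obtain h where h: "\<And>i. h i \<in> S" "\<And>i. g i = flat (h i)" by metis
  let ?M = "\<chi> i. flat (h i)"
  have "columns (transpose ?M) = B"
    using g h(2) by (auto simp: columns_def column_def transpose_def bij_betw_def vec_nth_inverse)
  then obtain N where "transpose ?M ** N = mat 1"
    using spB matrix_right_invertible_span_columns[of "transpose ?M"] by auto
  then have "det (transpose ?M) * det N = 1" by (metis det_I det_mul)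
  then have "det ?M \<noteq> 0" by (auto simp: det_transpose)
  then show ?thesis using h(1) by blast
qed

end


section \<open>Twisted Alexander polynomials and cocycles\<close>

text \<open>Evaluations, twisted actions and pairings are all sums over a support that changes under
  addition; their additivity is settled once in this form.\<close>

definition keyed_sum :: "('k \<Rightarrow> 'm::zero \<Rightarrow> 'n::comm_monoid_add) \<Rightarrow> ('k \<Rightarrow>\<^sub>0 'm) \<Rightarrow> 'n" where
  "keyed_sum f m = (\<Sum>k\<in>Poly_Mapping.keys m. f k (Poly_Mapping.lookup m k))"

lemma keyed_sum_superset:
  assumes "\<And>k. f k 0 = 0" "finite A" "Poly_Mapping.keys m \<subseteq> A"
  shows "keyed_sum f m = (\<Sum>k\<in>A. f k (Poly_Mapping.lookup m k))"
  unfolding keyed_sum_def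
  by (rule sum.mono_neutral_left) (use assms in \<open>auto simp: in_keys_iff\<close>)

lemma keyed_sum_add:
  fixes f :: "'k \<Rightarrow> 'm::ab_group_add \<Rightarrow> 'n::ab_group_add"
  assumes "\<And>k. Modules.additive (f k)"
  shows "keyed_sum f (m + n) = keyed_sum f m + keyed_sum f n"
proof -
  let ?A = "Poly_Mapping.keys m \<union> Poly_Mapping.keys n"
  have 0: "f k 0 = 0" for k using assms by (rule additive.zero)
  note sup = keyed_sum_superset[where f = f and A = ?A, OF 0]
  have "Poly_Mapping.keys (m + n) \<subseteq> ?A" by (rule Poly_Mapping.keys_add)
  then show ?thesis
    by (subst (1 2 3) sup) (auto simp: lookup_add additive.add[OF assms] sum.distrib)
qed

lemma keyed_sum_single: "f k 0 = 0 \<Longrightarrow> keyed_sum f (Poly_Mapping.single k v) = f k v"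
  by (simp add: keyed_sum_def)

lemma additive_keyed_sum:
  fixes f :: "'k \<Rightarrow> 'm::ab_group_add \<Rightarrow> 'n::ab_group_add"
  assumes "\<And>k. Modules.additive (f k)"
  shows "Modules.additive (keyed_sum f)"
  by (simp add: Modules.additive_def keyed_sum_add[OF assms])

lemma poly_mapping_sum_monomials:
  "(\<Sum>k\<in>Poly_Mapping.keys m. Poly_Mapping.single k (Poly_Mapping.lookup m k)) = m"
  by (rule poly_mapping_eqI) (simp add: lookup_sum lookup_single when_def sum.delta in_keys_iff)

lemma laurent_eval_keyed: "laurent_eval p x = keyed_sum (\<lambda>k c. c * x powi k) p"
  by (simp add: laurent_eval_def keyed_sum_def)

lemma laurent_eval_mult:
  assumes "x \<noteq> 0"
  shows "laurent_eval (p * q) x = laurent_eval p x * laurent_eval q x"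
proof -
  let ?e = "keyed_sum (\<lambda>k c. c * x powi k)"
  have add: "Modules.additive ?e" by (intro additive_keyed_sum) (simp add: Modules.additive_def algebra_simps)
  have single: "?e (Poly_Mapping.single k c) = c * x powi k" for k c by (simp add: keyed_sum_single)
  have "p * q = (\<Sum>k\<in>Poly_Mapping.keys p. Poly_Mapping.single k (Poly_Mapping.lookup p k)) *
      (\<Sum>l\<in>Poly_Mapping.keys q. Poly_Mapping.single l (Poly_Mapping.lookup q l))"
    by (simp only: poly_mapping_sum_monomials)
  also have "\<dots> = (\<Sum>k\<in>Poly_Mapping.keys p. \<Sum>l\<in>Poly_Mapping.keys q.
      Poly_Mapping.single (k + l) (Poly_Mapping.lookup p k * Poly_Mapping.lookup q l))"
    by (simp add: sum_product mult_single)
  finally have "?e (p * q) = (\<Sum>k\<in>Poly_Mapping.keys p. \<Sum>l\<in>Poly_Mapping.keys q.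
      Poly_Mapping.lookup p k * Poly_Mapping.lookup q l * x powi (k + l))"
    by (simp add: additive.sum[OF add] single)
  also have "\<dots> = ?e p * ?e q"
    using assms by (simp add: keyed_sum_def sum_product power_int_add algebra_simps)
  finally show ?thesis by (simp add: laurent_eval_keyed)
qed

lemma laurent_eval_prod:
  assumes "x \<noteq> 0"
  shows "laurent_eval (\<Prod>j<k::nat. p j) x = (\<Prod>j<k. laurent_eval (p j) x)"
proof (induction k)
  case 0
  have "keyed_sum (\<lambda>k c. c * x powi k) (Poly_Mapping.single 0 1) = 1" by (subst keyed_sum_single) simp_all
  then show ?case by (simp add: laurent_eval_keyed)
qed (simp add: laurent_eval_mult assms)

definition laurent_vec_eval :: "complex \<Rightarrow> (int \<Rightarrow>\<^sub>0 complex^'b^'a) \<Rightarrow> complex^'b^'a" where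
  "laurent_vec_eval x = keyed_sum (\<lambda>k. matrix_smult (x powi k))"

lemma additive_matrix_smult: "Modules.additive (matrix_smult c)"
  by (simp add: Modules.additive_def mat_space.scale_right_distrib)

lemma additive_laurent_vec_eval: "Modules.additive (laurent_vec_eval x)"
  unfolding laurent_vec_eval_def by (intro additive_keyed_sum additive_matrix_smult)

lemma laurent_vec_eval_single: "laurent_vec_eval x (Poly_Mapping.single k v) = matrix_smult (x powi k) v"
  by (simp add: laurent_vec_eval_def keyed_sum_single)

lemma laurent_vec_eval_smult:
  assumes "x \<noteq> 0"
  shows "laurent_vec_eval x (laurent_smult matrix_smult p m) = matrix_smult (laurent_eval p x) (laurent_vec_eval x m)"
proof -
  let ?p = "Poly_Mapping.lookup p" and ?m = "Poly_Mapping.lookup m"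
  have "laurent_vec_eval x (laurent_smult matrix_smult p m) = (\<Sum>k\<in>Poly_Mapping.keys p.
      \<Sum>l\<in>Poly_Mapping.keys m. matrix_smult (x powi (k + l)) (matrix_smult (?p k) (?m l)))"
    by (simp only: laurent_smult_def additive.sum[OF additive_laurent_vec_eval] laurent_vec_eval_single)
  also have "\<dots> = (\<Sum>k\<in>Poly_Mapping.keys p. \<Sum>l\<in>Poly_Mapping.keys m.
      matrix_smult (?p k * x powi k) (matrix_smult (x powi l) (?m l)))"
    using assms by (intro sum.cong refl) (simp add: power_int_add ac_simps)
  also have "\<dots> = matrix_smult (laurent_eval p x) (laurent_vec_eval x m)"
    by (subst sum.swap) (simp only: laurent_eval_def laurent_vec_eval_def keyed_sum_def mat_space.scale_sum_left mat_space.scale_sum_right)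
  finally show ?thesis .
qed

text \<open>The perfect pairing that makes b x a matrices the dual of a x b matrices, hence cocycle
  values dual to chain coefficients.\<close>

definition trace_pair :: "complex^'a^'b \<Rightarrow> complex^'b^'a \<Rightarrow> complex" where
  "trace_pair B A = trace (B ** A)"

lemma trace_pair_sum: "trace_pair B A = (\<Sum>j\<in>UNIV. \<Sum>i\<in>UNIV. B $ j $ i * A $ i $ j)"
  by (simp add: trace_pair_def trace_def matrix_matrix_mult_def)

lemma additive_trace_pair: "Modules.additive (trace_pair B)"
  by (simp add: Modules.additive_def trace_pair_sum algebra_simps sum.distrib)

lemma trace_pair_smult: "trace_pair B (matrix_smult c A) = c * trace_pair B A"
  by (simp add: trace_pair_sum sum_distrib_left ac_simps)

lemma trace_pair_smult_left: "trace_pair (matrix_smult c B) A = c * trace_pair B A"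
  by (simp add: trace_pair_sum sum_distrib_left ac_simps)

lemma trace_pair_add_left: "trace_pair (B + C) A = trace_pair B A + trace_pair C A"
  by (simp add: trace_pair_sum algebra_simps sum.distrib)

lemma trace_pair_diff_left: "trace_pair (B - C) A = trace_pair B A - trace_pair C A"
  by (simp add: trace_pair_sum algebra_simps sum_subtractf)

definition matrix_unit :: "'a \<Rightarrow> 'b \<Rightarrow> complex^'b^'a" where
  "matrix_unit i j = (\<chi> i' j'. if i' = i \<and> j' = j then 1 else 0)"

lemma matrix_unit_expansion: "A = (\<Sum>i\<in>UNIV. \<Sum>j\<in>UNIV. matrix_smult (A $ i $ j) (matrix_unit i j))"
proof -
  have "(\<Sum>i\<in>UNIV. \<Sum>j\<in>UNIV. A $ i $ j * (if k = i \<and> m = j then 1 else 0)) = A $ k $ m" for k m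
  proof -
    have "(\<Sum>j\<in>UNIV. A $ i $ j * (if k = i \<and> m = j then 1 else 0)) = (if k = i then A $ i $ m else 0)" for i
      by (simp add: mult_delta_right)
    then show ?thesis by simp
  qed
  then show ?thesis by (simp add: vec_eq_iff matrix_unit_def)
qed

lemma trace_pair_matrix_unit: "trace_pair B (matrix_unit i j) = B $ j $ i"
proof -
  have "(\<Sum>i'\<in>UNIV. B $ j' $ i' * (if i' = i \<and> j' = j then 1 else 0)) = (if j' = j then B $ j $ i else 0)" for j'
    by (auto simp: mult_delta_right)
  then show ?thesis by (simp add: trace_pair_sum matrix_unit_def)
qed

lemma trace_pair_nondegenerate: "(\<And>A. trace_pair B A = trace_pair C A) \<Longrightarrow> B = C"
  by (metis trace_pair_matrix_unit vec_eq_iff)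

lemma trace_pair_representation:
  assumes "Vector_Spaces.linear matrix_smult (*) (f :: complex^'b^'a \<Rightarrow> complex)"
  shows "\<exists>M. \<forall>A. f A = trace_pair M A"
proof -
  interpret f: Vector_Spaces.linear matrix_smult "(*)" f by (rule assms)
  define M :: "complex^'a^'b" where "M = (\<chi> j i. f (matrix_unit i j))"
  have "f A = trace_pair M A" for A
  proof -
    have "f A = (\<Sum>i\<in>UNIV. \<Sum>j\<in>UNIV. A $ i $ j * f (matrix_unit i j))"
      by (subst matrix_unit_expansion[of A]) (simp add: f.sum f.scale)
    also have "\<dots> = trace_pair M A"
      unfolding trace_pair_sum M_def by (subst sum.swap) (simp add: ac_simps)
    finally show ?thesis .
  qed
  then show ?thesis by blast
qed

section \<open>Pairing cocycles with one-chains\<close>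

lemma (in group) hom_integer_group:
  assumes "\<phi> \<in> hom G integer_group"
  shows "g \<in> carrier G \<Longrightarrow> h \<in> carrier G \<Longrightarrow> \<phi> (g \<otimes> h) = \<phi> g + \<phi> h" and "\<phi> \<one> = 0"
    and "g \<in> carrier G \<Longrightarrow> \<phi> (inv g) = - \<phi> g"
proof -
  show mult: "\<phi> (g \<otimes> h) = \<phi> g + \<phi> h" if "g \<in> carrier G" "h \<in> carrier G" for g h
    using assms that by (simp add: hom_def integer_group_def)
  show one: "\<phi> \<one> = 0" using mult[of \<one> \<one>] by simp
  show "\<phi> (inv g) = - \<phi> g" if "g \<in> carrier G"
    using mult[of g "inv g"] that by (simp add: one)
qed

text \<open>\<open>x\<close> is the value substituted for the variable \<open>t\<close> of the Alexander polynomials.\<close>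

locale rep_pair = group G for G :: "'g monoid" (structure) +
  fixes \<phi> :: "'g \<Rightarrow> int" and \<alpha> :: "'g \<Rightarrow> complex^'a^'a" and \<beta> :: "'g \<Rightarrow> complex^'b^'b" and x :: complex
  assumes \<phi>: "\<phi> \<in> hom G integer_group" and \<alpha>: "\<alpha> \<in> hom G SL" and \<beta>: "\<beta> \<in> hom G SL" and x: "x \<noteq> 0"
begin

lemmas phi_mult = hom_integer_group(1)[OF \<phi>]
  and phi_one = hom_integer_group(2)[OF \<phi>]
  and phi_inv = hom_integer_group(3)[OF \<phi>]

end

lemma matrix_inv_unique:
  assumes "A ** B = mat 1" "B ** A = mat (1 :: complex)"
  shows "matrix_inv A = B"
proof -
  have "A ** matrix_inv A = mat 1 \<and> matrix_inv A ** A = mat 1"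
    unfolding matrix_inv_def by (rule someI[of _ B]) (use assms in simp)
  then have "matrix_inv A = (B ** A) ** matrix_inv A" using assms by simp
  also have "\<dots> = B" using \<open>A ** matrix_inv A = mat 1 \<and> _\<close> by (simp flip: matrix_mul_assoc)
  finally show ?thesis .
qed

lemma SL_hom_facts:
  fixes \<alpha> :: "'g \<Rightarrow> complex^'a^'a"
  assumes "group G" "\<alpha> \<in> hom G SL"
  shows "g \<in> carrier G \<Longrightarrow> h \<in> carrier G \<Longrightarrow> \<alpha> (g \<otimes>\<^bsub>G\<^esub> h) = \<alpha> g ** \<alpha> h"
    and "\<alpha> \<one>\<^bsub>G\<^esub> = mat 1"
    and "g \<in> carrier G \<Longrightarrow> matrix_inv (\<alpha> g) = \<alpha> (inv\<^bsub>G\<^esub> g)"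
    and "g \<in> carrier G \<Longrightarrow> \<alpha> g ** \<alpha> (inv\<^bsub>G\<^esub> g) = mat 1"
    and "g \<in> carrier G \<Longrightarrow> \<alpha> (inv\<^bsub>G\<^esub> g) ** \<alpha> g = mat 1"
    and "g \<in> carrier G \<Longrightarrow> det (\<alpha> g) = 1"
proof -
  interpret group G by (rule assms(1))
  show m: "\<And>g h. g \<in> carrier G \<Longrightarrow> h \<in> carrier G \<Longrightarrow> \<alpha> (g \<otimes>\<^bsub>G\<^esub> h) = \<alpha> g ** \<alpha> h"
    using assms(2) by (simp add: hom_def SL_def)
  show 1: "\<alpha> \<one>\<^bsub>G\<^esub> = mat 1"
    using hom_one[OF assms(2,1) group_SL] by (simp add: SL_def)
  show a: "\<And>g. g \<in> carrier G \<Longrightarrow> \<alpha> g ** \<alpha> (inv\<^bsub>G\<^esub> g) = mat 1"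
    and b: "\<And>g. g \<in> carrier G \<Longrightarrow> \<alpha> (inv\<^bsub>G\<^esub> g) ** \<alpha> g = mat 1"
    using m 1 by (metis r_inv inv_closed, metis l_inv inv_closed)
  show "\<And>g. g \<in> carrier G \<Longrightarrow> matrix_inv (\<alpha> g) = \<alpha> (inv\<^bsub>G\<^esub> g)"
    using a b matrix_inv_unique by metis
  show "\<And>g. g \<in> carrier G \<Longrightarrow> det (\<alpha> g) = 1"
    using assms(2) by (auto simp: hom_def SL_def)
qed

context rep_pair
begin

lemmas alpha_facts = SL_hom_facts[OF is_group \<alpha>]
lemmas beta_facts = SL_hom_facts[OF is_group \<beta>]

text \<open>The action on Hom(x^\<phi> \<otimes> \<alpha>, \<beta>), that is, the contragredient of
  \<open>tensor_dual \<alpha> \<beta>\<close> with t specialised to x.\<close>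

definition dual_action :: "'g \<Rightarrow> complex^'a^'b \<Rightarrow> complex^'a^'b" where
  "dual_action g B = matrix_smult (x powi (- \<phi> g)) (\<beta> g ** B ** \<alpha> (inv g))"

lemma dual_action_mult:
  assumes "g \<in> carrier G" "h \<in> carrier G"
  shows "dual_action (g \<otimes> h) B = dual_action g (dual_action h B)"
  using assms x
  by (simp add: dual_action_def phi_mult inv_mult_group alpha_facts beta_facts matrix_mul_assoc
      matrix_smult_mult_left matrix_smult_mult_right power_int_add power_int_diff power_int_minus field_simps)

lemma dual_action_one: "dual_action \<one> B = B"
  by (simp add: dual_action_def phi_one alpha_facts beta_facts)

lemma dual_action_add: "dual_action g (B + C) = dual_action g B + dual_action g C"
  by (simp add: dual_action_def matrix_add_ldistrib matrix_add_rdistrib' mat_space.scale_right_distrib)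

lemma dual_action_smult: "dual_action g (matrix_smult c B) = matrix_smult c (dual_action g B)"
  by (simp add: dual_action_def matrix_smult_mult_left matrix_smult_mult_right mult.commute)

lemma trace_pair_dual_action:
  assumes "g \<in> carrier G"
  shows "trace_pair (dual_action g B) A =
    trace_pair B (matrix_smult (x powi \<phi> (inv g)) (tensor_dual \<alpha> \<beta> (inv g) A))"
proof -
  have "trace (\<beta> g ** B ** \<alpha> (inv g) ** A) = trace (B ** (\<alpha> (inv g) ** A ** \<beta> g))"
    using trace_mul_sym[of "\<beta> g" "B ** \<alpha> (inv g) ** A"] by (simp add: matrix_mul_assoc)
  then show ?thesis
    using assms by (simp add: trace_pair_smult trace_pair_smult_left dual_action_def tensor_dual_def phi_inv beta_facts)
      (simp add: trace_pair_def)
qed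

abbreviation laurent_action where "laurent_action \<equiv> twisted_action \<phi> (tensor_dual \<alpha> \<beta>)"

lemma additive_tensor_dual: "Modules.additive (tensor_dual \<alpha> \<beta> g)"
  by (simp add: Modules.additive_def tensor_dual_def matrix_add_ldistrib matrix_add_rdistrib')

lemma tensor_dual_smult: "tensor_dual \<alpha> \<beta> g (matrix_smult c A) = matrix_smult c (tensor_dual \<alpha> \<beta> g A)"
  by (simp add: tensor_dual_def matrix_smult_mult_left matrix_smult_mult_right)

lemma laurent_vec_eval_laurent_action:
  "laurent_vec_eval x (laurent_action g m) = matrix_smult (x powi \<phi> g) (tensor_dual \<alpha> \<beta> g (laurent_vec_eval x m))"
  using x
  by (simp add: twisted_action_def additive.sum[OF additive_laurent_vec_eval] laurent_vec_eval_single)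
    (simp add: laurent_vec_eval_def keyed_sum_def additive.sum[OF additive_tensor_dual] tensor_dual_smult
      mat_space.scale_sum_right power_int_add mult.commute)

text \<open>The chain m \<otimes> [g] is sent to the pairing of z(g) with m at t = x. Only chains
  supported on lists of length 1 matter, so the value of \<open>hd\<close> on the empty list is
  harmless.\<close>

definition cocycle_pairing :: "('g \<Rightarrow> complex^'a^'b) \<Rightarrow> ('g list \<Rightarrow>\<^sub>0 int \<Rightarrow>\<^sub>0 complex^'b^'a) \<Rightarrow> complex" where
  "cocycle_pairing z = keyed_sum (\<lambda>gs m. trace_pair (z (hd gs)) (laurent_vec_eval x m))"

lemma additive_cocycle_pairing: "Modules.additive (cocycle_pairing z)"
  unfolding cocycle_pairing_def
  by (intro additive_keyed_sum)
    (simp add: Modules.additive_def additive.add[OF additive_laurent_vec_eval] additive.add[OF additive_trace_pair])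

lemma cocycle_pairing_single:
  "cocycle_pairing z (Poly_Mapping.single gs m) = trace_pair (z (hd gs)) (laurent_vec_eval x m)"
  unfolding cocycle_pairing_def
  by (simp add: keyed_sum_single additive.zero[OF additive_laurent_vec_eval] additive.zero[OF additive_trace_pair])

lemma cocycle_pairing_smult:
  "cocycle_pairing z (chain_smult matrix_smult p c) = laurent_eval p x * cocycle_pairing z c"
  using x
  by (simp add: chain_smult_def additive.sum[OF additive_cocycle_pairing] cocycle_pairing_single
      laurent_vec_eval_smult trace_pair_smult)
    (simp add: cocycle_pairing_def keyed_sum_def sum_distrib_left)

text \<open>On the boundary of m \<otimes> [g|h] the three terms add up to the cocycle identity
  paired with m: the inverse in the bar complex is moved by the pairing to the action of g on
  z(h).\<close>

lemma cocycle_pairing_boundary: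
  assumes z: "\<And>g h. g \<in> carrier G \<Longrightarrow> h \<in> carrier G \<Longrightarrow> z (g \<otimes> h) = z g + dual_action g (z h)"
    and c: "c \<in> bar_boundaries G laurent_action 1"
  shows "cocycle_pairing z c = 0"
proof -
  obtain w where w: "w \<in> chains G 2" "c = bar_boundary G laurent_action w"
    using c by (auto simp: bar_boundaries_def numeral_2_eq_2)
  have "cocycle_pairing z (bar_boundary_term G laurent_action gs m) = 0" if "gs \<in> Poly_Mapping.keys w" for gs m
  proof -
    have "length gs = 2" "set gs \<subseteq> carrier G" using that w(1) by (auto simp: chains_def)
    then obtain g h where gs: "gs = [g, h]" "g \<in> carrier G" "h \<in> carrier G"
      by (auto simp: numeral_2_eq_2 length_Suc_conv)
    have s: "{1..<2} = {1::nat}" by auto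
    have "bar_boundary_term G laurent_action gs m = Poly_Mapping.single [h] (laurent_action (inv g) m)
        + Poly_Mapping.single [g \<otimes> h] (- m) + Poly_Mapping.single [g] m"
      by (simp add: bar_boundary_term_def gs(1) signed_def s)
    then have "cocycle_pairing z (bar_boundary_term G laurent_action gs m) =
       trace_pair (z h) (laurent_vec_eval x (laurent_action (inv g) m)) - trace_pair (z (g \<otimes> h)) (laurent_vec_eval x m)
       + trace_pair (z g) (laurent_vec_eval x m)"
      by (simp add: additive.add[OF additive_cocycle_pairing] cocycle_pairing_single
          additive.minus[OF additive_laurent_vec_eval] additive.minus[OF additive_trace_pair])
    then show ?thesis
      using z[OF gs(2,3)] trace_pair_dual_action[OF gs(2), of "z h"]
      by (simp add: laurent_vec_eval_laurent_action trace_pair_add_left)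
  qed
  then show ?thesis
    by (simp add: w(2) bar_boundary_def additive.sum[OF additive_cocycle_pairing])
qed

text \<open>The multiple p_j y_j of a generator is a boundary, so p_j(x) times its pairing is 0. As
  p_j(x) is a factor of \<Delta>(x), it is nonzero, and the generators pair to 0.\<close>

lemma cocycle_pairing_cycle:
  assumes z: "\<And>g h. g \<in> carrier G \<Longrightarrow> h \<in> carrier G \<Longrightarrow> z (g \<otimes> h) = z g + dual_action g (z h)"
    and \<Delta>: "is_twisted_alexander G \<phi> matrix_smult (tensor_dual \<alpha> \<beta>) 1 \<Delta>" "laurent_eval \<Delta> x \<noteq> 0"
    and c: "c \<in> bar_cycles G laurent_action 1"
  shows "cocycle_pairing z c = 0"
proof -
  have P0: "cocycle_pairing z b = 0" if "b \<in> bar_boundaries G laurent_action 1" for b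
    using cocycle_pairing_boundary[of z] z that by blast
  let ?sm = "chain_smult matrix_smult :: laurent \<Rightarrow> ('g list \<Rightarrow>\<^sub>0 int \<Rightarrow>\<^sub>0 complex^'b^'a) \<Rightarrow> _"
  let ?Z = "bar_cycles G laurent_action 1" and ?B = "bar_boundaries G laurent_action 1"
  obtain k p y where y: "\<forall>z\<in>?Z. \<exists>r. z - (\<Sum>j<k. ?sm (r j) (y j)) \<in> ?B"
    "\<forall>r. (\<Sum>j<k. ?sm (r j) (y j)) \<in> ?B \<longleftrightarrow> (\<forall>j<k. p j dvd r j)" "\<Delta> = (\<Prod>j<k::nat. p j)"
    using \<Delta>(1) unfolding is_twisted_alexander_def is_module_order_def by blast
  have sm0: "?sm 0 c = 0" for c by (simp add: chain_smult_def laurent_smult_def)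
  have yj: "cocycle_pairing z (y j) = 0" if j: "j < k" for j
  proof -
    let ?r = "\<lambda>i. if i = j then p j else 0"
    have "(\<Sum>i<k. ?sm (?r i) (y i)) = (\<Sum>i<k. if i = j then ?sm (p j) (y j) else 0)"
      by (intro sum.cong) (auto simp: sm0)
    also have "\<dots> = ?sm (p j) (y j)" using j by simp
    finally have "?sm (p j) (y j) \<in> ?B" using y(2)[rule_format, of ?r] by auto
    then have "laurent_eval (p j) x * cocycle_pairing z (y j) = 0"
      using P0 by (simp flip: cocycle_pairing_smult)
    moreover have "laurent_eval (p j) x \<noteq> 0"
      using \<Delta>(2) j unfolding y(3) laurent_eval_prod[OF x] by auto
    ultimately show ?thesis by simp
  qed
  obtain r where "c - (\<Sum>j<k. ?sm (r j) (y j)) \<in> ?B" using y(1) c by blast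
  then have "cocycle_pairing z (c - (\<Sum>j<k. ?sm (r j) (y j))) = 0" by (rule P0)
  then show ?thesis
    by (simp add: additive.diff[OF additive_cocycle_pairing] additive.sum[OF additive_cocycle_pairing]
        cocycle_pairing_smult yj)
qed

text \<open>The chain is the sum of the v_i \<otimes> [g_i] with v_i in degree t^0. Since
  \<phi>(g_i) = 0 its boundary stays in degree t^0, and there it is the left side of the assumed
  relation.\<close>

lemma cocycle_relation:
  assumes z: "\<And>g h. g \<in> carrier G \<Longrightarrow> h \<in> carrier G \<Longrightarrow> z (g \<otimes> h) = z g + dual_action g (z h)"
    and \<Delta>: "is_twisted_alexander G \<phi> matrix_smult (tensor_dual \<alpha> \<beta>) 1 \<Delta>" "laurent_eval \<Delta> x \<noteq> 0"
    and I: "\<And>i. i \<in> I \<Longrightarrow> g i \<in> carrier G \<and> \<phi> (g i) = 0"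
    and rel: "(\<Sum>i\<in>I. tensor_dual \<alpha> \<beta> (inv (g i)) (v i) - v i) = 0"
  shows "(\<Sum>i\<in>I. trace_pair (z (g i)) (v i)) = 0"
proof -
  define s where "s i = Poly_Mapping.single [g i] (Poly_Mapping.single (0::int) (v i))" for i
  define c where "c = (\<Sum>i\<in>I. s i)"
  have tact: "laurent_action h (Poly_Mapping.single 0 w) = Poly_Mapping.single (\<phi> h) (tensor_dual \<alpha> \<beta> h w)" for h w
    by (cases "w = 0") (simp_all add: twisted_action_def additive.zero[OF additive_tensor_dual])
  have bt: "Modules.additive (bar_boundary_term G laurent_action [h])" for h
  proof -
    have "Modules.additive (laurent_action h)" for h
    proof -
      let ?f = "\<lambda>l w. Poly_Mapping.single (l + \<phi> h) (tensor_dual \<alpha> \<beta> h w)"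
      have "Modules.additive (keyed_sum ?f)"
        by (intro additive_keyed_sum)
          (simp add: Modules.additive_def additive.add[OF additive_tensor_dual] single_add)
      moreover have "laurent_action h = keyed_sum ?f" by (simp add: fun_eq_iff twisted_action_def keyed_sum_def)
      ultimately show ?thesis by simp
    qed
    then show ?thesis
      by (simp add: Modules.additive_def bar_boundary_term_def signed_def single_add single_uminus single_diff)
  qed
  have cc: "c \<in> chains G 1"
  proof -
    have "Poly_Mapping.keys c \<subseteq> (\<Union>i\<in>I. Poly_Mapping.keys (s i))"
      unfolding c_def by (rule Poly_Mapping.keys_sum)
    also have "\<dots> \<subseteq> (\<lambda>i. [g i]) ` I" by (auto simp: s_def split: if_splits)
    finally show ?thesis using I by (auto simp: chains_def)
  qed
  have "bar_boundary G laurent_action c = 0"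
  proof -
    \<comment> \<open>Extended by 0 outside length 1, where additivity of the boundary terms has
      been shown; the keys of \<open>c\<close> all have that length.\<close>
    let ?T = "\<lambda>gs. if length gs = 1 then bar_boundary_term G laurent_action gs else (\<lambda>_. 0)"
    have T: "Modules.additive (?T gs)" for gs
      using bt by (cases "length gs = 1") (auto simp: length_Suc_conv Modules.additive_def)
    have "bar_boundary G laurent_action c = keyed_sum ?T c"
      unfolding bar_boundary_def keyed_sum_def using cc by (intro sum.cong) (auto simp: chains_def)
    also have "\<dots> = (\<Sum>i\<in>I. keyed_sum ?T (s i))"
      unfolding c_def by (rule additive.sum[OF additive_keyed_sum[OF T]])
    also have "\<dots> = (\<Sum>i\<in>I. bar_boundary_term G laurent_action [g i] (Poly_Mapping.single 0 (v i)))"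
      by (simp add: s_def keyed_sum_single additive.zero[OF bt])
    also have "\<dots> = (\<Sum>i\<in>I. Poly_Mapping.single [] (Poly_Mapping.single 0 (tensor_dual \<alpha> \<beta> (inv (g i)) (v i) - v i)))"
      using I by (intro sum.cong refl)
        (simp add: bar_boundary_term_def tact phi_inv signed_def single_diff single_uminus)
    also have "\<dots> = Poly_Mapping.single [] (Poly_Mapping.single 0 (\<Sum>i\<in>I. tensor_dual \<alpha> \<beta> (inv (g i)) (v i) - v i))"
    proof -
      have "Modules.additive (\<lambda>v :: complex^'b^'a. Poly_Mapping.single ([] :: 'g list) (Poly_Mapping.single (0 :: int) v))"
        by (simp add: Modules.additive_def single_add)
      then show ?thesis by (rule additive.sum[symmetric])
    qed
    finally show ?thesis by (simp add: rel)
  qed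
  then have "cocycle_pairing z c = 0"
    using cc by (intro cocycle_pairing_cycle[OF z \<Delta>]) (auto simp: bar_cycles_def)
  then show ?thesis
    by (simp add: c_def s_def additive.sum[OF additive_cocycle_pairing] cocycle_pairing_single laurent_vec_eval_single)
qed

text \<open>The wanted \<open>D\<close> is a functional sending g^(-1) v - v to the pairing of z(g)
  with v, for g in \<open>ker \<phi>\<close>. \<open>cocycle_relation\<close> says that this
  prescription is consistent, so it extends linearly.\<close>

theorem cocycle_coboundary_on_kernel:
  assumes z: "\<And>g h. g \<in> carrier G \<Longrightarrow> h \<in> carrier G \<Longrightarrow> z (g \<otimes> h) = z g + dual_action g (z h)"
    and \<Delta>: "is_twisted_alexander G \<phi> matrix_smult (tensor_dual \<alpha> \<beta>) 1 \<Delta>" "laurent_eval \<Delta> x \<noteq> 0"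
  shows "\<exists>D. \<forall>g\<in>carrier G. \<phi> g = 0 \<longrightarrow> z g = dual_action g D - D"
proof -
  define sc where "sc c p = (matrix_smult c (fst p), c * snd p)" for c and p :: "(complex^'b^'a) \<times> complex"
  interpret P: vector_space sc
    by unfold_locales (auto simp: sc_def mat_space.scale_right_distrib mat_space.scale_left_distrib algebra_simps prod_eq_iff)
  let ?w = "\<lambda>g v. tensor_dual \<alpha> \<beta> (inv g) v - v"
  define S where "S = {(?w g v, trace_pair (z g) v) | g v. g \<in> carrier G \<and> \<phi> g = 0}"
  \<comment> \<open>Consistency of the prescription: \<open>S\<close> lists the pairs (argument,
    value), and two values for one argument would put (0, 1) into the span. A functional that is 0
    on \<open>S\<close> and 1 at (0, 1) solves for the value, up to the sign that appears in
    \<open>D\<close>.\<close>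
  have "(0, 1) \<notin> P.span S"
  proof
    assume "(0, 1) \<in> P.span S"
    then obtain t r where t: "finite t" "t \<subseteq> S" "(0, 1) = (\<Sum>a\<in>t. sc (r a) a)"
      unfolding P.span_explicit by blast
    have "\<forall>a\<in>t. \<exists>g v. a = (?w g v, trace_pair (z g) v) \<and> g \<in> carrier G \<and> \<phi> g = 0"
      using t(2) unfolding S_def by blast
    then obtain g v where gv: "\<And>a. a \<in> t \<Longrightarrow> a = (?w (g a) (v a), trace_pair (z (g a)) (v a))"
      "\<And>a. a \<in> t \<Longrightarrow> g a \<in> carrier G \<and> \<phi> (g a) = 0" by metis
    let ?v = "\<lambda>a. matrix_smult (r a) (v a)"
    have "sc (r a) a = (?w (g a) (?v a), trace_pair (z (g a)) (?v a))" if "a \<in> t" for a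
      by (subst gv(1)[OF that]) (simp add: sc_def tensor_dual_smult mat_space.scale_right_diff_distrib trace_pair_smult)
    then have sum: "(0, 1) = (\<Sum>a\<in>t. (?w (g a) (?v a), trace_pair (z (g a)) (?v a)))"
      using t(3) by simp
    have "(\<Sum>a\<in>t. ?w (g a) (?v a)) = 0" "(\<Sum>a\<in>t. trace_pair (z (g a)) (?v a)) = 1"
      using arg_cong[OF sum, of fst] arg_cong[OF sum, of snd] by (simp_all add: fst_sum snd_sum)
    then show False using cocycle_relation[OF z \<Delta>, of t g ?v] gv(2) by auto
  qed
  from P.functional_separation[OF this] obtain F
    where F: "Vector_Spaces.linear sc (*) F" "\<And>s. s \<in> P.span S \<Longrightarrow> F s = 0" "F (0, 1) = 1" by blast
  interpret F: Vector_Spaces.linear sc "(*)" F by (rule F)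
  have "Vector_Spaces.linear matrix_smult (*) (\<lambda>A. - F (A, 0))"
  proof unfold_locales
    fix A B :: "complex^'b^'a" and c
    show "- F (A + B, 0) = - F (A, 0) + - F (B, 0)" using F.add[of "(A, 0)" "(B, 0)"] by simp
    show "- F (matrix_smult c A, 0) = c * (- F (A, 0))" using F.scale[of c "(A, 0)"] by (simp add: sc_def)
  qed
  then obtain D where D: "\<And>A. - F (A, 0) = trace_pair D A" using trace_pair_representation by blast
  have "z g = dual_action g D - D" if g: "g \<in> carrier G" "\<phi> g = 0" for g
  proof (rule trace_pair_nondegenerate)
    fix A
    have "(?w g A, trace_pair (z g) A) \<in> P.span S" using g by (intro P.span_base) (auto simp: S_def)
    then have "F (?w g A, trace_pair (z g) A) = 0" by (rule F)
    moreover have "F (?w g A, trace_pair (z g) A) = F (?w g A, 0) + trace_pair (z g) A"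
      using F.add[of "(?w g A, 0)" "(0, trace_pair (z g) A)"] F.scale[of "trace_pair (z g) A" "(0, 1)"] F(3)
      by (simp add: sc_def)
    ultimately have "trace_pair (z g) A = trace_pair D (?w g A)" by (simp flip: D add: eq_neg_iff_add_eq_0 add.commute)
    also have "\<dots> = trace_pair (dual_action g D - D) A"
      using g by (simp add: trace_pair_diff_left trace_pair_dual_action additive.diff[OF additive_trace_pair] phi_inv)
    finally show "trace_pair (z g) A = trace_pair (dual_action g D - D) A" .
  qed
  then show ?thesis by blast
qed

end


section \<open>Vanishing of the first cohomology\<close>

text \<open>Reduces identities over the whole group to \<open>ker \<phi>\<close> and one element
  \<mu>: \<open>H\<close> contains an element with each value of \<phi>, and dividing g by the one
  with the same value leaves an element of the kernel.\<close>

lemma (in group) subgroup_eq_carrier_from_kernel: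
  assumes \<phi>: "\<phi> \<in> hom G integer_group" and H: "subgroup H G"
    and ker: "\<And>g. g \<in> carrier G \<Longrightarrow> \<phi> g = 0 \<Longrightarrow> g \<in> H" and \<mu>: "\<mu> \<in> H" "\<phi> \<mu> = 1"
  shows "H = carrier G"
proof
  have HG: "H \<subseteq> carrier G" using H by (rule subgroup.subset)
  then show "H \<subseteq> carrier G" .
  note mult = hom_integer_group(1)[OF \<phi>] and one = hom_integer_group(2)[OF \<phi>] and inv = hom_integer_group(3)[OF \<phi>]
  have "\<exists>m\<in>H. \<phi> m = k" for k
  proof (induction k rule: int_induct[where k = 0])
    case base
    then show ?case using one subgroup.one_closed[OF H] by blast
  next
    case (step1 i)
    then obtain m where "m \<in> H" "\<phi> m = i" by blast
    then show ?case using mult[of m \<mu>] \<mu> HG subgroup.m_closed[OF H] by (intro bexI[of _ "m \<otimes> \<mu>"]) auto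
  next
    case (step2 i)
    then obtain m where "m \<in> H" "\<phi> m = i" by blast
    moreover from this have "m \<in> carrier G" "\<mu> \<in> carrier G" using HG \<mu> by auto
    ultimately show ?case
      using mult[of m "inv \<mu>"] inv[of \<mu>] \<mu> subgroup.m_closed[OF H] subgroup.m_inv_closed[OF H]
      by (intro bexI[of _ "m \<otimes> inv \<mu>"]) auto
  qed
  then obtain m where m: "\<And>k. m k \<in> H" "\<And>k. \<phi> (m k) = k" by metis
  show "carrier G \<subseteq> H"
  proof
    fix g assume g: "g \<in> carrier G"
    let ?m = "m (\<phi> g)"
    have mG: "?m \<in> carrier G" using m HG by blast
    have "g \<otimes> inv ?m \<in> H" using g mG m(2)[of "\<phi> g"] by (intro ker) (auto simp: mult inv)
    then have "g \<otimes> inv ?m \<otimes> ?m \<in> H" using m(1) subgroup.m_closed[OF H] by blast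
    then show "g \<in> H" using g mG by (simp add: m_assoc)
  qed
qed

text \<open>With \<open>\<mu>\<close> a preimage of \<open>1\<close>, a cocycle vanishing on the kernel of \<open>\<phi>\<close> is determined by its value at
  \<open>\<mu>\<close>, a vector fixed by the kernel; and \<open>\<mu> - 1\<close> is bijective on these vectors.\<close>

lemma (in group) coboundary_from_kernel:
  fixes act :: "'a \<Rightarrow> 'v::euclidean_space \<Rightarrow> 'v"
  assumes \<phi>: "\<phi> \<in> hom G integer_group" and \<mu>: "\<mu> \<in> carrier G" "\<phi> \<mu> = 1"
    and lin: "\<And>g. g \<in> carrier G \<Longrightarrow> linear (act g)"
    and act: "\<And>g h v. g \<in> carrier G \<Longrightarrow> h \<in> carrier G \<Longrightarrow> act (g \<otimes> h) v = act g (act h v)"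
    and act1: "\<And>v. act \<one> v = v"
    and U: "subspace U" "\<And>g u. g \<in> carrier G \<Longrightarrow> u \<in> U \<Longrightarrow> act g u \<in> U"
    and noinv: "\<And>u. u \<in> U \<Longrightarrow> (\<And>g. g \<in> carrier G \<Longrightarrow> act g u = u) \<Longrightarrow> u = 0"
    and z: "\<And>g h. g \<in> carrier G \<Longrightarrow> h \<in> carrier G \<Longrightarrow> z (g \<otimes> h) = z g + act g (z h)"
    and zU: "\<And>g. g \<in> carrier G \<Longrightarrow> z g \<in> U"
    and D: "D \<in> U" "\<And>g. g \<in> carrier G \<Longrightarrow> \<phi> g = 0 \<Longrightarrow> z g = act g D - D"
  shows "\<exists>B\<in>U. \<forall>g\<in>carrier G. z g = act g B - B"
proof -
  note mult = hom_integer_group(1)[OF \<phi>] and one = hom_integer_group(2)[OF \<phi>] and inv = hom_integer_group(3)[OF \<phi>]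
  have ladd: "act g (u + v) = act g u + act g v" and ldiff: "act g (u - v) = act g u - act g v"
    and lscale: "act g (c *\<^sub>R u) = c *\<^sub>R act g u" and l0: "act g 0 = 0" if "g \<in> carrier G" for g u v c
    using lin[OF that] by (auto simp: linear_add linear_diff linear_scale linear_0)
  have actinv: "act (inv g) (act g v) = v" "act g (act (inv g) v) = v" if "g \<in> carrier G" for g v
    using that by (auto simp: act[symmetric] act1)
  define y where "y g = z g - (act g D - D)" for g
  have y: "y (g \<otimes> h) = y g + act g (y h)" if "g \<in> carrier G" "h \<in> carrier G" for g h
    using that by (simp add: y_def z act ladd ldiff)
  have yU: "y g \<in> U" if "g \<in> carrier G" for g
    unfolding y_def using that zU D(1) U by (intro subspace_diff) auto
  have yk: "y g = 0" if "g \<in> carrier G" "\<phi> g = 0" for g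
    using D(2)[OF that] by (simp add: y_def)
  define F where "F = {u \<in> U. \<forall>g\<in>carrier G. \<phi> g = 0 \<longrightarrow> act g u = u}"
  have F: "subspace F"
    using U(1) unfolding subspace_def F_def by (auto simp: ladd lscale l0)
  have conj: "g \<otimes> \<mu> = \<mu> \<otimes> (inv \<mu> \<otimes> g \<otimes> \<mu>)" "inv \<mu> \<otimes> g \<otimes> \<mu> \<in> carrier G" "\<phi> (inv \<mu> \<otimes> g \<otimes> \<mu>) = \<phi> g"
    if "g \<in> carrier G" for g
    using that \<mu> by (simp_all add: m_assoc[symmetric] mult inv)
  \<comment> \<open>The kernel is normal, so \<mu> permutes the vectors fixed by it.\<close>
  have \<mu>F: "act \<mu> u \<in> F" if "u \<in> F" for u
  proof -
    have "act g (act \<mu> u) = act \<mu> u" if g: "g \<in> carrier G" "\<phi> g = 0" for g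
    proof -
      have "act g (act \<mu> u) = act \<mu> (act (inv \<mu> \<otimes> g \<otimes> \<mu>) u)"
        using g(1) \<mu> conj[OF g(1)] by (metis act)
      also have "act (inv \<mu> \<otimes> g \<otimes> \<mu>) u = u"
        using \<open>u \<in> F\<close> conj(2,3)[OF g(1)] g(2) unfolding F_def by auto
      finally show ?thesis .
    qed
    then show ?thesis using that U(2) \<mu> by (auto simp: F_def)
  qed
  have C: "y \<mu> \<in> F"
  proof -
    have "act g (y \<mu>) = y \<mu>" if g: "g \<in> carrier G" "\<phi> g = 0" for g
    proof -
      have "y (g \<otimes> \<mu>) = act g (y \<mu>)" using g \<mu> by (simp add: y yk)
      moreover have "y (g \<otimes> \<mu>) = y \<mu>"
        using conj[OF g(1)] \<mu> g(2) by (simp add: y yk l0)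
      ultimately show ?thesis by simp
    qed
    then show ?thesis using yU \<mu> by (auto simp: F_def)
  qed
  let ?L = "\<lambda>u. act \<mu> u - u"
  have linL: "linear ?L" using lin[OF \<mu>(1)] by (intro linear_compose_sub) (auto simp: linear_id[unfolded id_def])
  \<comment> \<open>A vector of \<open>F\<close> fixed by \<mu> is fixed by the group, hence 0.
    Finite real dimension then makes \<mu> - 1 surjective on \<open>F\<close>, and the value
    y(\<mu>) is reached.\<close>
  have "inj_on ?L F"
  proof (subst linear_inj_on_iff_eq_0[OF linL F], intro ballI impI)
    fix u assume u: "u \<in> F" "act \<mu> u - u = 0"
    let ?H = "{g \<in> carrier G. act g u = u}"
    have "subgroup ?H G"
    proof (rule subgroupI)
      show "?H \<noteq> {}" using act1 by (auto intro!: exI[of _ \<one>])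
      show "inv g \<in> ?H" if "g \<in> ?H" for g using that actinv(1)[of g u] by auto
    qed (auto simp: act)
    then have "?H = carrier G"
      by (rule subgroup_eq_carrier_from_kernel[OF \<phi>]) (use u \<mu> in \<open>auto simp: F_def\<close>)
    then show "u = 0" using u(1) by (intro noinv) (auto simp: F_def)
  qed
  then have "dim (?L ` F) = dim F"
    using F by (intro dim_image_eq[OF linL]) (simp add: span_eq_iff[THEN iffD2])
  moreover have "?L ` F \<subseteq> F" using \<mu>F F by (auto intro: subspace_diff)
  ultimately have "?L ` F = F"
    using F linear_subspace_image[OF linL F] by (intro subspace_dim_equal) auto
  then obtain C' where C': "C' \<in> F" "y \<mu> = act \<mu> C' - C'" using C by auto
  let ?H = "{g \<in> carrier G. y g = act g C' - C'}"
  have y1: "y \<one> = 0" using yk one by simp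
  have "subgroup ?H G"
  proof (rule subgroupI)
    show "?H \<noteq> {}" using act1 y1 by (auto intro!: exI[of _ \<one>])
    fix g assume g: "g \<in> ?H"
    then have gG: "g \<in> carrier G" and yg: "y g = act g C' - C'" by auto
    have "y g + act g (y (inv g)) = 0" using y[of g "inv g"] gG y1 by simp
    then have "act (inv g) (y g + act g (y (inv g))) = 0" using gG by (simp add: l0)
    then have "C' - act (inv g) C' + y (inv g) = 0" using gG by (simp add: yg ladd ldiff actinv)
    then have "y (inv g) = act (inv g) C' - C'" by (simp add: algebra_simps add_eq_0_iff)
    then show "inv g \<in> ?H" using gG by simp
  next
    fix g h assume "g \<in> ?H" "h \<in> ?H"
    then show "g \<otimes> h \<in> ?H" by (simp add: y act ldiff)
  qed auto
  then have H: "?H = carrier G"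
    by (rule subgroup_eq_carrier_from_kernel[OF \<phi>]) (use C' \<mu> yk in \<open>auto simp: F_def\<close>)
  have "z g = act g (D + C') - (D + C')" if "g \<in> carrier G" for g
  proof -
    have "y g = act g C' - C'" using that H by blast
    then show ?thesis using that by (simp add: y_def ladd algebra_simps)
  qed
  moreover have "D + C' \<in> U" using D(1) C'(1) U(1) by (auto simp: F_def intro: subspace_add)
  ultimately show ?thesis by blast
qed

lemma matrix_sub_ldistrib: "A ** (B - C) = A ** B - A ** (C :: complex^'p^'m)"
  by (simp add: vec_eq_iff matrix_matrix_mult_def sum_subtractf algebra_simps)

lemma matrix_sub_rdistrib: "(A - B) ** C = A ** C - B ** (C :: complex^'p^'m)"
  by (simp add: vec_eq_iff matrix_matrix_mult_def sum_subtractf algebra_simps)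

lemma matrix_scaleR_eq_smult: "(r *\<^sub>R A :: complex^'m^'n) = matrix_smult (of_real r) A"
  by (simp only: vec_eq_iff vector_scaleR_component matrix_smult_nth) (simp add: scaleR_conv_of_real)

section \<open>Schur's lemma and infinitesimal regularity\<close>

lemma irreducible_rep_span:
  fixes \<rho> :: "'g \<Rightarrow> complex^'n^'n"
  assumes "group G"
    and mult: "\<And>g h. g \<in> carrier G \<Longrightarrow> h \<in> carrier G \<Longrightarrow> \<rho> (g \<otimes>\<^bsub>G\<^esub> h) = \<rho> g ** \<rho> h"
    and one: "\<rho> \<one>\<^bsub>G\<^esub> = mat 1"
    and irr: "irreducible_rep G \<rho>"
  shows "mat_space.span (\<rho> ` carrier G) = UNIV"
    and "\<exists>h. range h \<subseteq> carrier G \<and> det (\<chi> i. flat (\<rho> (h i))) \<noteq> 0"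
proof -
  interpret group G by (rule assms(1))
  have 1: "mat 1 \<in> \<rho> ` carrier G" using one one_closed by (metis image_eqI)
  have 2: "A ** B \<in> \<rho> ` carrier G" if "A \<in> \<rho> ` carrier G" "B \<in> \<rho> ` carrier G" for A B
    using that mult m_closed by (metis (no_types, lifting) image_iff)
  have 3: "W = {0} \<or> W = UNIV"
    if "vec.subspace W" "\<And>A w. A \<in> \<rho> ` carrier G \<Longrightarrow> w \<in> W \<Longrightarrow> A *v w \<in> W" for W
    using irr that unfolding irreducible_rep_def by blast
  show "mat_space.span (\<rho> ` carrier G) = UNIV" by (rule burnside[OF 1 2 3])
  obtain h where h: "range h \<subseteq> \<rho> ` carrier G" "det (\<chi> i. flat (h i)) \<noteq> 0"
    using burnside_det[OF 1 2 3] by blast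
  then have "\<forall>i. \<exists>g\<in>carrier G. h i = \<rho> g" by blast
  then obtain k where k: "\<And>i. k i \<in> carrier G" "\<And>i. h i = \<rho> (k i)" by metis
  have "h = (\<lambda>i. \<rho> (k i))" using k(2) by blast
  then show "\<exists>h. range h \<subseteq> carrier G \<and> det (\<chi> i. flat (\<rho> (h i))) \<noteq> 0" using k(1) h(2) by blast
qed

lemma commutes_with_span:
  fixes A :: "complex^'n^'n"
  assumes "A \<in> mat_space.span S" "\<And>A. A \<in> S \<Longrightarrow> A ** B = B ** A" shows "A ** B = B ** A"
  using assms(1)
proof (rule mat_space.span_induct)
  show "mat_space.subspace {A. A ** B = B ** A}"
    by (auto simp: mat_space.subspace_def matrix_add_ldistrib matrix_add_rdistrib'
        matrix_smult_mult_left matrix_smult_mult_right)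
qed (use assms(2) in auto)

lemma scalar_if_commutes_with_all:
  fixes M :: "complex^'n^'n"
  assumes "\<And>A. A ** M = M ** A"
  shows "\<exists>c. M = matrix_smult c (mat 1)"
proof -
  have e: "M $ k $ i = (if k = i then M $ j $ j else 0)" for i j k
  proof -
    have "(M ** matrix_unit i j) $ k $ j = M $ k $ i"
      by (simp add: matrix_matrix_mult_def matrix_unit_def mult_delta_right)
    moreover have "(matrix_unit i j ** M) $ k $ j = (if k = i then M $ j $ j else 0)"
    proof -
      have "(\<Sum>l\<in>UNIV. (if k = i \<and> l = j then 1 else 0) * M $ l $ j) = (\<Sum>l\<in>UNIV. if l = j then (if k = i then M $ j $ j else 0) else 0)"
        by (intro sum.cong) auto
      then show ?thesis by (simp add: matrix_matrix_mult_def matrix_unit_def)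
    qed
    ultimately show ?thesis using assms[of "matrix_unit i j"] by simp
  qed
  \<comment> \<open>Any index serves: \<open>e\<close> shows that all diagonal entries
    agree.\<close>
  have "M = matrix_smult (M $ undefined $ undefined) (mat 1)"
    unfolding vec_eq_iff
  proof (intro allI)
    fix k i
    show "M $ k $ i = matrix_smult (M $ undefined $ undefined) (mat 1) $ k $ i"
      using e[of k i undefined] by (auto simp: mat_def)
  qed
  then show ?thesis by blast
qed

context rep_pair
begin

lemma linear_dual_action: "linear (dual_action g)"
  by (rule linearI) (simp_all add: dual_action_add dual_action_smult matrix_scaleR_eq_smult)

theorem H1_vanishes:
  assumes \<mu>: "\<mu> \<in> carrier G" "\<phi> \<mu> = 1"
    and noinv: "\<And>B. (\<And>g. g \<in> carrier G \<Longrightarrow> dual_action g B = B) \<Longrightarrow> B = 0"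
    and \<Delta>: "is_twisted_alexander G \<phi> matrix_smult (tensor_dual \<alpha> \<beta>) 1 \<Delta>" "laurent_eval \<Delta> x \<noteq> 0"
    and z: "\<And>g h. g \<in> carrier G \<Longrightarrow> h \<in> carrier G \<Longrightarrow> z (g \<otimes> h) = z g + dual_action g (z h)"
  shows "\<exists>B. \<forall>g\<in>carrier G. z g = dual_action g B - B"
proof -
  obtain D where D: "\<forall>g\<in>carrier G. \<phi> g = 0 \<longrightarrow> z g = dual_action g D - D"
    using cocycle_coboundary_on_kernel[OF z \<Delta>] by blast
  have "\<exists>B\<in>UNIV. \<forall>g\<in>carrier G. z g = dual_action g B - B"
    by (rule coboundary_from_kernel[OF \<phi> \<mu>, where act = dual_action and D = D])
      (use noinv z D in \<open>auto simp: linear_dual_action dual_action_mult dual_action_one\<close>)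
  then show ?thesis by blast
qed

text \<open>An invariant is a homomorphism from x^\<phi> \<otimes> \<alpha> to \<beta>.\<close>

lemma intertwiner:
  assumes "g \<in> carrier G" "dual_action g P = P"
  shows "P ** \<alpha> g = matrix_smult (x powi (- \<phi> g)) (\<beta> g ** P)"
    and "\<beta> g ** P = matrix_smult (x powi \<phi> g) (P ** \<alpha> g)"
proof -
  have "P ** \<alpha> g = dual_action g P ** \<alpha> g" by (simp add: assms)
  also have "\<dots> = matrix_smult (x powi (- \<phi> g)) (\<beta> g ** P ** (\<alpha> (inv g) ** \<alpha> g))"
    by (simp add: dual_action_def matrix_smult_mult_left matrix_mul_assoc)
  finally show 1: "P ** \<alpha> g = matrix_smult (x powi (- \<phi> g)) (\<beta> g ** P)"
    using assms by (simp add: alpha_facts)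
  show "\<beta> g ** P = matrix_smult (x powi \<phi> g) (P ** \<alpha> g)"
    unfolding 1 using x by (simp add: power_int_minus)
qed

text \<open>The scalars x^\<phi> do not change which subspaces are invariant, so irreducibility of
  \<alpha> and \<beta> applies to the kernel and the range of \<open>P\<close>.\<close>

lemma schur:
  assumes irr: "irreducible_rep G \<alpha>" "irreducible_rep G \<beta>"
    and P: "\<And>g. g \<in> carrier G \<Longrightarrow> dual_action g P = P" "P \<noteq> 0"
  shows "\<exists>Q. Q ** P = mat 1 \<and> P ** Q = mat 1"
proof -
  let ?K = "{v. P *v v = 0}"
  have "vec.subspace ?K"
    by (auto simp: vec.subspace_def matrix_vector_right_distrib vector_scalar_commute)
  moreover have "\<alpha> g *v v \<in> ?K" if "g \<in> carrier G" "v \<in> ?K" for g v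
    using that intertwiner(1)[OF that(1) P(1)[OF that(1)]]
    by (simp add: matrix_vector_mul_assoc matrix_smult_mult_vec) (simp flip: matrix_vector_mul_assoc)
  ultimately have "?K = {0} \<or> ?K = UNIV" using irr(1) unfolding irreducible_rep_def by blast
  moreover have "?K \<noteq> UNIV"
  proof
    assume "?K = UNIV"
    then have "\<forall>v. P *v v = 0 *v v" by auto
    then show False using P(2) by (simp add: matrix_eq)
  qed
  ultimately have K: "?K = {0}" by blast
  have "inj ((*v) P)"
  proof (rule injI)
    fix u v assume "P *v u = P *v v"
    then have "u - v \<in> ?K" by (simp add: matrix_vector_mult_diff_distrib)
    then show "u = v" using K by auto
  qed
  then obtain Q where Q: "Q ** P = mat 1" using matrix_left_invertible_injective[of P] by blast
  let ?R = "range ((*v) P)"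
  have sub: "vec.subspace ?R" by (rule subspace_range_matrix)
  have inv: "\<beta> g *v v \<in> ?R" if "g \<in> carrier G" "v \<in> ?R" for g v
  proof -
    obtain u where u: "v = P *v u" using \<open>v \<in> ?R\<close> by (rule imageE)
    have "\<beta> g *v v = P *v (x powi \<phi> g *s (\<alpha> g *v u))"
      using intertwiner(2)[OF that(1) P(1)[OF that(1)]]
      by (simp add: u matrix_vector_mul_assoc matrix_smult_mult_vec vector_scalar_commute)
    then show ?thesis by simp
  qed
  have "?R = {0} \<or> ?R = UNIV"
    using irr(2)[unfolded irreducible_rep_def, THEN spec, THEN mp, OF conjI[OF sub]] inv by simp
  moreover have "?R \<noteq> {0}" using \<open>?K \<noteq> UNIV\<close> by blast
  ultimately have "surj ((*v) P)" by blast
  then obtain Q' where Q': "P ** Q' = mat 1" using matrix_right_invertible_surjective[of P] by blast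
  have "Q ** (P ** Q') = Q'" by (simp add: matrix_mul_assoc Q)
  moreover have "Q ** (P ** Q') = Q" by (simp add: Q')
  ultimately have "Q = Q'" by simp
  then show ?thesis using Q Q' by blast
qed

text \<open>If \<open>Hom(x\<^sup>\<phi> \<otimes> \<alpha>, \<beta>)\<close> has an invariant \<open>P\<close>, the complement \<open>{B. tr (B P\<^sup>-\<^sup>1) = 0}\<close> of \<open>P\<close> is isomorphic to
  both adjoint modules.\<close>

lemma H1_trace_zero_vanishes:
  assumes \<mu>: "\<mu> \<in> carrier G" "\<phi> \<mu> = 1" and irr: "irreducible_rep G \<alpha>"
    and P: "\<And>g. g \<in> carrier G \<Longrightarrow> dual_action g P = P" and Q: "Q ** P = mat 1" "P ** Q = mat 1"
    and \<Delta>: "is_twisted_alexander G \<phi> matrix_smult (tensor_dual \<alpha> \<beta>) 1 \<Delta>" "laurent_eval \<Delta> x \<noteq> 0"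
    and z: "\<And>g h. g \<in> carrier G \<Longrightarrow> h \<in> carrier G \<Longrightarrow> z (g \<otimes> h) = z g + dual_action g (z h)"
    and tr: "\<And>g. g \<in> carrier G \<Longrightarrow> trace_pair (z g) Q = 0"
  shows "\<exists>B. trace_pair B Q = 0 \<and> (\<forall>g\<in>carrier G. z g = dual_action g B - B)"
proof -
  obtain D0 where D0: "\<forall>g\<in>carrier G. \<phi> g = 0 \<longrightarrow> z g = dual_action g D0 - D0"
    using cocycle_coboundary_on_kernel[OF z \<Delta>] by blast
  have PQ: "trace_pair P Q = of_nat CARD('b)" by (simp add: trace_pair_def Q trace_I)
  \<comment> \<open>Subtracting a multiple of the invariant \<open>P\<close> leaves the coboundary
    unchanged and makes the trace with \<open>Q\<close> vanish, as the trace of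
    \<open>P ** Q\<close> is b.\<close>
  define D where "D = D0 - matrix_smult (trace_pair D0 Q / of_nat CARD('b)) P"
  have DQ: "trace_pair D Q = 0"
    by (simp add: D_def trace_pair_diff_left trace_pair_smult_left PQ)
  have dd: "dual_action g (B - C) = dual_action g B - dual_action g C" for g B C
    using linear_diff[OF linear_dual_action] .
  have D: "z g = dual_action g D - D" if "g \<in> carrier G" "\<phi> g = 0" for g
    using D0 that P by (simp add: D_def dd dual_action_smult)
  have Qg: "Q ** \<beta> g = matrix_smult (x powi \<phi> g) (\<alpha> g ** Q)" if g: "g \<in> carrier G" for g
  proof -
    have "Q ** \<beta> g = Q ** (\<beta> g ** P) ** Q" by (simp add: Q flip: matrix_mul_assoc)
    also have "\<dots> = matrix_smult (x powi \<phi> g) ((Q ** P) ** \<alpha> g ** Q)"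
      unfolding intertwiner(2)[OF g P[OF g]]
      by (simp add: matrix_smult_mult_left matrix_smult_mult_right matrix_mul_assoc)
    finally show ?thesis by (simp add: Q)
  qed
  let ?U = "{B. trace_pair B Q = 0}"
  have "\<exists>B\<in>?U. \<forall>g\<in>carrier G. z g = dual_action g B - B"
  proof (rule coboundary_from_kernel[OF \<phi> \<mu>, where act = dual_action and D = D])
    show "subspace ?U"
      by (auto simp: subspace_def trace_pair_add_left matrix_scaleR_eq_smult trace_pair_smult_left)
        (simp add: trace_pair_sum)
  next
    fix g B assume g: "g \<in> carrier G" and B: "B \<in> ?U"
    have "matrix_smult (x powi \<phi> (inv g)) (tensor_dual \<alpha> \<beta> (inv g) Q) = Q"
      using g Qg[OF g] x
      by (simp add: tensor_dual_def beta_facts phi_inv matrix_smult_mult_right alpha_facts power_int_minus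
          matrix_mul_assoc flip: matrix_mul_assoc[of "\<alpha> (inv g)" Q "\<beta> g"])
    then show "dual_action g B \<in> ?U" using g B by (simp add: trace_pair_dual_action)
  next
    fix B assume B: "B \<in> ?U" and inv: "\<And>g. g \<in> carrier G \<Longrightarrow> dual_action g B = B"
    \<comment> \<open>\<open>Q ** B\<close> is an endomorphism of \<alpha>, so it is scalar and
      \<open>B\<close> is a multiple of \<open>P\<close>; the trace condition then leaves only
      0.\<close>
    have comm: "\<alpha> g ** (Q ** B) = (Q ** B) ** \<alpha> g" if g: "g \<in> carrier G" for g
    proof -
      have "(Q ** B) ** \<alpha> g = Q ** (B ** \<alpha> g)" by (simp add: matrix_mul_assoc)
      also have "\<dots> = matrix_smult (x powi (- \<phi> g)) (Q ** \<beta> g ** B)"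
        unfolding intertwiner(1)[OF g inv[OF g]] by (simp add: matrix_smult_mult_right matrix_mul_assoc)
      also have "\<dots> = \<alpha> g ** (Q ** B)"
        unfolding Qg[OF g] using x by (simp add: matrix_smult_mult_left matrix_mul_assoc power_int_minus)
      finally show ?thesis by simp
    qed
    have "A ** (Q ** B) = (Q ** B) ** A" for A
      by (rule commutes_with_span[of _ "\<alpha> ` carrier G"])
        (use irreducible_rep_span(1)[OF is_group alpha_facts(1,2) irr] comm in auto)
    then obtain c where c: "Q ** B = matrix_smult c (mat 1)" using scalar_if_commutes_with_all by blast
    have "B = P ** (Q ** B)" by (simp add: matrix_mul_assoc Q)
    then have Bc: "B = matrix_smult c P" by (simp add: c matrix_smult_mult_right)
    with B have "c = 0" by (simp add: trace_pair_smult_left PQ)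
    then show "B = 0" using Bc by simp
  qed (use z tr D DQ in \<open>auto simp: linear_dual_action dual_action_mult dual_action_one\<close>)
  then show ?thesis by blast
qed

text \<open>If every cocycle is a coboundary, a first basis class would be trivial; so the dimension
  c - 1 of the cohomology must be 0.\<close>

lemma infinitesimally_regular_cocycle:
  fixes \<rho> :: "'g \<Rightarrow> complex^'c^'c"
  assumes "infinitesimally_regular G \<rho>"
    and "\<And>y. (\<And>g. g \<in> carrier G \<Longrightarrow> trace (y g) = 0) \<Longrightarrow>
      (\<And>g h. g \<in> carrier G \<Longrightarrow> h \<in> carrier G \<Longrightarrow> y (g \<otimes> h) = y g + \<rho> g ** y h ** matrix_inv (\<rho> g)) \<Longrightarrow>
      \<exists>v. trace v = 0 \<and> (\<forall>g\<in>carrier G. y g = \<rho> g ** v ** matrix_inv (\<rho> g) - v)"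
  shows "CARD('c) = 1"
proof (rule ccontr)
  assume "CARD('c) \<noteq> 1"
  then have d: "0 < CARD('c) - 1" using zero_less_card_finite[where 'a = 'c] by linarith
  let ?act = "\<lambda>g A. \<rho> g ** A ** matrix_inv (\<rho> g)" and ?V = "{A :: complex^'c^'c. trace A = 0}"
  let ?d = "CARD('c) - 1"
  obtain z where z: "\<forall>j<?d. z j \<in> cocycles1 G ?V ?act"
    "\<forall>r. (\<lambda>g. \<Sum>j<?d. matrix_smult (r j) (z j g)) \<in> coboundaries1 G ?V ?act \<longrightarrow> (\<forall>j<?d. r j = 0)"
    using assms(1) unfolding infinitesimally_regular_def H1_has_dim_def by blast
  have "z 0 \<in> cocycles1 G ?V ?act" using z(1) d by blast
  then obtain v where v: "trace v = 0" "\<forall>g\<in>carrier G. z 0 g = ?act g v - v"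
    using assms(2)[of "z 0"] by (auto simp: cocycles1_def)
  let ?r = "\<lambda>j::nat. if j = 0 then 1 else 0 :: complex"
  have "(\<Sum>j<?d. matrix_smult (?r j) (z j g)) = z 0 g" for g
  proof -
    have "(\<Sum>j<?d. matrix_smult (?r j) (z j g)) = (\<Sum>j<?d. if j = 0 then z 0 g else 0)"
      by (intro sum.cong) auto
    then show ?thesis using d by simp
  qed
  then have "(\<lambda>g. \<Sum>j<?d. matrix_smult (?r j) (z j g)) \<in> coboundaries1 G ?V ?act"
    using v by (auto simp: coboundaries1_def)
  then have "\<forall>j<?d. ?r j = 0" using z(2)[rule_format, of ?r] by blast
  from this[rule_format, OF d] show False by simp
qed

text \<open>Multiplication by \<open>P\<close>, on the left for \<alpha> and on the right for
  \<beta>, carries the adjoint modules equivariantly to the trace zero complement of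
  \<open>P\<close> (\<open>PA\<close>, \<open>BP\<close>), and multiplication by \<open>Q\<close>
  carries coboundaries back.\<close>

theorem one_dimensional_if_intertwined:
  assumes \<mu>: "\<mu> \<in> carrier G" "\<phi> \<mu> = 1" and irr: "irreducible_rep G \<alpha>" "irreducible_rep G \<beta>"
    and reg: "infinitesimally_regular G \<alpha>" "infinitesimally_regular G \<beta>"
    and P: "\<And>g. g \<in> carrier G \<Longrightarrow> dual_action g P = P" "P \<noteq> 0"
    and \<Delta>: "is_twisted_alexander G \<phi> matrix_smult (tensor_dual \<alpha> \<beta>) 1 \<Delta>" "laurent_eval \<Delta> x \<noteq> 0"
  shows "CARD('a) = 1" "CARD('b) = 1"
proof -
  obtain Q where Q: "Q ** P = mat 1" "P ** Q = mat 1" using schur[OF irr P] by blast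
  note van = H1_trace_zero_vanishes[OF \<mu> irr(1) P(1) Q \<Delta>]
  have PA: "P ** (\<alpha> g ** A ** matrix_inv (\<alpha> g)) = dual_action g (P ** A)" if g: "g \<in> carrier G" for g A
    using intertwiner(1)[OF g P(1)[OF g]] g
    by (simp add: dual_action_def alpha_facts matrix_mul_assoc matrix_smult_mult_left)
  have BP: "(\<beta> g ** A ** matrix_inv (\<beta> g)) ** P = dual_action g (A ** P)" if g: "g \<in> carrier G" for g A
  proof -
    have "P ** \<alpha> (inv g) = matrix_smult (x powi \<phi> g) (\<beta> (inv g) ** P)"
      using intertwiner(1)[OF _ P(1), of "inv g"] g by (simp add: phi_inv)
    then have "dual_action g (A ** P) = matrix_smult (x powi (- \<phi> g)) (\<beta> g ** A ** matrix_smult (x powi \<phi> g) (\<beta> (inv g) ** P))"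
      by (simp add: dual_action_def flip: matrix_mul_assoc)
    then show ?thesis
      using x g by (simp add: beta_facts matrix_smult_mult_right matrix_mul_assoc power_int_minus)
  qed
  show "CARD('a) = 1"
  proof (rule infinitesimally_regular_cocycle[OF reg(1)])
    fix y :: "'g \<Rightarrow> complex^'a^'a"
    assume tr: "\<And>g. g \<in> carrier G \<Longrightarrow> trace (y g) = 0"
      and y: "\<And>g h. g \<in> carrier G \<Longrightarrow> h \<in> carrier G \<Longrightarrow> y (g \<otimes> h) = y g + \<alpha> g ** y h ** matrix_inv (\<alpha> g)"
    have "trace_pair (P ** y g) Q = 0" if "g \<in> carrier G" for g
      using tr[OF that] trace_mul_sym[of "P ** y g" Q] by (simp add: trace_pair_def matrix_mul_assoc Q)
    moreover have "P ** y (g \<otimes> h) = P ** y g + dual_action g (P ** y h)" if "g \<in> carrier G" "h \<in> carrier G" for g h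
      using y[OF that] PA[OF that(1)] by (simp add: matrix_add_ldistrib)
    ultimately obtain B where B: "trace_pair B Q = 0" "\<forall>g\<in>carrier G. P ** y g = dual_action g B - B"
      using van[of "\<lambda>g. P ** y g"] by blast
    have BQ: "B = P ** (Q ** B)" by (simp add: matrix_mul_assoc Q)
    have "y g = \<alpha> g ** (Q ** B) ** matrix_inv (\<alpha> g) - Q ** B" if g: "g \<in> carrier G" for g
    proof -
      have "P ** y g = P ** (\<alpha> g ** (Q ** B) ** matrix_inv (\<alpha> g)) - P ** (Q ** B)"
        unfolding PA[OF g] using B(2) g BQ by simp
      then have "Q ** (P ** y g) = Q ** (P ** (\<alpha> g ** (Q ** B) ** matrix_inv (\<alpha> g) - Q ** B))"
        by (simp add: matrix_sub_ldistrib)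
      then show ?thesis by (simp add: matrix_mul_assoc Q)
    qed
    moreover have "trace (Q ** B) = 0" using B(1) trace_mul_sym[of B Q] by (simp add: trace_pair_def)
    ultimately show "\<exists>v. trace v = 0 \<and> (\<forall>g\<in>carrier G. y g = \<alpha> g ** v ** matrix_inv (\<alpha> g) - v)" by blast
  qed
  show "CARD('b) = 1"
  proof (rule infinitesimally_regular_cocycle[OF reg(2)])
    fix y :: "'g \<Rightarrow> complex^'b^'b"
    assume tr: "\<And>g. g \<in> carrier G \<Longrightarrow> trace (y g) = 0"
      and y: "\<And>g h. g \<in> carrier G \<Longrightarrow> h \<in> carrier G \<Longrightarrow> y (g \<otimes> h) = y g + \<beta> g ** y h ** matrix_inv (\<beta> g)"
    have "trace_pair (y g ** P) Q = 0" if "g \<in> carrier G" for g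
      using tr[OF that] by (simp add: trace_pair_def Q flip: matrix_mul_assoc)
    moreover have "y (g \<otimes> h) ** P = y g ** P + dual_action g (y h ** P)" if "g \<in> carrier G" "h \<in> carrier G" for g h
      using y[OF that] BP[OF that(1)] by (simp add: matrix_add_rdistrib')
    ultimately obtain B where B: "trace_pair B Q = 0" "\<forall>g\<in>carrier G. y g ** P = dual_action g B - B"
      using van[of "\<lambda>g. y g ** P"] by blast
    have BQ: "B = (B ** Q) ** P" by (simp add: Q flip: matrix_mul_assoc)
    have "y g = \<beta> g ** (B ** Q) ** matrix_inv (\<beta> g) - B ** Q" if g: "g \<in> carrier G" for g
    proof -
      have "y g ** P = (\<beta> g ** (B ** Q) ** matrix_inv (\<beta> g)) ** P - (B ** Q) ** P"
        unfolding BP[OF g] using B(2) g BQ by simp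
      then have "y g ** P ** Q = (\<beta> g ** (B ** Q) ** matrix_inv (\<beta> g) - B ** Q) ** P ** Q"
        by (simp add: matrix_sub_rdistrib)
      then show ?thesis by (simp add: Q flip: matrix_mul_assoc)
    qed
    moreover have "trace (B ** Q) = 0" using B(1) by (simp add: trace_pair_def)
    ultimately show "\<exists>v. trace v = 0 \<and> (\<forall>g\<in>carrier G. y g = \<beta> g ** v ** matrix_inv (\<beta> g) - v)" by blast
  qed
qed

end


section \<open>Formal deformations of a reducible representation\<close>

lemma fun_sum_eq: "(\<lambda>p. \<Sum>i\<in>I. f i p) = (\<Sum>i\<in>I. (f i :: 'p \<Rightarrow> 'c::comm_monoid_add))"
  by (induction I rule: infinite_finite_induct) (auto simp: fun_eq_iff)

lemma fun_prod_eq: "(\<lambda>p. \<Prod>i\<in>I. f i p) = (\<Prod>i\<in>I. (f i :: 'p \<Rightarrow> 'c::comm_monoid_mult))"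
  by (induction I rule: infinite_finite_induct) (auto simp: fun_eq_iff)

interpretation fun_space: vector_space "\<lambda>c (f :: 'p \<Rightarrow> complex) p. c * f p"
  by unfold_locales (auto simp: fun_eq_iff algebra_simps)

definition entries_in :: "('p \<Rightarrow> complex) set \<Rightarrow> ('p \<Rightarrow> complex^'m^'n) \<Rightarrow> bool" where
  "entries_in I F \<longleftrightarrow> (\<forall>i j. (\<lambda>p. F p $ i $ j) \<in> I)"

locale max_ideal_filtration =
  fixes Y :: "('p \<Rightarrow> complex) set" and p0 :: 'p
begin

abbreviation ipow :: "nat \<Rightarrow> ('p \<Rightarrow> complex) set" where
  "ipow \<equiv> ideal_pow (function_algebra Y) (max_ideal Y p0)"

lemmas alg = is_subring_function_algebra[of Y]
lemmas ipow_add = ideal_pow_add[OF is_subring_function_algebra[of Y], where M = "max_ideal Y p0"]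
lemmas ipow_diff = ideal_pow_diff[OF is_subring_function_algebra[of Y] max_ideal_subset[of Y p0]]
lemmas ipow_sum = ideal_pow_sum[OF is_subring_function_algebra[of Y], where M = "max_ideal Y p0"]
lemmas ipow_mult = ideal_pow_mult[OF is_subring_function_algebra[of Y] _ _ max_ideal_subset[of Y p0]]

lemma ipow_scale: "f \<in> ipow k \<Longrightarrow> (\<lambda>p. c * f p) \<in> ipow k"
  using ideal_pow_mult_left[OF alg max_ideal_subset[of Y p0] const_in_function_algebra[of c Y], of f k]
  by (simp add: times_fun_def)

lemma ipow_mono: "i \<le> j \<Longrightarrow> f \<in> ipow j \<Longrightarrow> f \<in> ipow i"
  using ideal_pow_antimono[OF alg max_ideal_subset[of Y p0], of i j] by blast

lemma subspace_ipow: "fun_space.subspace (ipow k)"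
  unfolding fun_space.subspace_def
  using ideal_pow_zero[OF alg] ipow_add ipow_scale by blast

lemma ent_mult:
  assumes "entries_in (ipow i) F" "entries_in (ipow j) H"
  shows "entries_in (ipow (i + j)) (\<lambda>p. F p ** H p)"
  unfolding entries_in_def
proof (intro allI)
  fix r s
  have "(\<lambda>p. (F p ** H p) $ r $ s) = (\<Sum>l\<in>UNIV. (\<lambda>p. F p $ r $ l) * (\<lambda>p. H p $ l $ s))"
    by (simp add: matrix_matrix_mult_def fun_sum_eq[symmetric] times_fun_def)
  also have "\<dots> \<in> ipow (i + j)"
    using assms by (intro ipow_sum ipow_mult) (auto simp: entries_in_def)
  finally show "(\<lambda>p. (F p ** H p) $ r $ s) \<in> ipow (i + j)" .
qed

lemma ent_mult_left: "entries_in (ipow 0) F \<Longrightarrow> entries_in (ipow k) H \<Longrightarrow> entries_in (ipow k) (\<lambda>p. F p ** H p)"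
  using ent_mult[of 0 F k H] by simp

lemma ent_mult_right: "entries_in (ipow k) F \<Longrightarrow> entries_in (ipow 0) H \<Longrightarrow> entries_in (ipow k) (\<lambda>p. F p ** H p)"
  using ent_mult[of k F 0 H] by simp

lemma ent_add:
  assumes "entries_in (ipow k) F" "entries_in (ipow k) H"
  shows "entries_in (ipow k) (\<lambda>p. F p + H p)"
proof -
  have "(\<lambda>p. F p $ i $ j) + (\<lambda>p. H p $ i $ j) \<in> ipow k" for i j
    using assms by (intro ipow_add) (auto simp: entries_in_def)
  then show ?thesis by (simp add: entries_in_def plus_fun_def)
qed

lemma ent_diff:
  assumes "entries_in (ipow k) F" "entries_in (ipow k) H"
  shows "entries_in (ipow k) (\<lambda>p. F p - H p)"
proof -
  have "(\<lambda>p. F p $ i $ j) - (\<lambda>p. H p $ i $ j) \<in> ipow k" for i j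
    using assms by (intro ipow_diff) (auto simp: entries_in_def)
  then show ?thesis by (simp add: entries_in_def fun_diff_def)
qed

lemma ent_mono: "i \<le> j \<Longrightarrow> entries_in (ipow j) F \<Longrightarrow> entries_in (ipow i) F"
  using ipow_mono unfolding entries_in_def by blast

lemma ent_const: "entries_in (ipow 0) (\<lambda>_. C)"
  by (simp add: entries_in_def const_in_function_algebra)

lemma ent_zero: "entries_in (ipow k) (\<lambda>_. 0)"
  using ideal_pow_zero[OF alg, where M = "max_ideal Y p0" and k = k]
  unfolding entries_in_def zero_fun_def by simp

lemma ent_one:
  assumes "entries_in (ipow 0) F" "F p0 = 0"
  shows "entries_in (ipow 1) F"
  unfolding entries_in_def
proof (intro allI)
  fix i j
  have "(\<lambda>p. F p $ i $ j) \<in> max_ideal Y p0"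
    using assms by (simp add: max_ideal_def entries_in_def)
  then show "(\<lambda>p. F p $ i $ j) \<in> ipow 1" by (rule ideal_pow_one[OF alg])
qed

lemma ent_minus_value:
  assumes "entries_in (ipow 0) F" shows "entries_in (ipow 1) (\<lambda>p. F p - F p0)"
  by (rule ent_one) (use ent_diff[OF assms ent_const] in simp_all)

lemma ent_uminus: "entries_in (ipow k) F \<Longrightarrow> entries_in (ipow k) (\<lambda>p. - F p)"
  using ipow_scale[of _ k "-1"] by (simp add: entries_in_def)

lemma ent_one_pos: "entries_in (ipow k) F \<Longrightarrow> 1 \<le> k \<Longrightarrow> F p0 = 0"
proof -
  assume F: "entries_in (ipow k) F" "1 \<le> k"
  have *: "f p0 = 0" if "f \<in> ipow 1" for f
  proof -
    have "f \<in> ideal_gen (function_algebra Y) (max_ideal Y p0)" using that by simp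
    then show ?thesis by induction (auto simp: max_ideal_def)
  qed
  have "(\<lambda>p. F p $ i $ j) \<in> ipow 1" for i j
    using ent_mono[OF F(2,1)] unfolding entries_in_def by blast
  from *[OF this] show ?thesis by (simp add: vec_eq_iff)
qed

text \<open>In the Leibniz expansion every product contains an entry of column \<open>c\<close>.\<close>

lemma det_in_ipow:
  fixes F :: "'p \<Rightarrow> complex^'m^'m"
  assumes F: "entries_in (ipow 0) F" and c: "\<And>i. (\<lambda>p. F p $ i $ c) \<in> ipow k"
  shows "(\<lambda>p. det (F p)) \<in> ipow k"
proof -
  have "(\<lambda>p. of_int (sign \<pi>) * (\<Prod>i\<in>UNIV. F p $ i $ \<pi> i)) \<in> ipow k" if \<pi>: "\<pi> permutes UNIV" for \<pi>
  proof -
    obtain i where i: "\<pi> i = c" using \<pi> by (metis permutes_univ)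
    have "(\<Prod>j\<in>UNIV - {i}. (\<lambda>p. F p $ j $ \<pi> j)) \<in> ipow 0"
      using F by (auto simp: entries_in_def intro!: is_subring_prod[OF alg])
    then have "(\<lambda>p. F p $ i $ c) * (\<Prod>j\<in>UNIV - {i}. (\<lambda>p. F p $ j $ \<pi> j)) \<in> ipow (k + 0)"
      by (intro ipow_mult c)
    moreover have "(\<lambda>p. F p $ i $ c) * (\<Prod>j\<in>UNIV - {i}. (\<lambda>p. F p $ j $ \<pi> j)) = (\<lambda>p. \<Prod>j\<in>UNIV. F p $ j $ \<pi> j)"
    proof
      fix p
      show "((\<lambda>p. F p $ i $ c) * (\<Prod>j\<in>UNIV - {i}. (\<lambda>p. F p $ j $ \<pi> j))) p = (\<Prod>j\<in>UNIV. F p $ j $ \<pi> j)"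
        using i by (simp add: fun_prod_eq[symmetric] prod.remove[of UNIV i])
    qed
    ultimately show ?thesis using ipow_scale by simp
  qed
  then show ?thesis
    unfolding det_def fun_sum_eq by (intro ipow_sum) simp
qed

end

text \<open>For functionals without common zero, each coordinate is a finite combination of them.
  Applied to the entries of g X - X it recovers X from its coboundary by a linear formula, which
  still makes sense for entries in m^k.\<close>

lemma span_explicit_functional:
  fixes E :: "'i \<Rightarrow> complex^'a^'b \<Rightarrow> complex"
  assumes lin: "\<And>i. i \<in> I \<Longrightarrow> Vector_Spaces.linear matrix_smult (*) (E i)"
    and inj: "\<And>B. (\<And>i. i \<in> I \<Longrightarrow> E i B = 0) \<Longrightarrow> B = 0"
  shows "\<exists>t c. finite t \<and> t \<subseteq> I \<and> (\<forall>B. B $ k $ l = (\<Sum>i\<in>t. c i * E i B))"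
proof -
  have "\<forall>i\<in>I. \<exists>w :: complex^'b^'a. \<forall>B. E i B = trace_pair w B"
    using trace_pair_representation[OF lin] by blast
  then obtain w :: "'i \<Rightarrow> complex^'b^'a" where w: "\<forall>i\<in>I. \<forall>B. E i B = trace_pair (w i) B"
    using bchoice by metis
  have wB: "E i B = trace_pair B (w i)" if "i \<in> I" for i B
    using w that trace_mul_sym[of "w i" B] by (simp add: trace_pair_def)
  have "matrix_unit l k \<in> mat_space.span (w ` I)"
  proof (rule ccontr)
    assume "matrix_unit l k \<notin> mat_space.span (w ` I)"
    then obtain f where f: "Vector_Spaces.linear matrix_smult (*) f"
      "\<forall>s\<in>mat_space.span (w ` I). f s = 0" "f (matrix_unit l k) = 1"
      using mat_space.functional_separation by blast
    obtain B where B: "\<And>A. f A = trace_pair B A" using trace_pair_representation[OF f(1)] by blast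
    have "E i B = 0" if "i \<in> I" for i
      using wB[OF that] B f(2) mat_space.span_base[OF imageI[OF that]] by metis
    then have "B = 0" by (rule inj)
    then show False using f(3) B by (simp add: trace_pair_sum)
  qed
  then obtain s r where s: "finite s" "s \<subseteq> w ` I" "matrix_unit l k = (\<Sum>a\<in>s. matrix_smult (r a) a)"
    unfolding mat_space.span_explicit by blast
  then obtain t where t: "t \<subseteq> I" "inj_on w t" "s = w ` t"
    using subset_image_inj[of s w I] by blast
  have "finite t" using s(1) t(2,3) by (simp add: finite_image_iff)
  have "B $ k $ l = (\<Sum>i\<in>t. r (w i) * E i B)" for B
  proof -
    have "B $ k $ l = trace_pair B (matrix_unit l k)" by (simp add: trace_pair_matrix_unit)
    also have "\<dots> = (\<Sum>i\<in>t. r (w i) * trace_pair B (w i))"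
      unfolding s(3) t(3) by (simp add: additive.sum[OF additive_trace_pair] trace_pair_smult sum.reindex[OF t(2)])
    also have "\<dots> = (\<Sum>i\<in>t. r (w i) * E i B)"
      using t(1) wB by (intro sum.cong refl) auto
    finally show ?thesis .
  qed
  then show ?thesis using t(1) \<open>finite t\<close>
    by (intro exI[of _ t] exI[of _ "\<lambda>i. r (w i)"]) simp
qed

section \<open>Block matrices and conjugation by shears\<close>

definition blk11 :: "complex^('a::finite+'b::finite)^('a+'b) \<Rightarrow> complex^'a^'a" where "blk11 M = (\<chi> i j. M $ Inl i $ Inl j)"
definition blk12 :: "complex^('a::finite+'b::finite)^('a+'b) \<Rightarrow> complex^'b^'a" where "blk12 M = (\<chi> i j. M $ Inl i $ Inr j)"
definition blk21 :: "complex^('a::finite+'b::finite)^('a+'b) \<Rightarrow> complex^'a^'b" where "blk21 M = (\<chi> i j. M $ Inr i $ Inl j)"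
definition blk22 :: "complex^('a::finite+'b::finite)^('a+'b) \<Rightarrow> complex^'b^'b" where "blk22 M = (\<chi> i j. M $ Inr i $ Inr j)"

lemmas blk_defs = blk11_def blk12_def blk21_def blk22_def

lemma sum_UNIV_Plus: "(\<Sum>x\<in>(UNIV :: ('a::finite + 'b::finite) set). f x) = (\<Sum>i\<in>UNIV. f (Inl i)) + (\<Sum>j\<in>UNIV. f (Inr j))"
  using sum.Plus[of "UNIV :: 'a set" "UNIV :: 'b set" f] by simp

lemma blk_mult:
  "blk11 (M ** N) = blk11 M ** blk11 N + blk12 M ** blk21 N"
  "blk12 (M ** N) = blk11 M ** blk12 N + blk12 M ** blk22 N"
  "blk21 (M ** N) = blk21 M ** blk11 N + blk22 M ** blk21 N"
  "blk22 (M ** N) = blk21 M ** blk12 N + blk22 M ** blk22 N"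
  by (simp_all add: vec_eq_iff blk_defs matrix_matrix_mult_def sum_UNIV_Plus)

lemma blk_mat_1: "blk11 (mat 1) = mat 1" "blk12 (mat 1) = 0" "blk21 (mat 1) = 0" "blk22 (mat 1) = mat 1"
  by (simp_all add: vec_eq_iff blk_defs mat_def)

lemma blk_eqI:
  assumes "blk11 M = blk11 N" "blk12 M = blk12 N" "blk21 M = blk21 N" "blk22 M = blk22 N"
  shows "M = N"
  unfolding vec_eq_iff
proof (intro allI)
  fix i j show "M $ i $ j = N $ i $ j"
    using assms by (cases i; cases j) (simp_all add: vec_eq_iff blk_defs)
qed

definition shear :: "complex^'a^'b \<Rightarrow> complex^('a::finite+'b::finite)^('a+'b)" where
  "shear X = (\<chi> i j. case (i, j) of (Inr i', Inl j') \<Rightarrow> X $ i' $ j' | _ \<Rightarrow> if i = j then 1 else 0)"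

lemma blk_shear: "blk11 (shear X) = mat 1" "blk12 (shear X) = 0" "blk21 (shear X) = X" "blk22 (shear X) = mat 1"
  by (simp_all add: vec_eq_iff blk_defs shear_def mat_def)

lemma shear_add: "shear X ** shear Z = shear (X + Z)"
  by (rule blk_eqI) (simp_all add: blk_mult blk_shear)

lemma shear_0: "shear 0 = mat 1"
  by (rule blk_eqI) (simp_all add: blk_mat_1 blk_shear)

lemma matrix_uminus_mult: "(- A) ** B = - (A ** (B :: complex^'p^'m))"
  by (simp add: vec_eq_iff matrix_matrix_mult_def sum_negf)

text \<open>The terms linear in \<open>X\<close> are a coboundary to leading order; the last one is
  quadratic and hence of higher order in the filtration.\<close>

lemma blk21_shear_conj:
  "blk21 (shear (- X) ** M ** shear X) = blk21 M + blk22 M ** X - X ** blk11 M - X ** blk12 M ** X"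
  by (simp add: blk_mult blk_shear matrix_add_ldistrib matrix_add_rdistrib' matrix_sub_rdistrib
      matrix_uminus_mult matrix_mul_assoc)

text \<open>The members R p have entries in the algebra generated by \<open>Y\<close>. Both
  \<open>fin\<close> and \<open>dom\<close> serve Krull's theorem; they will come from finite
  generation of the group and irreducibility of the set of representations.\<close>

locale rep_family = max_ideal_filtration Y p0 + group G
  for Y :: "('p \<Rightarrow> complex) set" and p0 :: 'p and G :: "'g monoid" (structure) +
  fixes R :: "'p \<Rightarrow> 'g \<Rightarrow> complex^'n^'n"
  assumes fin: "finite Y"
    and dom: "\<And>u v. u \<in> function_algebra Y \<Longrightarrow> v \<in> function_algebra Y \<Longrightarrow> u * v = 0 \<Longrightarrow> u = 0 \<or> v = 0"
    and R_mult: "\<And>p g h. g \<in> carrier G \<Longrightarrow> h \<in> carrier G \<Longrightarrow> R p (g \<otimes> h) = R p g ** R p h"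
    and R_one: "\<And>p. R p \<one> = mat 1"
    and ent: "\<And>g. g \<in> carrier G \<Longrightarrow> entries_in (ipow 0) (\<lambda>p. R p g)"
begin

lemma R_inv: "g \<in> carrier G \<Longrightarrow> R p g ** R p (inv g) = mat 1" "g \<in> carrier G \<Longrightarrow> R p (inv g) ** R p g = mat 1"
  by (simp_all add: R_one flip: R_mult)

lemmas R_facts = R_mult R_one R_inv

lemma in_all_ipow_eq_0: "(\<And>k. 1 \<le> k \<Longrightarrow> f \<in> ipow k) \<Longrightarrow> f = 0"
proof (rule krull_intersection_domain[OF fin _ dom])
  fix k assume f: "\<And>k. 1 \<le> k \<Longrightarrow> f \<in> ipow k"
  show "f \<in> ipow k" using ipow_mono[OF _ f[of "Suc k"], of k] by simp
qed

end

locale block_rep_family = rep_family Y p0 G R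
  for Y :: "('p \<Rightarrow> complex) set" and p0 :: 'p and G :: "'g monoid" (structure)
    and R :: "'p \<Rightarrow> 'g \<Rightarrow> complex^('a::finite+'b::finite)^('a+'b)" +
  assumes diag: "\<And>g. g \<in> carrier G \<Longrightarrow> blk12 (R p0 g) = 0 \<and> blk21 (R p0 g) = 0"
begin

definition "A' g = blk11 (R p0 g)"
definition "B' g = blk22 (R p0 g)"
definition "hact g X = B' g ** X ** A' (inv g)"

lemma A'B'_mult:
  assumes "g \<in> carrier G" "h \<in> carrier G"
  shows "A' (g \<otimes> h) = A' g ** A' h" "B' (g \<otimes> h) = B' g ** B' h"
  using assms diag by (simp_all add: A'_def B'_def R_facts blk_mult)

lemma A'B'_inv:
  assumes "g \<in> carrier G"
  shows "A' g ** A' (inv g) = mat 1" "A' (inv g) ** A' g = mat 1"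
  using A'B'_mult[of g "inv g"] A'B'_mult[of "inv g" g] assms
  by (simp_all add: A'_def R_facts blk_mat_1)

text \<open>A block lower triangular change of basis makes the lower left block vanish modulo \<open>\<mm>\<^sup>k\<close>. The
  obstruction to passing from \<open>k\<close> to \<open>k + 1\<close> is a class in \<open>H\<^sup>1(G; Hom(A', B')) \<otimes> \<mm>\<^sup>k/\<mm>\<^sup>k\<^sup>+\<^sup>1\<close>.\<close>

lemma triangular_mod_ipow:
  assumes H0: "\<And>X. (\<And>g. g \<in> carrier G \<Longrightarrow> hact g X = X) \<Longrightarrow> X = 0"
    and H1: "\<And>z. (\<And>g h. g \<in> carrier G \<Longrightarrow> h \<in> carrier G \<Longrightarrow> z (g \<otimes> h) = z g + hact g (z h)) \<Longrightarrow>
       \<exists>X. \<forall>g\<in>carrier G. z g = hact g X - X"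
  shows "\<exists>C C'. entries_in (ipow 0) C \<and> entries_in (ipow 0) C' \<and>
     (\<forall>p. C p ** C' p = mat 1) \<and> C p0 = mat 1 \<and> C' p0 = mat 1 \<and>
     (\<forall>g\<in>carrier G. entries_in (ipow (Suc k)) (\<lambda>p. blk21 (C' p ** R p g ** C p)))"
proof (induction k)
  case 0
  have "entries_in (ipow 1) (\<lambda>p. blk21 (R p g))" if "g \<in> carrier G" for g
    using ent[OF that] diag[OF that] by (intro ent_one) (auto simp: entries_in_def blk21_def)
  then show ?case
    by (intro exI[of _ "\<lambda>_. mat 1"]) (simp add: ent_const del: ideal_pow.simps)
next
  case (Suc k0)
  define k where "k = Suc k0"
  then have k: "1 \<le> k" by simp
  obtain C C' where C: "entries_in (ipow 0) C" "entries_in (ipow 0) C'" "\<And>p. C p ** C' p = mat 1"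
    "C p0 = mat 1" "C' p0 = mat 1"
    "\<And>g. g \<in> carrier G \<Longrightarrow> entries_in (ipow k) (\<lambda>p. blk21 (C' p ** R p g ** C p))"
    using Suc.IH unfolding k_def by blast
  define R' where "R' p g = C' p ** R p g ** C p" for p g
  define E where "E p g = blk21 (R' p g)" for p g
  have R'_mult: "R' p (g \<otimes> h) = R' p g ** R' p h" if "g \<in> carrier G" "h \<in> carrier G" for p g h
  proof -
    have "R' p g ** R' p h = C' p ** R p g ** (C p ** C' p) ** R p h ** C p"
      by (simp only: R'_def matrix_mul_assoc)
    then show ?thesis using that by (simp add: C(3) R'_def R_facts matrix_mul_assoc)
  qed
  have R'_ent: "entries_in (ipow 0) (\<lambda>p. R' p g)" if "g \<in> carrier G" for g
    unfolding R'_def using C(1,2) ent[OF that] by (intro ent_mult_left)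
  have R'_p0: "R' p0 g = R p0 g" for g by (simp add: R'_def C(4,5))
  have E: "entries_in (ipow k) (\<lambda>p. E p g)" if "g \<in> carrier G" for g
    using C(6)[OF that] by (simp add: E_def R'_def)
  have P1: "entries_in (ipow 1) (\<lambda>p. blk11 (R' p g) - A' g)" and N1: "entries_in (ipow 1) (\<lambda>p. blk22 (R' p g) - B' g)"
    and Q0: "entries_in (ipow 0) (\<lambda>p. blk12 (R' p g))"
    if "g \<in> carrier G" for g
  proof -
    have 0: "entries_in (ipow 0) (\<lambda>p. blk11 (R' p g))" "entries_in (ipow 0) (\<lambda>p. blk22 (R' p g))"
      "entries_in (ipow 0) (\<lambda>p. blk12 (R' p g))"
      using R'_ent[OF that] by (auto simp: entries_in_def blk_defs)
    show "entries_in (ipow 1) (\<lambda>p. blk11 (R' p g) - A' g)" "entries_in (ipow 1) (\<lambda>p. blk22 (R' p g) - B' g)"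
      using ent_minus_value[OF 0(1)] ent_minus_value[OF 0(2)] by (simp_all only: R'_p0 A'_def B'_def)
    show "entries_in (ipow 0) (\<lambda>p. blk12 (R' p g))" by (rule 0)
  qed
  \<comment> \<open>Modulo m^(k+1) the block satisfies E(gh) = E(g) A'(h) + B'(g) E(h); multiplying
    by the inverse of A'(g) on the right turns this into the cocycle identity for
    \<open>hact\<close>.\<close>
  define z where "z p g = E p g ** A' (inv g)" for p g
  have z: "entries_in (ipow k) (\<lambda>p. z p g)" if "g \<in> carrier G" for g
    unfolding z_def using E[OF that] ent_const by (rule ent_mult_right)
  define I where "I = {(g, i, j). g \<in> carrier G \<and> i \<in> (UNIV :: 'b set) \<and> j \<in> (UNIV :: 'a set)}"
  define del where "del s X = (case s of (g, i, j) \<Rightarrow> (hact g X - X) $ i $ j)" for s X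
  define rec where "rec i j t c \<longleftrightarrow> finite t \<and> t \<subseteq> I \<and> (\<forall>X. X $ i $ j = (\<Sum>s\<in>t. c s * del s X))" for i j t c
  have "\<exists>t c. rec i j t c" for i j
    unfolding rec_def
  proof (rule span_explicit_functional)
    fix s assume "s \<in> I"
    obtain g a b where s: "s = (g, a, b)" by (metis prod.exhaust)
    show "Vector_Spaces.linear matrix_smult (*) (del s)"
      by unfold_locales
        (simp_all add: del_def s hact_def matrix_add_ldistrib matrix_add_rdistrib' matrix_smult_mult_left
          matrix_smult_mult_right algebra_simps)
  next
    fix X assume X: "\<And>s. s \<in> I \<Longrightarrow> del s X = 0"
    have "hact g X $ i $ j = X $ i $ j" if "g \<in> carrier G" for g i j
      using X[of "(g, i, j)"] that by (simp add: I_def del_def)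
    then have "hact g X = X" if "g \<in> carrier G" for g
      using that by (simp add: vec_eq_iff)
    then show "X = 0" by (rule H0)
  qed
  then obtain t c where "\<And>i j. rec i j (t i j) (c i j)" by metis
  then have t: "\<And>i j. t i j \<subseteq> I" and tc: "\<And>i j X. X $ i $ j = (\<Sum>s\<in>t i j. c i j s * del s X)"
    unfolding rec_def by blast+
  define zc where "zc p s = (case s of (g, i, j) \<Rightarrow> z p g $ i $ j)" for p s
  have zc: "(\<lambda>p. zc p s) \<in> ipow k" if "s \<in> I" for s
    using that z by (auto simp: I_def zc_def entries_in_def)
  \<comment> \<open>The formulas recovering a matrix from its coboundary, applied with opposite sign
    to the approximate cocycle. They use finitely many group elements and scalar coefficients, so
    \<open>V\<close> keeps its entries in m^k.\<close>
  define V :: "'p \<Rightarrow> complex^'a^'b" where "V p = (\<chi> i j. - (\<Sum>s\<in>t i j. c i j s * zc p s))" for p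
  have V: "entries_in (ipow k) V"
  proof -
    have "(\<lambda>p. \<Sum>s\<in>t i j. c i j s * zc p s) \<in> ipow k" for i j
      unfolding fun_sum_eq using t by (intro ipow_sum ipow_scale zc) blast
    then show ?thesis using ipow_scale[of _ k "-1"] by (simp add: entries_in_def V_def)
  qed
  \<comment> \<open>Tested by linear functionals u that vanish on m^(k+1). Applying u to the entries
    of z gives a genuine complex cocycle, which \<open>H1\<close> makes the coboundary of some X;
    the recovery formulas give u(V) = -X, and u of the new block is 0. No tensor product with
    m^k/m^(k+1) has to be formed.\<close>
  have main: "entries_in (ipow (Suc k)) (\<lambda>p. E p g + B' g ** V p - V p ** A' g)" if g: "g \<in> carrier G" for g
    unfolding entries_in_def
  proof (intro allI, rule ccontr)
    fix i j
    let ?T = "\<lambda>p. E p g + B' g ** V p - V p ** A' g"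
    let ?f = "\<lambda>p. ?T p $ i $ j"
    assume "?f \<notin> ipow (Suc k)"
    then have "?f \<notin> fun_space.span (ipow (Suc k))"
      using fun_space.span_minimal[OF subset_refl subspace_ipow] by blast
    then obtain u where u: "Vector_Spaces.linear (\<lambda>c f p. c * f p) (*) u"
      "\<forall>f\<in>fun_space.span (ipow (Suc k)). u f = 0" "u ?f = 1"
      using fun_space.functional_separation by blast
    interpret u: Vector_Spaces.linear "\<lambda>c f p. c * f p" "(*)" u by (rule u(1))
    have uadd: "u (\<lambda>p. f p + h p) = u f + u h" for f h using u.add[of f h] by (simp add: plus_fun_def)
    have udiff: "u (\<lambda>p. f p - h p) = u f - u h" for f h using u.diff[of f h] by (simp add: fun_diff_def)
    have uscale: "u (\<lambda>p. a * f p) = a * u f" for a f by (rule u.scale)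
    have uneg: "u (\<lambda>p. - f p) = - u f" for f using uscale[of "-1" f] by simp
    have uscale': "u (\<lambda>p. f p * a) = u f * a" for a f using uscale[of a f] by (simp add: mult.commute)
    have usum: "u (\<lambda>p. \<Sum>s\<in>S. f s p) = (\<Sum>s\<in>S. u (f s))" for f :: "'g \<times> 'b \<times> 'a \<Rightarrow> 'p \<Rightarrow> complex" and S
      unfolding fun_sum_eq by (rule u.sum)
    have usum_a: "u (\<lambda>p. \<Sum>s\<in>S. f s p) = (\<Sum>s\<in>S. u (f s))" for f :: "'a \<Rightarrow> 'p \<Rightarrow> complex" and S
      unfolding fun_sum_eq by (rule u.sum)
    have usum_b: "u (\<lambda>p. \<Sum>s\<in>S. f s p) = (\<Sum>s\<in>S. u (f s))" for f :: "'b \<Rightarrow> 'p \<Rightarrow> complex" and S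
      unfolding fun_sum_eq by (rule u.sum)
    define W where "W h = (\<chi> i j. u (\<lambda>p. E p h $ i $ j))" for h
    define UV :: "complex^'a^'b" where "UV = (\<chi> i j. u (\<lambda>p. V p $ i $ j))"
    have uAl: "(\<chi> i j. u (\<lambda>p. (D ** F p) $ i $ j)) = D ** (\<chi> i j. u (\<lambda>p. F p $ i $ j))"
      for D :: "complex^'b^'b" and F :: "'p \<Rightarrow> complex^'a^'b"
      by (simp add: vec_eq_iff matrix_matrix_mult_def usum_b uscale)
    have uAr: "(\<chi> i j. u (\<lambda>p. (F p ** D) $ i $ j)) = (\<chi> i j. u (\<lambda>p. F p $ i $ j)) ** D"
      for D :: "complex^'a^'a" and F :: "'p \<Rightarrow> complex^'a^'b"
      by (simp add: vec_eq_iff matrix_matrix_mult_def usum_a uscale')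
    have uker: "u (\<lambda>p. F p $ i $ j) = 0" if "entries_in (ipow (Suc k)) F" for F :: "'p \<Rightarrow> complex^'a^'b" and i j
      using that u(2) fun_space.span_base unfolding entries_in_def by blast
    have W: "W (g \<otimes> h) = W g ** A' h + B' g ** W h" if gh: "g \<in> carrier G" "h \<in> carrier G" for g h
    proof -
      have "entries_in (ipow (Suc k)) (\<lambda>p. E p g ** (blk11 (R' p h) - A' h) + (blk22 (R' p g) - B' g) ** E p h)"
        using ent_mult[OF E[OF gh(1)] P1[OF gh(2)]] ent_mult[OF N1[OF gh(1)] E[OF gh(2)]]
        by (intro ent_add) (simp_all del: ideal_pow.simps)
      moreover have "E p g ** (blk11 (R' p h) - A' h) + (blk22 (R' p g) - B' g) ** E p h
          = E p (g \<otimes> h) - E p g ** A' h - B' g ** E p h" for p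
        unfolding E_def R'_mult[OF gh] blk_mult by (simp add: matrix_sub_ldistrib matrix_sub_rdistrib)
      ultimately have "entries_in (ipow (Suc k)) (\<lambda>p. E p (g \<otimes> h) - E p g ** A' h - B' g ** E p h)" by simp
      from uker[OF this] have "W (g \<otimes> h) - (\<chi> i j. u (\<lambda>p. (E p g ** A' h) $ i $ j))
          - (\<chi> i j. u (\<lambda>p. (B' g ** E p h) $ i $ j)) = 0"
        by (simp add: vec_eq_iff W_def udiff)
      then show ?thesis unfolding uAl uAr by (simp add: W_def algebra_simps)
    qed
    define zu where "zu h = W h ** A' (inv h)" for h
    have zu: "zu h $ i $ j = u (\<lambda>p. z p h $ i $ j)" for h i j
      using uAr[of "\<lambda>p. E p h" "A' (inv h)"] by (simp add: zu_def z_def W_def vec_eq_iff)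
    have "zu (g \<otimes> h) = zu g + hact g (zu h)" if gh: "g \<in> carrier G" "h \<in> carrier G" for g h
    proof -
      have "zu (g \<otimes> h) = W g ** (A' h ** A' (inv h)) ** A' (inv g) + B' g ** W h ** A' (inv h) ** A' (inv g)"
        using gh by (simp add: zu_def W inv_mult_group A'B'_mult matrix_add_rdistrib' matrix_mul_assoc)
      then show ?thesis using gh by (simp add: A'B'_inv zu_def hact_def matrix_mul_assoc)
    qed
    from H1[OF this] obtain X where X: "\<And>g. g \<in> carrier G \<Longrightarrow> zu g = hact g X - X" by blast
    have "UV = - X"
    proof -
      have uz: "u (\<lambda>p. zc p s) = del s X" if "s \<in> I" for s
        using that by (auto simp: I_def zc_def del_def X zu[symmetric])
      have "(\<Sum>s\<in>t i j. c i j s * u (\<lambda>p. zc p s)) = (\<Sum>s\<in>t i j. c i j s * del s X)" for i j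
        by (intro sum.cong refl arg_cong2[where f = "(*)"] uz subsetD[OF t])
      then show ?thesis
        by (simp add: vec_eq_iff UV_def V_def uneg usum uscale tc[of X])
    qed
    have "(\<chi> i j. u (\<lambda>p. ?T p $ i $ j)) = W g + B' g ** UV - UV ** A' g"
      using uAl[of "B' g" V] uAr[of V "A' g"]
      by (simp add: vec_eq_iff W_def UV_def uadd udiff)
    also have "\<dots> = W g - (B' g ** X - X ** A' g)"
      unfolding \<open>UV = - X\<close> by (simp add: vec_eq_iff matrix_matrix_mult_def sum_negf)
    also have "B' g ** X - X ** A' g = (hact g X - X) ** A' g"
      using g by (simp add: hact_def matrix_sub_rdistrib A'B'_inv flip: matrix_mul_assoc)
    also have "\<dots> = zu g ** A' g" using X[OF g] by simp
    also have "\<dots> = W g" using g by (simp add: zu_def A'B'_inv flip: matrix_mul_assoc)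
    finally have "(\<chi> i j. u (\<lambda>p. ?T p $ i $ j)) = 0" by simp
    then have "u ?f = 0" by (simp add: vec_eq_iff)
    then show False using u(3) by simp
  qed
  define D D' where "D p = C p ** shear (V p)" and "D' p = shear (- V p) ** C' p" for p
  have V0: "V p0 = 0" by (rule ent_one_pos[OF V k])
  have sh: "entries_in (ipow 0) (\<lambda>p. shear (F p))" if "entries_in (ipow k) F" for F
  proof -
    have F0: "entries_in (ipow 0) F" by (rule ent_mono[OF _ that]) simp
    have "(\<lambda>p. shear (F p) $ i $ j) \<in> ipow 0" for i j
      using F0 const_in_function_algebra
      by (cases i; cases j) (auto simp: shear_def entries_in_def)
    then show ?thesis by (simp add: entries_in_def)
  qed
  have "entries_in (ipow 0) D" "entries_in (ipow 0) D'"
    unfolding D_def D'_def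
    by (rule ent_mult_left[OF C(1) sh[OF V]], rule ent_mult_left[OF sh[OF ent_uminus[OF V]] C(2)])
  moreover have "D p ** D' p = mat 1" for p
  proof -
    have "D p ** D' p = C p ** (shear (V p) ** shear (- V p)) ** C' p"
      by (simp only: D_def D'_def matrix_mul_assoc)
    then show ?thesis by (simp add: shear_add shear_0 C(3))
  qed
  moreover have "D p0 = mat 1" "D' p0 = mat 1" by (simp_all add: D_def D'_def V0 shear_0 C(4,5))
  moreover have "entries_in (ipow (Suc k)) (\<lambda>p. blk21 (D' p ** R p g ** D p))" if g: "g \<in> carrier G" for g
  proof -
    have "D' p ** R p g ** D p = shear (- V p) ** R' p g ** shear (V p)" for p
      by (simp only: D_def D'_def R'_def matrix_mul_assoc)
    then have eq: "blk21 (D' p ** R p g ** D p) = (E p g + B' g ** V p - V p ** A' g)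
        + (blk22 (R' p g) - B' g) ** V p - V p ** (blk11 (R' p g) - A' g) - V p ** blk12 (R' p g) ** V p" for p
      by (simp add: blk21_shear_conj E_def matrix_sub_ldistrib matrix_sub_rdistrib)
    have 1: "entries_in (ipow (Suc k)) (\<lambda>p. (blk22 (R' p g) - B' g) ** V p)"
      using ent_mult[OF N1[OF g] V] by (simp del: ideal_pow.simps)
    have 2: "entries_in (ipow (Suc k)) (\<lambda>p. V p ** (blk11 (R' p g) - A' g))"
      using ent_mult[OF V P1[OF g]] by (simp del: ideal_pow.simps)
    \<comment> \<open>The induction starts at exponent 1 so that the quadratic term is absorbed: 2k
      \<ge> k + 1.\<close>
    have "entries_in (ipow (k + k)) (\<lambda>p. V p ** blk12 (R' p g) ** V p)"
      using ent_mult[OF ent_mult_right[OF V Q0[OF g]] V] .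
    then have 3: "entries_in (ipow (Suc k)) (\<lambda>p. V p ** blk12 (R' p g) ** V p)"
      by (rule ent_mono[rotated]) (use k in simp)
    show ?thesis unfolding eq by (intro ent_diff ent_add main[OF g] 1 2 3)
  qed
  ultimately show ?case unfolding k_def[symmetric] by blast
qed

text \<open>After the change of basis for m^k, every row of the Burnside determinant has its entry
  at a lower left position in m^k, so a whole column and hence the determinant lies there. The basis
  varies with k but \<open>f\<close> does not.\<close>

theorem no_irreducible_member:
  assumes H0: "\<And>X. (\<And>g. g \<in> carrier G \<Longrightarrow> hact g X = X) \<Longrightarrow> X = 0"
    and H1: "\<And>z. (\<And>g h. g \<in> carrier G \<Longrightarrow> h \<in> carrier G \<Longrightarrow> z (g \<otimes> h) = z g + hact g (z h)) \<Longrightarrow>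
       \<exists>X. \<forall>g\<in>carrier G. z g = hact g X - X"
  shows "\<not> irreducible_rep G (R p1)"
proof
  assume "irreducible_rep G (R p1)"
  then obtain h where h: "range h \<subseteq> carrier G" "det (\<chi> i. flat (R p1 (h i))) \<noteq> 0"
    using irreducible_rep_span(2)[where \<rho> = "R p1", OF is_group R_mult R_one] by blast
  define f where "f p = det (\<chi> i. flat (R p (h i)))" for p
  have "f \<in> ipow k" if k1: "1 \<le> k" for k
  proof -
    obtain k0 where k0: "k = Suc k0" using k1 by (cases k) auto
    define Q where "Q C C' \<longleftrightarrow> entries_in (ipow 0) C \<and> entries_in (ipow 0) C' \<and>
        (\<forall>p. C p ** C' p = mat 1) \<and> C p0 = mat 1 \<and> C' p0 = mat 1 \<and>
        (\<forall>g\<in>carrier G. entries_in (ipow k) (\<lambda>p. blk21 (C' p ** R p g ** C p)))" for C C'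
    have "\<exists>C C'. Q C C'"
      unfolding Q_def k0 by (rule triangular_mod_ipow) (fact H0, fact H1)
    then obtain C C' where "Q C C'" by blast
    then have C: "entries_in (ipow 0) C" "entries_in (ipow 0) C'" "\<And>p. C p ** C' p = mat 1"
      "\<And>g. g \<in> carrier G \<Longrightarrow> entries_in (ipow k) (\<lambda>p. blk21 (C' p ** R p g ** C p))"
      unfolding Q_def by blast+
    define R' where "R' p i = C' p ** R p (h i) ** C p" for p i
    define F where "F p = (\<chi> i. flat (R' p i))" for p
    \<comment> \<open>The matrix of the linear map M \<mapsto> C M C' on flattened matrices, acting
      on rows from the right.\<close>
    define K :: "'p \<Rightarrow> complex^(('a+'b)\<times>('a+'b))^(('a+'b)\<times>('a+'b))"
      where "K p = (\<chi> s r. C p $ fst r $ fst s * C' p $ snd s $ snd r)" for p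
    have RC: "R p (h i) = C p ** R' p i ** C' p" for p i
    proof -
      have "C p ** R' p i ** C' p = (C p ** C' p) ** R p (h i) ** (C p ** C' p)"
        by (simp only: R'_def matrix_mul_assoc)
      then show ?thesis by (simp add: C(3))
    qed
    have "(\<chi> i. flat (R p (h i))) = F p ** K p" for p
    proof -
      have "flat (C p ** M ** C' p) $ r = (\<Sum>s\<in>UNIV. flat M $ s * K p $ s $ r)" for M r
      proof -
        have "flat (C p ** M ** C' p) $ r = (\<Sum>l\<in>UNIV. \<Sum>k\<in>UNIV. C p $ fst r $ k * M $ k $ l * C' p $ l $ snd r)"
          by (simp add: flat_def matrix_matrix_mult_def sum_distrib_right)
        also have "\<dots> = (\<Sum>k\<in>UNIV. \<Sum>l\<in>UNIV. M $ k $ l * (C p $ fst r $ k * C' p $ l $ snd r))"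
          by (subst sum.swap) (simp add: ac_simps)
        also have "\<dots> = (\<Sum>s\<in>UNIV \<times> UNIV. flat M $ s * K p $ s $ r)"
          by (simp add: sum.cartesian_product flat_def K_def case_prod_beta)
        finally show ?thesis by simp
      qed
      then show ?thesis
        by (simp add: vec_eq_iff RC[of p] F_def matrix_matrix_mult_def)
    qed
    then have fF: "f = (\<lambda>p. det (F p)) * (\<lambda>p. det (K p))"
      by (simp add: f_def fun_eq_iff det_mul)
    have R'0: "entries_in (ipow 0) (\<lambda>p. R' p i)" for i
      unfolding R'_def using C(1,2) ent[of "h i"] h(1) by (intro ent_mult_left) auto
    have F0: "entries_in (ipow 0) F"
      using R'0 by (simp add: entries_in_def F_def flat_def)
    have col: "(\<lambda>p. F p $ i $ (Inr a, Inl b)) \<in> ipow k" for i a b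
    proof -
      have "h i \<in> carrier G" using h(1) by blast
      from C(4)[OF this] show ?thesis by (simp add: entries_in_def F_def flat_def R'_def blk21_def)
    qed
    have "(\<lambda>p. det (F p)) \<in> ipow k" by (rule det_in_ipow[OF F0 col])
    moreover have "entries_in (ipow 0) K"
      unfolding entries_in_def
    proof (intro allI)
      fix s r
      have "(\<lambda>p. C p $ fst r $ fst s) * (\<lambda>p. C' p $ snd s $ snd r) \<in> ipow (0 + 0)"
        using C(1,2) by (intro ipow_mult) (auto simp: entries_in_def)
      then show "(\<lambda>p. K p $ s $ r) \<in> ipow 0" by (simp add: K_def times_fun_def)
    qed
    then have "(\<lambda>p. det (K p)) \<in> ipow 0"
      by (intro det_in_ipow) (auto simp: entries_in_def)
    ultimately show ?thesis unfolding fF using ipow_mult[of "\<lambda>p. det (F p)" k "\<lambda>p. det (K p)" 0] by simp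
  qed
  then have "f = 0" by (rule in_all_ipow_eq_0)
  then have "f p1 = 0" by simp
  then show False using h(2) by (simp add: f_def)
qed

end

section \<open>Families through a scalar representation\<close>

context rep_family
begin

text \<open>If elements of \<open>ker \<phi>\<close> are trivial modulo \<open>\<mm>\<^sup>k\<close>, they commute with everything modulo \<open>\<mm>\<^sup>k\<^sup>+\<^sup>1\<close>, because \<open>R p0\<close>
  is scalar; then all commutators, hence all elements of \<open>ker \<phi>\<close>, are trivial modulo \<open>\<mm>\<^sup>k\<^sup>+\<^sup>1\<close>.\<close>

theorem no_irreducible_member_near_scalar:
  assumes \<phi>: "\<phi> \<in> hom G integer_group" and \<mu>: "\<mu> \<in> carrier G" "\<phi> \<mu> = 1"
    and ker: "kernel G integer_group \<phi> = derived G (carrier G)"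
    and scalar: "\<And>g. g \<in> carrier G \<Longrightarrow> R p0 g = matrix_smult (c (\<phi> g)) (mat 1)" and c0: "c 0 = 1"
    and n: "CARD('n) \<noteq> 1"
  shows "\<not> irreducible_rep G (R p1)"
proof
  assume irr: "irreducible_rep G (R p1)"
  define comm where "comm g h = (\<lambda>p. R p g ** R p h - R p h ** R p g)" for g h
  have step: "entries_in (ipow (Suc k)) (comm g h)"
    if K: "\<And>g. g \<in> carrier G \<Longrightarrow> \<phi> g = 0 \<Longrightarrow> entries_in (ipow k) (\<lambda>p. R p g - mat 1)"
      and gh: "g \<in> carrier G" "h \<in> carrier G" for k g h
  proof -
    let ?Z = "\<lambda>h. {g \<in> carrier G. entries_in (ipow (Suc k)) (comm g h)}"
    have anti: "entries_in (ipow (Suc k)) (comm h g)" if "entries_in (ipow (Suc k)) (comm g h)" for g h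
      using ent_uminus[OF that] by (simp add: comm_def)
    have sub: "subgroup (?Z h) G" if h: "h \<in> carrier G" for h
    proof (rule subgroupI)
      have "comm \<one> h = (\<lambda>_. 0)" by (simp add: comm_def R_facts fun_eq_iff)
      then show "?Z h \<noteq> {}" using ent_zero[of "Suc k"] by auto
    next
      fix g assume g: "g \<in> ?Z h"
      then have gG: "g \<in> carrier G" by simp
      have "R p (inv g) ** comm g h p ** R p (inv g) = - comm (inv g) h p" for p
      proof -
        have "R p (inv g) ** comm g h p ** R p (inv g) = (R p (inv g) ** R p g) ** R p h ** R p (inv g)
            - R p (inv g) ** R p h ** (R p g ** R p (inv g))"
          by (simp add: comm_def matrix_sub_ldistrib matrix_sub_rdistrib matrix_mul_assoc)
        then show ?thesis using gG by (simp add: R_facts comm_def)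
      qed
      then have "comm (inv g) h = (\<lambda>p. - (R p (inv g) ** comm g h p ** R p (inv g)))" by (simp add: fun_eq_iff)
      moreover have "entries_in (ipow (Suc k)) (\<lambda>p. - (R p (inv g) ** comm g h p ** R p (inv g)))"
        using g ent[of "inv g"] gG by (intro ent_uminus ent_mult_right[OF ent_mult_left]) auto
      ultimately show "inv g \<in> ?Z h" using gG by simp
    next
      fix g1 g2 assume g: "g1 \<in> ?Z h" "g2 \<in> ?Z h"
      have "comm (g1 \<otimes> g2) h = (\<lambda>p. R p g1 ** comm g2 h p + comm g1 h p ** R p g2)"
        using g by (simp add: comm_def R_facts fun_eq_iff matrix_sub_ldistrib matrix_sub_rdistrib matrix_mul_assoc)
      moreover have "entries_in (ipow (Suc k)) (\<lambda>p. R p g1 ** comm g2 h p + comm g1 h p ** R p g2)"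
        using g ent by (intro ent_add ent_mult_left ent_mult_right) auto
      ultimately show "g1 \<otimes> g2 \<in> ?Z h" using g by simp
    qed auto
    have kerZ: "entries_in (ipow (Suc k)) (comm h g)" if g: "g \<in> carrier G" and h: "h \<in> carrier G" "\<phi> h = 0" for g h
    proof -
      have R1: "entries_in (ipow 1) (\<lambda>p. R p g - R p0 g)" by (rule ent_minus_value[OF ent[OF g]])
      have e: "entries_in (ipow k) (\<lambda>p. R p h - mat 1)" by (rule K[OF h])
      \<comment> \<open>Scalars drop out of commutators, so both factors can be replaced by their
        differences from scalars: one in m^k, the other in m.\<close>
      have "comm h g = (\<lambda>p. (R p h - mat 1) ** (R p g - R p0 g) - (R p g - R p0 g) ** (R p h - mat 1))"
        by (simp add: fun_eq_iff comm_def scalar[OF g] matrix_sub_ldistrib matrix_sub_rdistrib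
            matrix_smult_mult_left matrix_smult_mult_right mat_space.scale_right_diff_distrib)
      then show ?thesis using ent_diff ent_mult[OF e R1] ent_mult[OF R1 e] by (simp del: ideal_pow.simps)
    qed
    \<comment> \<open>Two passes: the elements commuting with \<mu> modulo m^(k+1) include the
      kernel and \<mu>, hence are everything; thus \<mu> commutes with an arbitrary h, and the same
      argument applies to h.\<close>
    have "?Z \<mu> = carrier G"
    proof (rule subgroup_eq_carrier_from_kernel[OF \<phi> sub[OF \<mu>(1)]])
      have "comm \<mu> \<mu> = (\<lambda>_. 0)" by (simp add: comm_def fun_eq_iff)
      then show "\<mu> \<in> ?Z \<mu>" using \<mu> ent_zero[of "Suc k"] by (simp del: ideal_pow.simps)
    qed (use kerZ \<mu> in auto)
    then have "\<mu> \<in> ?Z g" using gh(1) anti \<mu>(1) by blast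
    have "?Z h = carrier G"
    proof (rule subgroup_eq_carrier_from_kernel[OF \<phi> sub[OF gh(2)]])
      show "\<mu> \<in> ?Z h" using \<open>?Z \<mu> = carrier G\<close> gh(2) anti \<mu>(1) by blast
    qed (use kerZ gh \<mu> in auto)
    then show ?thesis using gh(1) by blast
  qed
  have kerK: "entries_in (ipow (Suc k)) (\<lambda>p. R p g - mat 1)" if "g \<in> carrier G" "\<phi> g = 0" for g k
    using that
  proof (induction k arbitrary: g)
    case 0
    have "entries_in (ipow 1) (\<lambda>p. R p g - R p0 g)" by (rule ent_minus_value[OF ent[OF 0(1)]])
    then show ?case using scalar[OF 0(1)] c0 0(2) by simp
  next
    case (Suc k)
    let ?H = "{g \<in> carrier G. entries_in (ipow (Suc (Suc k))) (\<lambda>p. R p g - mat 1)}"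
    have "subgroup ?H G"
    proof (rule subgroupI)
      show "?H \<noteq> {}" using ent_zero[of "Suc (Suc k)"] by (auto intro!: exI[of _ \<one>] simp: R_facts simp del: ideal_pow.simps)
    next
      fix g assume g: "g \<in> ?H"
      then have gG: "g \<in> carrier G" by simp
      have "(\<lambda>p. R p (inv g) - mat 1) = (\<lambda>p. - (R p (inv g) ** (R p g - mat 1)))"
        using gG by (simp add: fun_eq_iff matrix_sub_ldistrib R_facts)
      moreover have "entries_in (ipow (Suc (Suc k))) (\<lambda>p. - (R p (inv g) ** (R p g - mat 1)))"
        using g gG ent[of "inv g"] by (intro ent_uminus ent_mult_left) auto
      ultimately show "inv g \<in> ?H" using gG by simp
    next
      fix g1 g2 assume g: "g1 \<in> ?H" "g2 \<in> ?H"
      then have gG: "g1 \<in> carrier G" "g2 \<in> carrier G" by auto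
      have "(\<lambda>p. R p (g1 \<otimes> g2) - mat 1) = (\<lambda>p. R p g1 ** (R p g2 - mat 1) + (R p g1 - mat 1))"
        using gG by (simp add: fun_eq_iff matrix_sub_ldistrib R_facts)
      moreover have "entries_in (ipow (Suc (Suc k))) (\<lambda>p. R p g1 ** (R p g2 - mat 1) + (R p g1 - mat 1))"
        using g gG ent[of g1] by (intro ent_add ent_mult_left) auto
      ultimately show "g1 \<otimes> g2 \<in> ?H" using gG by simp
    qed auto
    moreover have "derived_set G (carrier G) \<subseteq> ?H"
    proof
      fix w assume "w \<in> derived_set G (carrier G)"
      then obtain g h where gh: "g \<in> carrier G" "h \<in> carrier G" and w: "w = g \<otimes> h \<otimes> inv g \<otimes> inv h" by auto
      have "entries_in (ipow (Suc (Suc k))) (comm g h)"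
        by (rule step[OF Suc.IH gh])
      moreover have "entries_in (ipow 0) (\<lambda>p. R p (inv g) ** R p (inv h))"
        using ent gh by (intro ent_mult_left) auto
      ultimately have "entries_in (ipow (Suc (Suc k))) (\<lambda>p. comm g h p ** (R p (inv g) ** R p (inv h)))"
        by (rule ent_mult_right)
      moreover have "comm g h p ** (R p (inv g) ** R p (inv h)) = R p w - mat 1" for p
      proof -
        have "R p h ** R p g ** (R p (inv g) ** R p (inv h)) = R p h ** (R p g ** R p (inv g)) ** R p (inv h)"
          by (simp only: matrix_mul_assoc)
        then have "R p h ** R p g ** (R p (inv g) ** R p (inv h)) = mat 1" using gh by (simp add: R_facts)
        moreover have "R p w = R p g ** R p h ** (R p (inv g) ** R p (inv h))"
          using gh by (simp add: w R_facts matrix_mul_assoc)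
        ultimately show ?thesis by (simp add: comm_def matrix_sub_rdistrib)
      qed
      ultimately have "entries_in (ipow (Suc (Suc k))) (\<lambda>p. R p w - mat 1)" by (simp only:)
      then show "w \<in> ?H" using gh w by simp
    qed
    ultimately have "derived G (carrier G) \<subseteq> ?H"
      unfolding derived_def by (rule generate_subgroup_incl[rotated])
    moreover have "g \<in> derived G (carrier G)"
      using Suc.prems unfolding ker[symmetric] kernel_def by (simp add: integer_group_def)
    ultimately show ?case by blast
  qed
  \<comment> \<open>By Krull all commutators vanish, not only at \<open>p0\<close>. The span of R p1
    would then be commutative, yet by Burnside it contains all matrices.\<close>
  have comm0: "R p1 g ** R p1 h = R p1 h ** R p1 g" if gh: "g \<in> carrier G" "h \<in> carrier G" for g h
  proof -
    have "(\<lambda>p. comm g h p $ i $ j) = 0" for i j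
    proof (rule in_all_ipow_eq_0)
      fix k :: nat assume "1 \<le> k"
      then obtain k0 where "k = Suc k0" by (cases k) auto
      then have "entries_in (ipow (Suc k)) (comm g h)" using step[OF kerK gh] by simp
      then have "entries_in (ipow k) (comm g h)" by (rule ent_mono[rotated]) simp
      then show "(\<lambda>p. comm g h p $ i $ j) \<in> ipow k" by (simp add: entries_in_def)
    qed
    then have "comm g h p1 $ i $ j = 0" for i j by (metis zero_fun_apply)
    then have "comm g h p1 = 0" by (simp add: vec_eq_iff)
    then show ?thesis by (simp add: comm_def)
  qed
  note sp = irreducible_rep_span(1)[where \<rho> = "R p1", OF is_group R_mult R_one irr]
  have c1: "A ** R p1 g = R p1 g ** A" if "g \<in> carrier G" for A g
    by (rule commutes_with_span[of _ "R p1 ` carrier G"]) (use sp comm0 that in auto)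
  have c2: "A ** B = B ** A" for A B :: "complex^'n^'n"
    by (rule commutes_with_span[of _ "R p1 ` carrier G"]) (use sp c1[of _ B] in \<open>auto simp: c1\<close>)
  obtain i j :: 'n where ij: "i \<noteq> j"
  proof -
    have "\<not> (\<forall>i j :: 'n. i = j)"
    proof
      assume "\<forall>i j :: 'n. i = j"
      then have "(UNIV :: 'n set) = {undefined}" by auto
      then have "CARD('n) = card {undefined :: 'n}" by simp
      then show False using n by simp
    qed
    then show ?thesis using that by blast
  qed
  obtain d where "matrix_unit i j = matrix_smult d (mat 1 :: complex^'n^'n)"
    using scalar_if_commutes_with_all[of "matrix_unit i j"] c2 by blast
  then have "(matrix_unit i j :: complex^'n^'n) $ i $ j = matrix_smult d (mat 1) $ i $ j" by simp
  then show False using ij by (simp add: matrix_unit_def mat_def)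
qed

end


section \<open>Finite generation of the knot group\<close>

definition path_from_to :: "'a::topological_space set \<Rightarrow> (real \<Rightarrow> 'a) \<Rightarrow> 'a \<Rightarrow> 'a \<Rightarrow> bool" where
  "path_from_to X p a b \<longleftrightarrow> path p \<and> path_image p \<subseteq> X \<and> pathstart p = a \<and> pathfinish p = b"

lemma path_from_to_join: "path_from_to X p a b \<Longrightarrow> path_from_to X q b c \<Longrightarrow> path_from_to X (p +++ q) a c"
  by (simp add: path_from_to_def path_image_join)

lemma path_from_to_reverse: "path_from_to X p a b \<Longrightarrow> path_from_to X (reversepath p) b a"
  by (simp add: path_from_to_def)

lemma homotopic_paths_join':
  "homotopic_paths X p p' \<Longrightarrow> homotopic_paths X q q' \<Longrightarrow> path_from_to X p a b \<Longrightarrow> path_from_to X q b c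
    \<Longrightarrow> homotopic_paths X (p +++ q) (p' +++ q')"
  by (simp add: homotopic_paths_join path_from_to_def)

lemma homotopic_paths_assoc':
  fixes X :: "'a::real_normed_vector set"
  shows "path_from_to X p a b \<Longrightarrow> path_from_to X q b c \<Longrightarrow> path_from_to X r c d
    \<Longrightarrow> homotopic_paths X ((p +++ q) +++ r) (p +++ (q +++ r))"
  by (rule homotopic_paths_sym, rule homotopic_paths_assoc) (simp_all add: path_from_to_def)

lemma homotopic_paths_refl': "path_from_to X p a b \<Longrightarrow> homotopic_paths X p p"
  by (simp add: path_from_to_def)

text \<open>Telescoping of consecutive generators: the detour to the base point and back along c
  cancels.\<close>

lemma homotopic_paths_cancel_middle:
  fixes X :: "'a::real_normed_vector set"
  assumes s: "path_from_to X s a b" and c: "path_from_to X c x b" and z: "path_from_to X z b d"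
  shows "homotopic_paths X ((s +++ reversepath c) +++ (c +++ z)) (s +++ z)"
proof -
  note R = path_from_to_reverse[OF c]
  have const: "path_from_to X (linepath b b) b b"
    using s by (auto simp: path_from_to_def pathfinish_in_path_image subset_iff)
  have 1: "homotopic_paths X ((s +++ reversepath c) +++ (c +++ z)) (s +++ (reversepath c +++ (c +++ z)))"
    by (rule homotopic_paths_assoc'[OF s R path_from_to_join[OF c z]])
  have 2: "homotopic_paths X (reversepath c +++ (c +++ z)) ((reversepath c +++ c) +++ z)"
    by (rule homotopic_paths_sym, rule homotopic_paths_assoc'[OF R c z])
  have 3: "homotopic_paths X (reversepath c +++ c) (linepath b b)"
    using homotopic_paths_linv[of c X] c by (simp add: path_from_to_def)
  have 4: "homotopic_paths X ((reversepath c +++ c) +++ z) (linepath b b +++ z)"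
    by (rule homotopic_paths_join'[OF 3 homotopic_paths_refl'[OF z] path_from_to_join[OF R c] z])
  have 5: "homotopic_paths X (linepath b b +++ z) z"
    using homotopic_paths_lid[of z X] z by (simp add: path_from_to_def)
  have 6: "homotopic_paths X (reversepath c +++ (c +++ z)) z"
    using 2 4 5 homotopic_paths_trans by blast
  have 7: "homotopic_paths X (s +++ (reversepath c +++ (c +++ z))) (s +++ z)"
    by (rule homotopic_paths_join'[OF homotopic_paths_refl'[OF s] 6 s
          path_from_to_join[OF R path_from_to_join[OF c z]]])
  from 1 7 show ?thesis by (rule homotopic_paths_trans)
qed

text \<open>A loop is homotopic in \<open>X\<close> to the retraction of a polygon with vertices in a finite net; the
  generators are the edges of such polygons, joined to the base point.\<close>

theorem fundamental_group_finitely_generated: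
  fixes X :: "'a::euclidean_space set"
  assumes X: "compact X" and x0: "x0 \<in> X" and U: "open U" "X \<subseteq> U"
    and r: "continuous_on U r" "r ` U \<subseteq> X" "\<And>x. x \<in> X \<Longrightarrow> r x = x"
  shows "\<exists>S. finite S \<and> S \<subseteq> carrier (fundamental_group X x0) \<and>
    carrier (fundamental_group X x0) = generate (fundamental_group X x0) S"
proof -
  let ?G = "fundamental_group X x0"
  interpret G: group ?G by (rule group_fundamental_group[OF x0])
  obtain e where e: "e > 0" "(\<Union>x\<in>X. ball x e) \<subseteq> U"
    using compact_subset_open_imp_ball_epsilon_subset[OF X U] by blast
  \<comment> \<open>Consecutive net points are joined through two points of the loop, in three steps
    shorter than \<open>d\<close>, so they are closer than \<open>e\<close>.\<close>
  define d where "d = e / 3"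
  have d: "d > 0" using e by (simp add: d_def)
  obtain N0 where N0: "finite N0" "N0 \<subseteq> X" "X \<subseteq> (\<Union>x\<in>N0. ball x d)"
    using compactE_image[OF X, of X "\<lambda>x. ball x d"] d by (metis UN_I centre_in_ball open_ball subsetI)
  define s where "s a b = r \<circ> linepath a b" for a b
  \<comment> \<open>Constant at \<open>x0\<close>, so that the polygon needs no correction at its
    two ends.\<close>
  define c where "c y = (if y = x0 then linepath x0 x0 else SOME p. path_from_to X p x0 y)" for y
  define gp where "gp y y' = c y +++ (s y y' +++ reversepath (c y'))" for y y'
  \<comment> \<open>\<open>X\<close> is not assumed path connected; only the reachable net points
    can be joined to the base point.\<close>
  define N where "N = insert x0 {y \<in> N0. \<exists>p. path_from_to X p x0 y}"
  define S where "S = path_class X ` (\<lambda>(y, y'). gp y y') ` {(y, y') \<in> N \<times> N. dist y y' < e}"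
  have fin: "finite S"
  proof -
    have "finite N" using N0 by (simp add: N_def)
    then have "finite (N \<times> N)" by simp
    then have "finite {(y, y') \<in> N \<times> N. dist y y' < e}"
      by (rule rev_finite_subset) auto
    then show ?thesis unfolding S_def by (intro finite_imageI)
  qed
  have NX: "N \<subseteq> X" using N0 x0 by (auto simp: N_def)
  have const: "path_from_to X (linepath x0 x0) x0 x0" using x0 by (simp add: path_from_to_def)
  have c: "path_from_to X (c y) x0 y" if "\<exists>p. path_from_to X p x0 y" for y
    using someI_ex[OF that] const by (simp add: c_def)
  have cN: "path_from_to X (c y) x0 y" if "y \<in> N" for y
    using that const by (intro c) (auto simp: N_def)
  have loop: "p \<in> loops_at X x0 \<longleftrightarrow> path_from_to X p x0 x0" for p
    by (simp add: loops_at_def path_from_to_def)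
  have rball: "path_from_to X (r \<circ> p) a b"
    if "y \<in> X" "path_from_to (ball y e) p a b" "a \<in> X" "b \<in> X" for y p a b
  proof -
    have "path_image p \<subseteq> U" using that e by (auto simp: path_from_to_def)
    then show ?thesis
      using that r unfolding path_from_to_def
      by (auto simp: path_image_compose pathstart_compose pathfinish_compose
          intro!: path_continuous_image continuous_on_subset[OF r(1)])
  qed
  have sball: "path_from_to (ball y e) (linepath a b) a b" if "a \<in> ball y e" "b \<in> ball y e" for a b y
    using that closed_segment_subset[OF that convex_ball] by (simp add: path_from_to_def)
  have s: "path_from_to X (s a b) a b" if "y \<in> X" "a \<in> X" "b \<in> X" "dist y a < e" "dist y b < e" for a b y
    unfolding s_def using that by (intro rball[of y] sball) auto
  have gp: "path_from_to X (gp y y') x0 x0" if "y \<in> N" "y' \<in> N" "dist y y' < e" for y y'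
    unfolding gp_def using that NX e
    by (intro path_from_to_join[OF cN] path_from_to_join[OF s[of y]] path_from_to_reverse cN) auto
  have SG: "S \<subseteq> carrier ?G"
    using gp by (auto simp: S_def fundamental_group_def loop)
  have hom: "homotopic_paths X (r \<circ> p) (r \<circ> q)"
    if "y \<in> X" "path_from_to (ball y e) p a b" "path_from_to (ball y e) q a b" for y p q a b
  proof -
    have "homotopic_paths (ball y e) p q"
      using convex_imp_simply_connected[OF convex_ball, of y e] that(2,3)
      by (auto simp: simply_connected_eq_homotopic_paths path_from_to_def)
    then show ?thesis
      by (rule homotopic_paths_continuous_image)
        (use that(1) e r in \<open>auto intro: continuous_on_subset[OF r(1)]\<close>)
  qed
  have "A \<in> generate ?G S" if AG: "A \<in> carrier ?G" for A
  proof -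
    obtain p where p: "path_from_to X p x0 x0" and A: "A = path_class X p"
      using AG by (auto simp: fundamental_group_def loop)
    have pp: "path p" "path_image p \<subseteq> X" "p 0 = x0" "p 1 = x0"
      using p by (auto simp: path_from_to_def pathstart_def pathfinish_def)
    have "uniformly_continuous_on {0..1} p"
      using pp(1) by (simp add: path_def compact_uniformly_continuous)
    then obtain \<eta> where \<eta>: "\<eta> > 0" "\<And>t t'. t \<in> {0..1} \<Longrightarrow> t' \<in> {0..1} \<Longrightarrow> dist t' t < \<eta> \<Longrightarrow> dist (p t') (p t) < d"
      using d unfolding uniformly_continuous_on_def by metis
    obtain n where n: "n > 0" "1 / real n < \<eta>" using \<eta>(1) by (metis nat_approx_posE of_nat_Suc zero_less_Suc)
    define t where "t i = real i / real n" for i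
    have t: "t i \<in> {0..1}" if "i \<le> n" for i using that n by (auto simp: t_def)
    have pX: "p u \<in> X" if "u \<in> {0..1}" for u using pp(2) that by (auto simp: path_image_def)
    have pathto: "path_from_to X (subpath 0 u p) x0 (p u)" if "u \<in> {0..1}" for u
      using that pp path_image_subpath_subset[of 0 u p]
      by (auto simp: path_from_to_def)
    have "\<exists>y\<in>N. dist y (p u) < d \<and> (u \<in> {0, 1} \<longrightarrow> y = x0)" if u: "u \<in> {0..1}" for u
    proof (cases "u \<in> {0, 1}")
      case True
      then show ?thesis using pp d by (intro bexI[of _ x0]) (auto simp: N_def)
    next
      case False
      obtain y where y: "y \<in> N0" "dist y (p u) < d" using N0(3) pX[OF u] by auto
      have "path_from_to X (s (p u) y) (p u) y"
        using y N0 pX[OF u] d by (intro s[of y]) (auto simp: d_def)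
      then have "y \<in> N" using y path_from_to_join[OF pathto[OF u]] by (auto simp: N_def)
      then show ?thesis using y False by auto
    qed
    then obtain Y where Y: "\<And>u. u \<in> {0..1} \<Longrightarrow> Y u \<in> N" "\<And>u. u \<in> {0..1} \<Longrightarrow> dist (Y u) (p u) < d"
      "Y 0 = x0" "Y 1 = x0"
      by (metis atLeastAtMost_iff insertI1 insertI2 order_refl zero_le_one)
    define y where "y i = Y (t i)" for i
    have y: "y i \<in> N" "y i \<in> X" "dist (y i) (p (t i)) < d" if "i \<le> n" for i
      using Y(1,2)[OF t[OF that]] NX by (auto simp: y_def)
    \<comment> \<open>The initial piece of p, closed up through the net point y i. Passing to i + 1
      multiplies by one generator; a 0 is trivial and a n is homotopic to p.\<close>
    define a where "a i = subpath 0 (t i) p +++ (s (p (t i)) (y i) +++ reversepath (c (y i)))" for i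
    have si: "path_from_to X (s (p (t i)) (y i)) (p (t i)) (y i)" if "i \<le> n" for i
      using y[OF that] pX[OF t[OF that]] d by (intro s[of "y i"]) (auto simp: d_def)
    have rc: "path_from_to X (reversepath (c (y i))) (y i) x0" if "i \<le> n" for i
      using y(1)[OF that] by (intro path_from_to_reverse cN)
    have ai: "path_from_to X (a i) x0 x0" if "i \<le> n" for i
      unfolding a_def using that
      by (intro path_from_to_join[OF pathto[OF t]] path_from_to_join[OF si] rc)
    have "path_class X (a i) \<in> generate ?G S" if "i \<le> n" for i
      using that
    proof (induction i)
      case 0
      have eq: "y 0 = x0" "p (t 0) = x0" using Y(3) pp by (auto simp: y_def t_def)
      have cc: "c x0 = linepath x0 x0" by (simp add: c_def)
      have ss: "s x0 x0 = linepath x0 x0" using r(3)[OF x0] by (auto simp: s_def linepath_def fun_eq_iff algebra_simps)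
      have sp: "subpath 0 (t 0) p = linepath x0 x0"
        using pp by (auto simp: t_def subpath_def linepath_def fun_eq_iff algebra_simps)
      have "homotopic_paths X (linepath x0 x0 +++ (linepath x0 x0 +++ linepath x0 x0)) (linepath x0 x0)"
        using homotopic_paths_lid[of "linepath x0 x0 +++ linepath x0 x0" X]
          homotopic_paths_lid[of "linepath x0 x0" X] x0
        by (auto simp: path_image_join intro: homotopic_paths_trans)
      then have "path_class X (a 0) = \<one>\<^bsub>?G\<^esub>"
        unfolding a_def eq sp cc ss by (simp add: fundamental_group_def path_class_eqI reversepath_linepath)
      then show ?case by (simp add: generate.one)
    next
      case (Suc i)
      then have i: "i \<le> n" by simp
      note i' = Suc.prems
      define u where "u = t i" define v where "v = t (Suc i)"
      have uv: "u \<in> {0..1}" "v \<in> {0..1}" "u \<le> v" "v - u = 1 / real n"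
        using t[OF i] t[OF i'] n by (auto simp: u_def v_def t_def divide_right_mono field_simps)
      have close: "dist (p w) (p u) < d" if "w \<in> {u..v}" for w
        using that uv n by (intro \<eta>(2)) (auto simp: dist_real_def)
      have dy: "dist (y i) (y (Suc i)) < e"
      proof -
        have "dist (p u) (p v) < d" using close[of v] uv by (simp add: dist_commute)
        moreover have "dist (p v) (y (Suc i)) < d" "dist (y i) (p u) < d"
          using y(3)[OF i] y(3)[OF i'] by (simp_all add: u_def v_def dist_commute)
        ultimately show ?thesis
          using dist_triangle[of "y i" "y (Suc i)" "p u"] dist_triangle[of "p u" "y (Suc i)" "p v"]
          by (simp add: d_def)
      qed
      let ?b = "ball (y i) e"
      have inb: "p w \<in> ?b" if "w \<in> {u..v}" for w
        using close[OF that] y(3)[OF i] d dist_triangle[of "y i" "p w" "p u"]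
        by (simp add: u_def[symmetric] dist_commute d_def)
      have sub: "path_from_to (X \<inter> ?b) (subpath u v p) (p u) (p v)"
      proof -
        have "path_image (subpath u v p) = p ` {u..v}" using uv by (simp add: path_image_subpath)
        moreover have "p ` {u..v} \<subseteq> X \<inter> ?b" using inb pX uv by auto
        ultimately show ?thesis using uv pp by (simp add: path_from_to_def)
      qed
      have yb: "y i \<in> ?b" "y (Suc i) \<in> ?b" "p u \<in> ?b" "p v \<in> ?b"
        using e dy inb uv by auto
      have subb: "path_from_to ?b (subpath u v p) (p u) (p v)" and subX: "path_from_to X (subpath u v p) (p u) (p v)"
        using sub by (auto simp: path_from_to_def)
      let ?ru = "s (p u) (y i)" and ?ei = "s (y i) (y (Suc i))" and ?rv = "s (p v) (y (Suc i))"
      let ?z = "reversepath (c (y (Suc i)))"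
      have ru: "path_from_to X ?ru (p u) (y i)" and rv: "path_from_to X ?rv (p v) (y (Suc i))"
        using si[OF i] si[OF i'] by (simp_all add: u_def v_def)
      have ei: "path_from_to X ?ei (y i) (y (Suc i))"
        by (rule s[of "y i"]) (use y(2)[OF i] y(2)[OF i'] dy e in simp_all)
      note z = rc[OF i']
      \<comment> \<open>The two ways around the quadrilateral p u, y i, y (i+1), p v lie in one
        ball, where they are homotopic by convexity; the retraction carries the homotopy into
        \<open>X\<close>.\<close>
      have h1: "homotopic_paths X (?ru +++ ?ei) ((r \<circ> subpath u v p) +++ ?rv)"
        unfolding s_def path_compose_join[symmetric]
        by (rule hom[OF y(2)[OF i]]) (rule path_from_to_join sball subb yb)+
      have rsub: "path_from_to X (r \<circ> subpath u v p) (p u) (p v)"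
        using rball[OF y(2)[OF i] subb] pX uv by simp
      have "homotopic_paths X (r \<circ> subpath u v p) (subpath u v p)"
      proof (rule homotopic_paths_sym, rule homotopic_paths_eq)
        fix w :: real assume "w \<in> {0..1}"
        then have "subpath u v p w \<in> X" using subX by (auto simp: path_from_to_def path_image_def)
        then show "subpath u v p w = (r \<circ> subpath u v p) w" using r(3) by simp
      qed (use subX in \<open>auto simp: path_from_to_def\<close>)
      then have "homotopic_paths X ((r \<circ> subpath u v p) +++ ?rv) (subpath u v p +++ ?rv)"
        by (rule homotopic_paths_join'[OF _ homotopic_paths_refl'[OF rv] rsub rv])
      with h1 have sq: "homotopic_paths X (?ru +++ ?ei) (subpath u v p +++ ?rv)"
        by (rule homotopic_paths_trans)
      let ?P = "subpath 0 u p" and ?P' = "subpath 0 v p"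
      note P = pathto[OF uv(1)] and P' = pathto[OF uv(2)]
      note cy = cN[OF y(1)[OF i]]
      have ez: "path_from_to X (?ei +++ ?z) (y i) x0" by (rule path_from_to_join[OF ei z])
      have 1: "homotopic_paths X ((?P +++ (?ru +++ reversepath (c (y i)))) +++ (c (y i) +++ (?ei +++ ?z)))
          (?P +++ ((?ru +++ reversepath (c (y i))) +++ (c (y i) +++ (?ei +++ ?z))))"
        by (rule homotopic_paths_assoc'[OF P path_from_to_join[OF ru rc[OF i]] path_from_to_join[OF cy ez]])
      have 2: "homotopic_paths X ((?ru +++ reversepath (c (y i))) +++ (c (y i) +++ (?ei +++ ?z))) (?ru +++ (?ei +++ ?z))"
        by (rule homotopic_paths_cancel_middle[OF ru cy ez])
      have 3: "homotopic_paths X (?ru +++ (?ei +++ ?z)) ((?ru +++ ?ei) +++ ?z)"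
        by (rule homotopic_paths_sym, rule homotopic_paths_assoc'[OF ru ei z])
      have 4: "homotopic_paths X ((?ru +++ ?ei) +++ ?z) ((subpath u v p +++ ?rv) +++ ?z)"
        by (rule homotopic_paths_join'[OF sq homotopic_paths_refl'[OF z] path_from_to_join[OF ru ei] z])
      have 5: "homotopic_paths X ((subpath u v p +++ ?rv) +++ ?z) (subpath u v p +++ (?rv +++ ?z))"
        by (rule homotopic_paths_assoc'[OF subX rv z])
      have 6: "homotopic_paths X ((?ru +++ reversepath (c (y i))) +++ (c (y i) +++ (?ei +++ ?z)))
          (subpath u v p +++ (?rv +++ ?z))"
        by (rule homotopic_paths_trans[OF homotopic_paths_trans[OF homotopic_paths_trans[OF 2 3] 4] 5])
      have 7: "homotopic_paths X (?P +++ ((?ru +++ reversepath (c (y i))) +++ (c (y i) +++ (?ei +++ ?z))))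
          (?P +++ (subpath u v p +++ (?rv +++ ?z)))"
        by (rule homotopic_paths_join'[OF homotopic_paths_refl'[OF P] 6 P
              path_from_to_join[OF path_from_to_join[OF ru rc[OF i]] path_from_to_join[OF cy ez]]])
      have 8: "homotopic_paths X (?P +++ (subpath u v p +++ (?rv +++ ?z))) ((?P +++ subpath u v p) +++ (?rv +++ ?z))"
        by (rule homotopic_paths_sym, rule homotopic_paths_assoc'[OF P subX path_from_to_join[OF rv z]])
      have "homotopic_paths X (?P +++ subpath u v p) ?P'"
        using homotopic_join_subpaths1[of p X 0 u v] pp uv by auto
      then have 9: "homotopic_paths X ((?P +++ subpath u v p) +++ (?rv +++ ?z)) (?P' +++ (?rv +++ ?z))"
        by (rule homotopic_paths_join'[OF _ homotopic_paths_refl'[OF path_from_to_join[OF rv z]]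
              path_from_to_join[OF P subX] path_from_to_join[OF rv z]])
      have "homotopic_paths X (a i +++ gp (y i) (y (Suc i))) (a (Suc i))"
        unfolding a_def gp_def u_def[symmetric] v_def[symmetric]
        by (rule homotopic_paths_trans[OF homotopic_paths_trans[OF homotopic_paths_trans[OF 1 7] 8] 9])
      then have "path_class X (a (Suc i)) = path_class X (a i +++ gp (y i) (y (Suc i)))"
        by (metis path_class_eqI)
      also have "\<dots> = path_class X (a i) \<otimes>\<^bsub>?G\<^esub> path_class X (gp (y i) (y (Suc i)))"
        using ai[OF i] gp[OF y(1)[OF i] y(1)[OF i'] dy] by (subst mult_path_class) (auto simp: loop)
      also have "\<dots> \<in> generate ?G S"
        by (rule generate.eng[OF Suc.IH[OF i] generate.incl])
          (use y(1)[OF i] y(1)[OF i'] dy in \<open>auto simp: S_def\<close>)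
      finally show ?case .
    qed
    from this[of n] have an: "path_class X (a n) \<in> generate ?G S" by simp
    have tn: "t n = 1" using n by (simp add: t_def)
    have eq: "y n = x0" "p (t n) = x0" using Y(4) pp tn by (auto simp: y_def)
    have cc: "c x0 = linepath x0 x0" by (simp add: c_def)
    have ss: "s x0 x0 = linepath x0 x0" using r(3)[OF x0] by (auto simp: s_def linepath_def fun_eq_iff algebra_simps)
    have 1: "homotopic_paths X (linepath x0 x0 +++ linepath x0 x0) (linepath x0 x0)"
      using homotopic_paths_lid[of "linepath x0 x0" X] x0 by simp
    have "homotopic_paths X (p +++ (linepath x0 x0 +++ linepath x0 x0)) (p +++ linepath x0 x0)"
      by (rule homotopic_paths_join'[OF homotopic_paths_refl'[OF p] 1 p path_from_to_join[OF const const]])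
    moreover have "homotopic_paths X (p +++ linepath x0 x0) p"
      using homotopic_paths_rid[of p X] p by (simp add: path_from_to_def)
    ultimately have "homotopic_paths X (p +++ (linepath x0 x0 +++ linepath x0 x0)) p"
      by (rule homotopic_paths_trans)
    then have "path_class X (a n) = A"
      unfolding a_def eq cc ss unfolding tn A by (simp add: path_class_eqI reversepath_linepath)
    then show ?thesis using an by simp
  qed
  moreover have "generate ?G S \<subseteq> carrier ?G"
    using G.generate_incl[OF SG] .
  ultimately show ?thesis using fin SG by blast
qed

section \<open>The knot exterior as a compact neighbourhood retract\<close>

lemma continuous_on_tubular_nbhd:
  assumes "tubular_nbhd k T" shows "continuous_on A T"
proof -
  have "smooth T" using assms by (simp add: tubular_nbhd_def)
  then have "\<And>x. T differentiable (at x)" by (auto elim: smooth.cases)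
  then show ?thesis
    by (meson continuous_at_imp_continuous_on differentiable_imp_continuous_within)
qed

lemma tubular_nbhd_fundamental_domain:
  assumes "tubular_nbhd k T" shows "\<exists>s'\<in>{0..1}. T (s', z) = T (s, z)"
proof -
  have "T (frac s, z) = T (s, z) \<longleftrightarrow> frac s - s \<in> \<int>"
    using assms by (simp add: tubular_nbhd_def)
  moreover have "frac s - s \<in> \<int>" by (simp add: frac_def)
  ultimately show ?thesis
    by (intro bexI[of _ "frac s"]) (auto simp: frac_ge_0 frac_lt_1 less_imp_le)
qed

text \<open>The open tube must be open in the sphere. Coning it with a radial parameter q > 0 gives
  a map between 4-dimensional spaces, so invariance of domain applies; windows of length 1 in s make
  it injective.\<close>

lemma compact_knot_exterior:
  assumes T: "tubular_nbhd k T" shows "compact (knot_exterior T)"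
proof -
  have inj: "\<And>s z s' z'. T (s, z) = T (s', z') \<longleftrightarrow> s - s' \<in> \<int> \<and> z = z'" and sph: "\<And>x. norm (T x) = 1"
    using T by (auto simp: tubular_nbhd_def image_subset_iff)
  define F where "F x = snd (snd x) *\<^sub>R T (fst x, fst (snd x))" for x :: "real \<times> complex \<times> real"
  define O' where "O' a = {a<..<a + 1} \<times> (ball 0 1 :: complex set) \<times> ({0<..} :: real set)" for a :: real
  have "open (F ` O' a)" for a
  proof (rule invariance_of_domain_gen)
    show "open (O' a)" by (auto simp: O'_def intro!: open_Times)
    have "continuous_on (O' a) (\<lambda>x. T (fst x, fst (snd x)))"
      by (rule continuous_on_compose2[OF continuous_on_tubular_nbhd[OF T, of UNIV]])
        (auto intro!: continuous_intros)
    then show "continuous_on (O' a) F" unfolding F_def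
      by (intro continuous_intros)
    show "inj_on F (O' a)"
    proof (rule inj_onI)
      fix x x' assume x: "x \<in> O' a" "x' \<in> O' a" "F x = F x'"
      obtain s z q s' z' q' where eq: "x = (s, z, q)" "x' = (s', z', q')" by (metis prod.exhaust)
      have nF: "norm (F w) = snd (snd w)" if "w \<in> O' a" for w
        using that sph by (auto simp: F_def O'_def)
      have "q = q'" using nF[OF x(1)] nF[OF x(2)] x(3) by (simp add: eq)
      then have "T (s, z) = T (s', z')" using x by (auto simp: F_def O'_def eq)
      then have "s - s' \<in> \<int>" "z = z'" using inj by auto
      moreover have "\<bar>s - s'\<bar> < 1" using x by (auto simp: O'_def eq)
      ultimately have "s = s'" by (metis Ints_nonzero_abs_less1 eq_iff_diff_eq_0)
      then show "x = x'" by (simp add: eq \<open>q = q'\<close> \<open>z = z'\<close>)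
    qed
  qed simp
  then have "open (\<Union>a. F ` O' a)" by blast
  moreover have "knot_exterior T = sphere 0 1 - (\<Union>a. F ` O' a)"
  proof -
    have *: "y \<in> T ` (UNIV \<times> ball 0 1) \<longleftrightarrow> y \<in> (\<Union>a. F ` O' a)" if y1: "y \<in> sphere 0 1" for y
    proof
      assume "y \<in> T ` (UNIV \<times> ball 0 1)"
      then obtain s z where "y = T (s, z)" "norm z < 1" by auto
      then have "y = F (s, z, 1)" "(s, z, 1) \<in> O' (s - 1/2)" by (auto simp: F_def O'_def)
      then show "y \<in> (\<Union>a. F ` O' a)" by blast
    next
      assume "y \<in> (\<Union>a. F ` O' a)"
      then obtain s z q where y: "y = q *\<^sub>R T (s, z)" "norm z < 1" "q > 0" by (auto simp: F_def O'_def)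
      then have "q = 1" using y1 sph by simp
      then show "y \<in> T ` (UNIV \<times> ball 0 1)" using y by auto
    qed
    show ?thesis unfolding knot_exterior_def using * by blast
  qed
  ultimately show ?thesis by (simp add: compact_diff)
qed

text \<open>The retraction collapses the shell \<open>1/2 \<le> \<bar>z\<bar> \<le> 1\<close> of the tube radially.\<close>

lemma knot_exterior_neighbourhood_retract:
  assumes T: "tubular_nbhd k T"
  shows "\<exists>U r. open U \<and> knot_exterior T \<subseteq> U \<and> continuous_on U r \<and> r ` U \<subseteq> knot_exterior T \<and>
    (\<forall>x\<in>knot_exterior T. r x = x)"
proof -
  let ?X = "knot_exterior T"
  have inj: "\<And>s z s' z'. T (s, z) = T (s', z') \<longleftrightarrow> s - s' \<in> \<int> \<and> z = z'" and sph: "\<And>x. norm (T x) = 1"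
    using T by (auto simp: tubular_nbhd_def image_subset_iff)
  note cT = continuous_on_tubular_nbhd[OF T]
  define C where "C = {0..1::real} \<times> (cball 0 1 - ball 0 (1/2) :: complex set)"
  have C: "compact C" unfolding C_def by (intro compact_Times compact_Icc compact_diff) auto
  define h where "h x = T (fst x, snd x / of_real (norm (snd x)))" for x
  have h: "continuous_on C h"
    unfolding h_def
    by (rule continuous_on_compose2[OF cT[of UNIV]])
      (auto intro!: continuous_intros simp: C_def)
  define pre where "pre y = (SOME x. x \<in> C \<and> T x = y)" for y
  have pre: "pre y \<in> C" "T (pre y) = y" if "y \<in> T ` C" for y
    using someI_ex[of "\<lambda>x. x \<in> C \<and> T x = y"] that by (auto simp: pre_def)
  define g where "g y = h (pre y)" for y
  have gT: "g (T x) = h x" if "x \<in> C" for x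
  proof -
    have "T (pre (T x)) = T x" using pre that by blast
    then have "fst (pre (T x)) - fst x \<in> \<int>" "snd (pre (T x)) = snd x" by (metis inj prod.collapse)+
    then show ?thesis by (simp add: g_def h_def inj)
  qed
  have closedTC: "closed (T ` C)"
    by (intro compact_imp_closed compact_continuous_image cT C)
  \<comment> \<open>\<open>T\<close> glues the ends of the compact domain \<open>C\<close>, so
    continuity is obtained from closed sets: \<open>T\<close> maps closed subsets of
    \<open>C\<close> to closed sets.\<close>
  have g: "continuous_on (T ` C) g"
    unfolding continuous_on_closed_invariant
  proof (intro allI impI)
    fix B :: "(real^4) set" assume "closed B"
    then have "closed (C \<inter> h -` B)"
      using continuous_closed_preimage[OF h compact_imp_closed[OF C]] by simp
    then have "compact (C \<inter> h -` B)" using C by (metis compact_Int_closed inf_left_idem)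
    then have "closed (T ` (C \<inter> h -` B))"
      by (intro compact_imp_closed compact_continuous_image cT)
    moreover have "T ` (C \<inter> h -` B) \<inter> T ` C = g -` B \<inter> T ` C" using gT by auto
    ultimately show "\<exists>A. closed A \<and> A \<inter> T ` C = g -` B \<inter> T ` C" by blast
  qed
  have gX: "g y \<in> ?X" if yC: "y \<in> T ` C" for y
  proof -
    obtain x where x: "x \<in> C" "y = T x" using yC by blast
    then have "norm (snd x / of_real (norm (snd x))) = 1" by (auto simp: C_def norm_divide)
    then show ?thesis using gT[OF x(1)] by (auto simp: x(2) h_def knot_exterior_def sph inj)
  qed
  define q where "q y = (if y \<in> ?X then y else g y)" for y
  have q: "continuous_on (?X \<union> T ` C) q"
    unfolding q_def
  proof (rule continuous_on_cases)
    show "closed ?X" using compact_knot_exterior[OF T] by (rule compact_imp_closed)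
    show "\<forall>x. x \<in> ?X \<and> x \<notin> ?X \<or> x \<in> T ` C \<and> x \<in> ?X \<longrightarrow> x = g x"
    proof (intro allI impI)
      fix y assume "y \<in> ?X \<and> y \<notin> ?X \<or> y \<in> T ` C \<and> y \<in> ?X"
      then obtain s z where y: "y = T (s, z)" "(s, z) \<in> C" "y \<in> ?X" by auto
      then have "norm z = 1" by (force simp: knot_exterior_def C_def)
      then show "y = g y" using gT[OF y(2)] by (simp add: y(1) h_def)
    qed
  qed (auto intro: closedTC g)
  define K where "K = T ` ({0..1} \<times> cball 0 (1/2))"
  have K: "closed K"
    unfolding K_def by (intro compact_imp_closed compact_continuous_image cT compact_Times) auto
  have cover: "y \<in> ?X \<union> T ` C" if y1: "norm y = 1" and yK: "y \<notin> K" for y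
  proof (cases "y \<in> ?X")
    case False
    then obtain s z where y: "y = T (s, z)" "norm z < 1" using y1 by (auto simp: knot_exterior_def)
    obtain s' where s': "s' \<in> {0..1}" "T (s', z) = T (s, z)" using tubular_nbhd_fundamental_domain[OF T] by blast
    have "norm z > 1/2"
    proof (rule ccontr)
      assume "\<not> ?thesis"
      then have "(s', z) \<in> {0..1} \<times> cball 0 (1/2)" using s' by simp
      then have "y \<in> K" unfolding K_def y(1) s'(2)[symmetric] by (rule imageI)
      then show False using yK by simp
    qed
    then have "(s', z) \<in> C" using y s' by (auto simp: C_def)
    then show ?thesis using y s' by (metis UnI2 image_eqI)
  qed simp
  \<comment> \<open>Radial projection thickens the complement of the half-radius tube
    \<open>K\<close> in the sphere to an open subset of the ambient 4-space.\<close>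
  define U where "U = {x :: real^4. x \<noteq> 0 \<and> x /\<^sub>R norm x \<notin> K}"
  have cn: "continuous_on (- {0}) (\<lambda>x :: real^4. x /\<^sub>R norm x)"
    by (auto intro!: continuous_intros)
  have "open ((\<lambda>x :: real^4. x /\<^sub>R norm x) -` (- K) \<inter> - {0})"
    using continuous_on_open_vimage[THEN iffD1, rule_format, OF _ cn, of "- K"] K by auto
  moreover have "U = (\<lambda>x :: real^4. x /\<^sub>R norm x) -` (- K) \<inter> - {0}" by (auto simp: U_def)
  ultimately have "open U" by simp
  have XK: "x \<notin> K" if "x \<in> ?X" for x
    using that by (auto simp: knot_exterior_def K_def)
  have X1: "norm x = 1" if "x \<in> ?X" for x using that by (simp add: knot_exterior_def)
  have "?X \<subseteq> U" using XK X1 by (fastforce simp: U_def)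
  moreover have img: "(\<lambda>x. x /\<^sub>R norm x) ` U \<subseteq> ?X \<union> T ` C"
  proof (rule image_subsetI)
    fix y assume "y \<in> U"
    then have "norm (y /\<^sub>R norm y) = 1" "y /\<^sub>R norm y \<notin> K" by (auto simp: U_def)
    then show "y /\<^sub>R norm y \<in> ?X \<union> T ` C" by (rule cover)
  qed
  moreover have "continuous_on U (\<lambda>x. q (x /\<^sub>R norm x))"
    by (rule continuous_on_compose2[OF q continuous_on_subset[OF cn] img]) (auto simp: U_def)
  moreover have "q y \<in> ?X" if "y \<in> ?X \<union> T ` C" for y
    using that gX by (auto simp: q_def)
  then have "(\<lambda>x. q (x /\<^sub>R norm x)) ` U \<subseteq> ?X" using img by blast
  moreover have "\<forall>x\<in>?X. q (x /\<^sub>R norm x) = x" using X1 by (simp add: q_def)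
  ultimately show ?thesis using \<open>open U\<close> by blast
qed

theorem knot_group_finitely_generated:
  assumes "tubular_nbhd k T" "x0 \<in> knot_exterior T"
  shows "\<exists>S. finite S \<and> S \<subseteq> carrier (fundamental_group (knot_exterior T) x0) \<and>
    carrier (fundamental_group (knot_exterior T) x0) = generate (fundamental_group (knot_exterior T) x0) S"
proof -
  obtain U r where "open U" "knot_exterior T \<subseteq> U" "continuous_on U r" "r ` U \<subseteq> knot_exterior T"
    "\<And>x. x \<in> knot_exterior T \<Longrightarrow> r x = x"
    using knot_exterior_neighbourhood_retract[OF assms(1)] by blast
  then show ?thesis
    by (rule fundamental_group_finitely_generated[OF compact_knot_exterior[OF assms(1)] assms(2)])
qed


section \<open>Reducible points of components with irreducible representations\<close>

text \<open>Serves to exchange the two blocks: the index types \<open>'a + 'b\<close> and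
  \<open>'b + 'a\<close> differ.\<close>

definition reindex :: "('m \<Rightarrow> 'n) \<Rightarrow> complex^'n^'n \<Rightarrow> complex^'m^'m" where
  "reindex e M = (\<chi> i j. M $ e i $ e j)"

lemma reindex_mult:
  assumes "bij e" shows "reindex e (M ** N) = reindex e M ** reindex e N"
  unfolding vec_eq_iff
proof (intro allI)
  fix i j
  show "reindex e (M ** N) $ i $ j = (reindex e M ** reindex e N) $ i $ j"
    using sum.reindex_bij_betw[OF assms, of "\<lambda>k. M $ e i $ k * N $ k $ e j"]
    by (simp add: reindex_def matrix_matrix_mult_def)
qed

lemma reindex_one: assumes "bij e" shows "reindex e (mat 1) = mat 1"
  using assms by (simp add: reindex_def vec_eq_iff mat_def bij_def inj_eq)

lemma irreducible_rep_reindex: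
  fixes \<sigma> :: "'g \<Rightarrow> complex^'n^'n" and e :: "'m::finite \<Rightarrow> 'n"
  assumes e: "bij e" and irr: "irreducible_rep G \<sigma>"
  shows "irreducible_rep G (\<lambda>g. reindex e (\<sigma> g))"
  unfolding irreducible_rep_def
proof (intro allI impI)
  fix W :: "(complex^'m) set"
  assume W: "vec.subspace W \<and> (\<forall>g\<in>carrier G. \<forall>w\<in>W. reindex e (\<sigma> g) *v w \<in> W)"
  define r where "r v = (\<chi> i. v $ e i)" for v :: "complex^'n"
  have r_mv: "r (M *v v) = reindex e M *v r v" for M v
    unfolding vec_eq_iff
  proof (intro allI)
    fix i
    show "r (M *v v) $ i = (reindex e M *v r v) $ i"
      using sum.reindex_bij_betw[OF e, of "\<lambda>k. M $ e i $ k * v $ k"]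
      by (simp add: r_def reindex_def matrix_vector_mult_def)
  qed
  have r_lin: "r 0 = 0" "r (u + v) = r u + r v" "r (c *s v) = c *s r v" for u v c
    by (simp_all add: r_def vec_eq_iff)
  have surj: "\<exists>v. w = r v" for w
    by (rule exI[of _ "\<chi> k. w $ inv_into UNIV e k"]) (use e in \<open>simp add: r_def vec_eq_iff bij_def\<close>)
  have inj: "r u = r v \<Longrightarrow> u = v" for u v
    using e by (simp add: r_def vec_eq_iff bij_def) (metis surjD)
  let ?V = "{v. r v \<in> W}"
  have "vec.subspace ?V"
    using W by (auto simp: vec.subspace_def r_lin)
  moreover have "\<forall>g\<in>carrier G. \<forall>v\<in>?V. \<sigma> g *v v \<in> ?V"
    using W by (simp add: r_mv)
  ultimately have "?V = {0} \<or> ?V = UNIV" using irr unfolding irreducible_rep_def by blast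
  then show "W = {0} \<or> W = UNIV"
  proof
    assume V: "?V = {0}"
    have "w = 0" if "w \<in> W" for w
    proof -
      obtain v where v: "w = r v" using surj by blast
      then have "v \<in> ?V" using that by simp
      then show ?thesis using V v r_lin(1) by simp
    qed
    then show ?thesis using W vec.subspace_0 by blast
  next
    assume V: "?V = UNIV"
    have "w \<in> W" for w
    proof -
      obtain v where v: "w = r v" using surj by blast
      have "v \<in> ?V" unfolding V by simp
      then show ?thesis using v by simp
    qed
    then show ?thesis by blast
  qed
qed

text \<open>The functions on an irreducible set \<open>Z\<close> are realised on the whole type by precomposing with a map
  onto \<open>Z\<close>.\<close>

lemma rep_family_of_irreducible:
  fixes Z :: "('g \<Rightarrow> complex^'n^'n) set" and e :: "'m::finite \<Rightarrow> 'n"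
  assumes G: "group G" and S: "finite S" "S \<subseteq> carrier G" "carrier G = generate G S"
    and Z: "zariski_irreducible G Z" and \<rho>0: "\<rho>0 \<in> Z" and e: "bij e"
  shows "\<exists>Y. rep_family Y \<rho>0 G (\<lambda>\<rho> g. reindex e ((if \<rho> \<in> Z then \<rho> else \<rho>0) g))"
proof -
  interpret group G by (rule G)
  define \<pi> where "\<pi> \<rho> = (if \<rho> \<in> Z then \<rho> else \<rho>0)" for \<rho>
  have \<pi>Z: "\<pi> \<rho> \<in> Z" for \<rho> using \<rho>0 by (simp add: \<pi>_def)
  have ZR: "Z \<subseteq> rep_variety G" using Z by (simp add: zariski_irreducible_def)
  have hom: "\<pi> \<rho> \<in> hom G SL" for \<rho> using \<pi>Z ZR by (auto simp: rep_variety_def)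
  note facts = SL_hom_facts[OF G hom]
  define R where "R \<rho> g = reindex e (\<pi> \<rho> g)" for \<rho> g
  define entry where "entry s = (\<lambda>\<rho>. R \<rho> (fst s) $ fst (snd s) $ snd (snd s))" for s
  \<comment> \<open>Entries at the inverses of the generators are included, so that induction over
    generated elements covers inverses directly.\<close>
  define Y where "Y = entry ` ((S \<union> m_inv G ` S) \<times> UNIV \<times> UNIV)"
  have SG: "s \<in> carrier G" if "s \<in> S \<union> m_inv G ` S" for s using that S(2) by auto
  have R_mult: "R \<rho> (g \<otimes>\<^bsub>G\<^esub> h) = R \<rho> g ** R \<rho> h" if "g \<in> carrier G" "h \<in> carrier G" for \<rho> g h
    using that by (simp add: R_def facts reindex_mult[OF e])
  have R_one: "R \<rho> \<one>\<^bsub>G\<^esub> = mat 1" for \<rho> by (simp add: R_def facts reindex_one[OF e])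
  have poly: "\<exists>f\<in>polynomial_functions G. \<forall>\<rho>. u \<rho> = f (\<pi> \<rho>)" if "u \<in> function_algebra Y" for u
    using that unfolding function_algebra_def
  proof induction
    case (base c)
    then obtain a where "c = (\<lambda>_. a)" by (auto simp: const_funs_def)
    then show ?case by (intro bexI[OF _ polynomial_functions.const[of a]]) simp
  next
    case (gen y)
    then obtain x where x: "x \<in> (S \<union> m_inv G ` S) \<times> UNIV \<times> UNIV" "y = entry x"
      unfolding Y_def by (rule imageE)
    obtain s i j where "x = (s, i, j)" by (metis prod.exhaust)
    with x have s: "s \<in> S \<union> m_inv G ` S" "y = (\<lambda>\<rho>. R \<rho> s $ i $ j)"
      by (simp_all add: entry_def)
    then show ?case
      by (intro bexI[OF _ polynomial_functions.entry[OF SG[OF s(1)], of "e i" "e j"]]) (simp add: R_def reindex_def)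
  next
    case (add x y)
    then obtain f h where "f \<in> polynomial_functions G" "h \<in> polynomial_functions G"
      "\<forall>\<rho>. x \<rho> = f (\<pi> \<rho>)" "\<forall>\<rho>. y \<rho> = h (\<pi> \<rho>)" by blast
    then show ?case by (intro bexI[OF _ polynomial_functions.add[of f G h]]) auto
  next
    case (mult x y)
    then obtain f h where "f \<in> polynomial_functions G" "h \<in> polynomial_functions G"
      "\<forall>\<rho>. x \<rho> = f (\<pi> \<rho>)" "\<forall>\<rho>. y \<rho> = h (\<pi> \<rho>)" by blast
    then show ?case by (intro bexI[OF _ polynomial_functions.mult[of f G h]]) auto
  qed
  \<comment> \<open>If a product vanishes, \<open>Z\<close> is covered by the zero sets of the two
    factors, and irreducibility puts it into one of them.\<close>
  have dom: "u = 0 \<or> v = 0" if u: "u \<in> function_algebra Y" and v: "v \<in> function_algebra Y" and uv: "u * v = 0" for u v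
  proof -
    obtain f where f: "f \<in> polynomial_functions G" "\<And>\<rho>. u \<rho> = f (\<pi> \<rho>)" using poly[OF u] by blast
    obtain h where h: "h \<in> polynomial_functions G" "\<And>\<rho>. v \<rho> = h (\<pi> \<rho>)" using poly[OF v] by blast
    define zeros where "zeros f = {\<rho> \<in> rep_variety G. f \<rho> = 0}" for f :: "('g \<Rightarrow> complex^'n^'n) \<Rightarrow> complex"
    have closed: "zariski_closed G (zeros f)" if "f \<in> polynomial_functions G" for f
      unfolding zariski_closed_def zeros_def by (rule exI[of _ "{f}"]) (use that in auto)
    have "Z \<subseteq> zeros f \<union> zeros h"
    proof
      fix \<rho> assume \<rho>: "\<rho> \<in> Z"
      have "u \<rho> * v \<rho> = 0" using fun_cong[OF uv, of \<rho>] by simp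
      then have "f \<rho> * h \<rho> = 0" using f(2)[of \<rho>] h(2)[of \<rho>] \<rho> by (simp add: \<pi>_def)
      then show "\<rho> \<in> zeros f \<union> zeros h" using \<rho> ZR by (auto simp: zeros_def)
    qed
    then have "Z \<subseteq> zeros f \<or> Z \<subseteq> zeros h"
      using Z closed[OF f(1)] closed[OF h(1)] unfolding zariski_irreducible_def by blast
    moreover have "u = 0" if "Z \<subseteq> zeros f"
      using that \<pi>Z f(2) by (auto simp: fun_eq_iff zeros_def)
    moreover have "v = 0" if "Z \<subseteq> zeros h"
      using that \<pi>Z h(2) by (auto simp: fun_eq_iff zeros_def)
    ultimately show ?thesis by blast
  qed
  interpret F: max_ideal_filtration Y \<rho>0 .
  have gen: "entries_in (F.ipow 0) (\<lambda>\<rho>. R \<rho> s)" if "s \<in> S \<union> m_inv G ` S" for s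
  proof -
    have "(\<lambda>\<rho>. R \<rho> s $ i $ j) \<in> Y" for i j
      unfolding Y_def entry_def using that by (intro image_eqI[of _ _ "(s, i, j)"]) auto
    then show ?thesis by (auto simp: entries_in_def function_algebra_def intro: subring_gen.gen)
  qed
  have ent: "entries_in (F.ipow 0) (\<lambda>\<rho>. R \<rho> g)" if "g \<in> carrier G" for g
    using that unfolding S(3)
  proof induction
    case one
    then show ?case using F.ent_const[of "mat 1"] by (simp add: R_one)
  next
    case (eng h1 h2)
    then have "h1 \<in> carrier G" "h2 \<in> carrier G" by (simp_all add: S(3))
    then show ?case using F.ent_mult_left[OF eng.IH] by (simp add: R_mult)
  qed (use gen in auto)
  have "rep_family Y \<rho>0 G R"
    by unfold_locales (use S(1) dom R_mult R_one ent in \<open>auto simp: Y_def\<close>)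
  then show ?thesis unfolding R_def \<pi>_def by blast
qed

lemma det_card_1:
  fixes A :: "complex^'n^'n"
  assumes "CARD('n) = 1" shows "A = matrix_smult (det A) (mat 1)"
proof -
  obtain i where i: "(UNIV :: 'n set) = {i}" using assms by (metis card_1_singletonE)
  have "det A = A $ i $ i" by (simp add: det_def i permutes_sing)
  moreover have "j = i" for j using i by (metis UNIV_I singletonD)
  ultimately show ?thesis by (simp add: vec_eq_iff mat_def) metis
qed

lemma blk_block_diag:
  "blk11 (block_diag A B) = A" "blk12 (block_diag A B) = 0" "blk21 (block_diag A B) = 0" "blk22 (block_diag A B) = B"
  by (simp_all add: vec_eq_iff blk_defs block_diag_def)

lemma blk_scalar:
  "blk11 (matrix_smult c (mat 1)) = matrix_smult c (mat 1)" "blk12 (matrix_smult c (mat 1)) = 0"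
  "blk21 (matrix_smult c (mat 1)) = 0" "blk22 (matrix_smult c (mat 1)) = matrix_smult c (mat 1)"
  by (simp_all add: vec_eq_iff blk_defs mat_def)

text \<open>The twists y, w and the bijection e are left free so that both vanishing statements are
  instances, with (y, w) equal to (\<lambda>^b, \<lambda>^(-a)) or the reverse.\<close>

lemma laurent_eval_eq_0:
  fixes \<alpha> :: "'g \<Rightarrow> complex^'a^'a" and \<beta> :: "'g \<Rightarrow> complex^'b^'b"
    and Z :: "('g \<Rightarrow> complex^'n^'n) set" and e :: "'a + 'b \<Rightarrow> 'n"
  assumes G: "group G" and S: "finite S" "S \<subseteq> carrier G" "carrier G = generate G S"
    and \<phi>_ab: "\<phi> \<in> hom G integer_group" "\<phi> ` carrier G = UNIV"
      "kernel G integer_group \<phi> = derived G (carrier G)"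
    and \<alpha>_reg: "\<alpha> \<in> hom G SL" "irreducible_rep G \<alpha>" "infinitesimally_regular G \<alpha>"
    and \<beta>_reg: "\<beta> \<in> hom G SL" "irreducible_rep G \<beta>" "infinitesimally_regular G \<beta>"
    and yw: "y \<noteq> 0" "w \<noteq> 0"
    and Z: "zariski_irreducible G Z" "\<rho>0 \<in> Z" "\<sigma> \<in> Z" "irreducible_rep G \<sigma>" and e: "bij e"
    and \<rho>0: "\<And>g. g \<in> carrier G \<Longrightarrow> reindex e (\<rho>0 g) =
        block_diag (matrix_smult (y powi \<phi> g) (\<alpha> g)) (matrix_smult (w powi \<phi> g) (\<beta> g))"
    and \<Delta>: "is_twisted_alexander G \<phi> matrix_smult (tensor_dual \<alpha> \<beta>) 1 \<Delta>"
  shows "laurent_eval \<Delta> (y / w) = 0"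
proof (rule ccontr)
  assume nz: "laurent_eval \<Delta> (y / w) \<noteq> 0"
  interpret group G by (rule G)
  interpret rep_pair G \<phi> \<alpha> \<beta> "y / w"
    by unfold_locales (use \<phi>_ab \<alpha>_reg \<beta>_reg yw in auto)
  obtain \<mu> where \<mu>: "\<mu> \<in> carrier G" "\<phi> \<mu> = 1" using \<phi>_ab(2) by (metis UNIV_I imageE)
  obtain Y where Y: "rep_family Y \<rho>0 G (\<lambda>\<rho> g. reindex e ((if \<rho> \<in> Z then \<rho> else \<rho>0) g))"
    using rep_family_of_irreducible[OF G S Z(1,2) e] by blast
  define R where "R \<rho> g = reindex e ((if \<rho> \<in> Z then \<rho> else \<rho>0) g)" for \<rho> g
  have R\<sigma>: "irreducible_rep G (R \<sigma>)"
    using irreducible_rep_reindex[OF e Z(4)] Z(3) by (simp add: R_def[abs_def])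
  interpret F: rep_family Y \<rho>0 G R using Y unfolding R_def[abs_def] .
  have R0: "R \<rho>0 g = block_diag (matrix_smult (y powi \<phi> g) (\<alpha> g)) (matrix_smult (w powi \<phi> g) (\<beta> g))"
    if "g \<in> carrier G" for g using \<rho>0[OF that] Z(2) by (simp add: R_def)
  show False
  proof (cases "\<exists>P. P \<noteq> 0 \<and> (\<forall>g\<in>carrier G. dual_action g P = P)")
    case False
    interpret B: block_rep_family Y \<rho>0 G R
      by unfold_locales (simp add: R0 blk_block_diag)
    have hact: "B.hact g X = dual_action g X" if "g \<in> carrier G" for g X
      using that yw
      by (simp add: B.hact_def B.A'_def B.B'_def R0 blk_block_diag dual_action_def phi_inv matrix_smult_mult_left
          matrix_smult_mult_right power_int_minus power_int_divide_distrib field_simps)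
    have "\<not> irreducible_rep G (R \<sigma>)"
    proof (rule B.no_irreducible_member)
      fix X assume "\<And>g. g \<in> carrier G \<Longrightarrow> B.hact g X = X"
      then show "X = 0" using False hact by auto
    next
      fix z assume z: "\<And>g h. g \<in> carrier G \<Longrightarrow> h \<in> carrier G \<Longrightarrow> z (g \<otimes>\<^bsub>G\<^esub> h) = z g + B.hact g (z h)"
      have "\<exists>B. \<forall>g\<in>carrier G. z g = dual_action g B - B"
        by (rule H1_vanishes[OF \<mu> _ \<Delta> nz]) (use False z hact in auto)
      then show "\<exists>X. \<forall>g\<in>carrier G. z g = B.hact g X - X" using hact by auto
    qed
    then show False using R\<sigma> by simp
  next
    case True
    then obtain P where P: "P \<noteq> 0" "\<And>g. g \<in> carrier G \<Longrightarrow> dual_action g P = P" by blast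
    have card: "CARD('a) = 1" "CARD('b) = 1"
      using one_dimensional_if_intertwined[OF \<mu> \<alpha>_reg(2) \<beta>_reg(2) \<alpha>_reg(3) \<beta>_reg(3) P(2,1) \<Delta> nz] by blast+
    have one: "\<alpha> g = mat 1" "\<beta> g = mat 1" if "g \<in> carrier G" for g
      using det_card_1[OF card(1), of "\<alpha> g"] det_card_1[OF card(2), of "\<beta> g"] that
      by (simp_all add: alpha_facts beta_facts)
    \<comment> \<open>In dimension one \<alpha> and \<beta> are trivial, so invariance at \<mu>
      compares only the twists and gives w = y; the point \<rho>0 is therefore scalar.\<close>
    have "matrix_smult (w / y) P = P"
      using P(2)[OF \<mu>(1)] \<mu> by (simp add: dual_action_def one power_int_minus)
    then have "matrix_smult (w / y - 1) P = 0" by (simp add: mat_space.scale_left_diff_distrib)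
    then have "w = y" using P(1) yw by (simp add: field_simps)
    have "\<not> irreducible_rep G (R \<sigma>)"
    proof (rule F.no_irreducible_member_near_scalar[OF \<phi>_ab(1) \<mu> \<phi>_ab(3)])
      show "R \<rho>0 g = matrix_smult (y powi \<phi> g) (mat 1)" if "g \<in> carrier G" for g
        using that
        by (intro blk_eqI) (simp_all only: R0 one blk_block_diag blk_scalar \<open>w = y\<close>)
      show "CARD('a + 'b) \<noteq> 1" by (simp add: card)
    qed simp
    then show False using R\<sigma> by simp
  qed
qed

theorem theorem1p3:
  fixes k :: "real \<Rightarrow> real^4"
    and T :: "real \<times> complex \<Rightarrow> real^4"
    and x0 :: "real^4"
    and \<Gamma> :: "(real \<Rightarrow> real^4) set monoid"
    and \<phi> :: "(real \<Rightarrow> real^4) set \<Rightarrow> int"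
    and \<alpha> :: "(real \<Rightarrow> real^4) set \<Rightarrow> complex^'a^'a"
    and \<beta> :: "(real \<Rightarrow> real^4) set \<Rightarrow> complex^'b^'b"
    and l :: complex
    and \<Delta>plus \<Delta>minus :: laurent
  assumes knot: "oriented_knot k" "tubular_nbhd k T"
    and group: "x0 \<in> knot_exterior T" "\<Gamma> = fundamental_group (knot_exterior T) x0"
    and phi: "knot_abelianization T x0 \<phi>"
    and alpha: "\<alpha> \<in> rep_variety \<Gamma>" "irreducible_rep \<Gamma> \<alpha>" "infinitesimally_regular \<Gamma> \<alpha>"
    and beta: "\<beta> \<in> rep_variety \<Gamma>" "irreducible_rep \<Gamma> \<beta>" "infinitesimally_regular \<Gamma> \<beta>"
    and l: "l \<noteq> 0"
    and deform: "deformable_to_irreducible \<Gamma> (rho_sum \<Gamma> \<phi> l \<alpha> \<beta>)"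
    and plus: "is_twisted_alexander \<Gamma> \<phi> matrix_smult (tensor_dual \<alpha> \<beta>) 1 \<Delta>plus"
    and minus: "is_twisted_alexander \<Gamma> \<phi> matrix_smult (tensor_dual \<beta> \<alpha>) 1 \<Delta>minus"
  shows "laurent_eval \<Delta>plus (l powi int (CARD('a) + CARD('b))) = 0 \<and>
         laurent_eval \<Delta>minus (l powi (- int (CARD('a) + CARD('b)))) = 0"
proof -
  have G: "Group.group \<Gamma>" unfolding group(2) by (rule group_fundamental_group[OF group(1)])
  obtain S where S: "finite S" "S \<subseteq> carrier \<Gamma>" "carrier \<Gamma> = generate \<Gamma> S"
    using knot_group_finitely_generated[OF knot(2) group(1)] unfolding group(2) by blast
  have \<phi>: "\<phi> \<in> hom \<Gamma> integer_group" "\<phi> ` carrier \<Gamma> = UNIV" "kernel \<Gamma> integer_group \<phi> = derived \<Gamma> (carrier \<Gamma>)"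
    using phi unfolding knot_abelianization_def Let_def group(2) by blast+
  let ?\<rho> = "rho_sum \<Gamma> \<phi> l \<alpha> \<beta>"
  obtain Z \<sigma> where Z: "zariski_irreducible \<Gamma> Z" "?\<rho> \<in> Z" "\<sigma> \<in> Z" "irreducible_rep \<Gamma> \<sigma>"
    using deform unfolding deformable_to_irreducible_def irreducible_component_def by blast
  have hom: "\<alpha> \<in> hom \<Gamma> SL" "\<beta> \<in> hom \<Gamma> SL" using alpha(1) beta(1) by (auto simp: rep_variety_def)
  let ?y = "l powi int CARD('b)" and ?w = "l powi (- int CARD('a))"
  have yw: "?y \<noteq> 0" "?w \<noteq> 0" using l by simp_all
  have rho: "?\<rho> g = block_diag (matrix_smult (?y powi \<phi> g) (\<alpha> g)) (matrix_smult (?w powi \<phi> g) (\<beta> g))"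
    if "g \<in> carrier \<Gamma>" for g
    using that by (simp only: rho_sum_def restrict_apply if_True power_int_mult)
  have "laurent_eval \<Delta>plus (?y / ?w) = 0"
  proof (rule laurent_eval_eq_0[OF G S \<phi> hom(1) alpha(2,3) hom(2) beta(2,3) yw Z bij_id _ plus])
    show "reindex id (?\<rho> g) = block_diag (matrix_smult (?y powi \<phi> g) (\<alpha> g)) (matrix_smult (?w powi \<phi> g) (\<beta> g))"
      if "g \<in> carrier \<Gamma>" for g
      using rho[OF that] by (simp add: reindex_def vec_eq_iff)
  qed
  moreover have "?y / ?w = l powi int (CARD('a) + CARD('b))"
    using l by (simp add: power_int_add power_int_minus field_simps)
  moreover
  let ?s = "case_sum Inr Inl :: 'b + 'a \<Rightarrow> 'a + 'b"
  have s: "bij ?s"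
    by (rule bij_betw_byWitness[where f' = "case_sum Inr Inl"]) (auto split: sum.splits)
  have "laurent_eval \<Delta>minus (?w / ?y) = 0"
  proof (rule laurent_eval_eq_0[OF G S \<phi> hom(2) beta(2,3) hom(1) alpha(2,3) yw(2,1) Z s _ minus])
    show "reindex ?s (?\<rho> g) = block_diag (matrix_smult (?w powi \<phi> g) (\<beta> g)) (matrix_smult (?y powi \<phi> g) (\<alpha> g))"
      if "g \<in> carrier \<Gamma>" for g
      unfolding rho[OF that] by (simp add: reindex_def vec_eq_iff block_diag_def split: sum.splits)
  qed
  moreover have "?w / ?y = l powi (- int (CARD('a) + CARD('b)))"
    using power_int_diff[of l "- int CARD('a)" "int CARD('b)"] l by (simp add: algebra_simps)
  ultimately show ?thesis by simp
qed

end
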